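(* An $(\ell_0,\ell_2)$ constant mean curvature (cmc) torus of revolution in $\mathbb{S}^3$ is embedded if and only if $\ell_0=1$.
   Context: Equivariant cmc surfaces. Let $q\in[-1,1]\setminus\{0\}$ and let $\lambda_j=e^{2i\theta_j}$ ($j=1,2$) be two distinct points of $\mathbb{S}^1$ (sym points). Put $\varphi=\theta_1-\theta_2$, $k=\cos(\theta_1+\theta_2)$, $h=\cos(\theta_1-\theta_2)$, and let $v=\mathrm{dn}(y,1-q^2)$ (Jacobi function with parameter $1-q^2$). The associated equivariant cmc surface is the immersion $f:\mathbb{R}^2\to\mathbb{S}^3$, unique up to isometry, with induced metric $\sin^2\varphi\,v^2(dx^2+dy^2)$ and second fundamental form $H\sin^2\varphi\,v^2(dx^2+dy^2)+\mathrm{Re}\left(Q\,(dx+i\,dy)^2\right)$, $H=\cot\varphi$, $Q=\frac{i}{2}q(\lambda_2^{-1}-\lambda_1^{-1})$. It is a surface of revolution iff $\lambda_2=\lambda_1^{-1}$, i.e. $k^2=1$. For $q=\pm1$ it is flat; for $0<|q|<1$ it has spectral genus one. Flow. With $K'=K(\sqrt{1-q^2})$, $E'=E(\sqrt{1-q^2})$ complete elliptic integrals (of modulus $\sqrt{1-q^2}$), families of equivariant cmc tori are integral curves of $\dot q=q(E'k-qK'h)$, $\dot k=\frac{1-k^2}{1-q^2}((1+q^2)E'-2q^2K')$, $\dot h=q\frac{1-h^2}{1-q^2}(2E'-(1+q^2)K')$, along which the period lattice varies continuously. Tori of revolution ($k^2=1$) stay tori of revolution, and along each such family $|q|$ varies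 between $1$ (a flat cmc torus) and the limit $0$ (a sphere bouquet). $(\ell_0,\ell_2)$ tori. For a flat torus of revolution obtained at $q=\pm1$ with sym points $\lambda_1$, $\lambda_2=\lambda_1^{-1}$, put $\lambda_0=\mathrm{sign}(q)$ (a double point of its spectral curve), $m=(\lambda_0^{1/2},\lambda_1^{1/2},\lambda_2^{1/2})$, let $(s_0,s_1,s_2)$ be an integral real multiple of the real vector $i\,m\times\bar m$ with $\gcd(s_0,s_1+s_2,s_1-s_2)=2$, and set $(\ell_0,\ell_1,\ell_2)=\frac12(|s_0|,\min|s_1\pm s_2|,\max|s_1\pm s_2|)$. Then $\ell_1=0$, $0<\ell_0<\ell_2$, $\gcd(\ell_0,\ell_2)=1$. In coordinates in which the flat immersion is $F_{\lambda_1}F_{\lambda_2}^{-1}$ with $F_\lambda(z)=\exp\left(\pi i\begin{pmatrix}0& z\lambda^{-1}+\bar z\\ z+\bar z\lambda&0\end{pmatrix}\right)$, the $(\ell_0,0,\ell_2)$ flat torus has period lattice $\{\gamma\in\mathbb{C}:\ \mathrm{Re}(\gamma\bar\kappa_1),\mathrm{Re}(\gamma\bar\kappa_2),\mathrm{Re}(\gamma\overline{\lambda_0^{1/2}})\in\mathbb{Z}\}$, where $\kappa_{1}=\frac12(\lambda_1^{1/2}+\lambda_2^{1/2})$, $\kappa_2=\frac12(\lambda_1^{1/2}-\lambda_2^{1/2})$. An $(\ell_0,\ell_2)$ torus of revolution is a torus in the family of tori of revolution (with $0<|q|\le1$) starting at the $(\ell_0,0,\ell_2)$ flat cmc torus at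 $|q|=1$.
   Formalization: The period lattice of the flat torus is defined with 2Re in place of Re in its three integrality conditions, as the stated normalisation of F_λ requires; with Re the lattice has index 4 in the correct one and no such torus would be embedded. *)

theory Defs
  imports "HOL-Analysis.Analysis"
begin

section \<open>Elliptic integrals and the Jacobi function dn\<close>

definition elliptic_K :: "real \<Rightarrow> real" where
  "elliptic_K \<kappa> = integral {0..pi/2} (\<lambda>t. 1 / sqrt (1 - \<kappa>^2 * (sin t)^2))"

definition elliptic_E :: "real \<Rightarrow> real" where
  "elliptic_E \<kappa> = integral {0..pi/2} (\<lambda>t. sqrt (1 - \<kappa>^2 * (sin t)^2))"

text \<open>The complete integrals above take the modulus \<open>\<kappa>\<close>; the functions below take the
  parameter \<open>m = \<kappa>\<^sup>2\<close> (used only for \<open>0 \<le> m < 1\<close>, where the incomplete integral is an increasing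
  bijection of the real line). The interval integral is oriented, so that \<open>jacobi_am m\<close> is odd.\<close>

definition elliptic_F :: "real \<Rightarrow> real \<Rightarrow> real" where
  "elliptic_F m x = (LBINT t=ereal 0..ereal x. 1 / sqrt (1 - m * (sin t)^2))"

definition jacobi_am :: "real \<Rightarrow> real \<Rightarrow> real" where
  "jacobi_am m y = (THE x. elliptic_F m x = y)"

definition jacobi_dn :: "real \<Rightarrow> real \<Rightarrow> real" where
  "jacobi_dn y m = sqrt (1 - m * (sin (jacobi_am m y))^2)"


section \<open>Surfaces in the 3-sphere\<close>

text \<open>The parameter plane is \<^typ>\<open>complex\<close>, regarded as a real vector space with
  \<open>z = x + i y\<close>; the 3-sphere is the unit sphere of \<open>real ^ 4\<close>.\<close>

definition dir_deriv :: "complex \<Rightarrow> (complex \<Rightarrow> real ^ 4) \<Rightarrow> complex \<Rightarrow> real ^ 4" where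
  "dir_deriv w f z = frechet_derivative f (at z) w"

text \<open>Infinitely differentiable: every iterated directional derivative is differentiable.\<close>

definition smooth_map :: "(complex \<Rightarrow> real ^ 4) \<Rightarrow> bool" where
  "smooth_map f \<longleftrightarrow> (\<forall>ws. fold dir_deriv ws f differentiable_on UNIV)"

definition first_form :: "(complex \<Rightarrow> real ^ 4) \<Rightarrow> complex \<Rightarrow> complex \<Rightarrow> real" where
  "first_form f z w = inner (dir_deriv w f z) (dir_deriv w f z)"

definition second_form ::
  "(complex \<Rightarrow> real ^ 4) \<Rightarrow> (complex \<Rightarrow> real ^ 4) \<Rightarrow> complex \<Rightarrow> complex \<Rightarrow> real" where
  "second_form f N z w = inner (dir_deriv w (dir_deriv w f) z) (N z)"

text \<open>The normal is tangent to the sphere. Either of the two unit normal fields is admitted, which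
  corresponds to uniqueness of the immersion up to all isometries of the sphere.\<close>

definition unit_normal_field :: "(complex \<Rightarrow> real ^ 4) \<Rightarrow> (complex \<Rightarrow> real ^ 4) \<Rightarrow> bool" where
  "unit_normal_field f N \<longleftrightarrow> continuous_on UNIV N \<and>
     (\<forall>z. norm (N z) = 1 \<and> inner (N z) (f z) = 0 \<and> (\<forall>w. inner (N z) (dir_deriv w f z) = 0))"


section \<open>Equivariant cmc surfaces\<close>

definition sym_point :: "real \<Rightarrow> complex" where
  "sym_point \<theta> = cis (2 * \<theta>)"

definition hopf :: "real \<Rightarrow> real \<Rightarrow> real \<Rightarrow> complex" where
  "hopf q \<theta>1 \<theta>2 = \<i> / 2 * of_real q * (inverse (sym_point \<theta>2) - inverse (sym_point \<theta>1))"

text \<open>The two fundamental forms are stated as quadratic forms: evaluated at a tangent vector \<open>w\<close>,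
  \<open>dx\<^sup>2 + dy\<^sup>2\<close> is \<open>\<bar>w\<bar>\<^sup>2\<close> and \<open>dx + i dy\<close> is \<open>w\<close>.\<close>

definition equivariant_cmc_immersion ::
  "real \<Rightarrow> real \<Rightarrow> real \<Rightarrow> (complex \<Rightarrow> real ^ 4) \<Rightarrow> bool" where
  "equivariant_cmc_immersion q \<theta>1 \<theta>2 f \<longleftrightarrow>
     (let \<phi> = \<theta>1 - \<theta>2;
          v = (\<lambda>z. jacobi_dn (Im z) (1 - q^2))
      in smooth_map f \<and> range f \<subseteq> sphere 0 1 \<and>
         (\<exists>N. unit_normal_field f N \<and>
           (\<forall>z w. first_form f z w = (sin \<phi>)^2 * (v z)^2 * (cmod w)^2 \<and>
                  second_form f N z w =
                    cot \<phi> * (sin \<phi>)^2 * (v z)^2 * (cmod w)^2 + Re (hopf q \<theta>1 \<theta>2 * w^2))))"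


section \<open>Lattices, tori and embeddedness\<close>

definition lattice :: "complex \<Rightarrow> complex \<Rightarrow> complex set" where
  "lattice \<omega>1 \<omega>2 = {of_int a * \<omega>1 + of_int b * \<omega>2 | a b. True}"

definition lattice_basis :: "complex \<Rightarrow> complex \<Rightarrow> bool" where
  "lattice_basis \<omega>1 \<omega>2 \<longleftrightarrow> \<omega>1 \<noteq> \<omega>2 \<and> independent {\<omega>1, \<omega>2}"

definition periods :: "(complex \<Rightarrow> real ^ 4) \<Rightarrow> complex set" where
  "periods f = {\<gamma>. \<forall>z. f (z + \<gamma>) = f z}"

text \<open>The torus \<open>\<complex>/\<Gamma>\<close>: cosets of \<open>\<Gamma>\<close> with the quotient topology.\<close>

definition torus_topology :: "complex set \<Rightarrow> complex set topology" where
  "torus_topology \<Gamma> =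
     topology (\<lambda>U. U \<subseteq> UNIV // {(z, w). w - z \<in> \<Gamma>} \<and> open (\<Union>U))"

lemma openin_torus_topology:
  assumes "0 \<in> \<Gamma>" "\<And>a b. a \<in> \<Gamma> \<Longrightarrow> b \<in> \<Gamma> \<Longrightarrow> a - b \<in> \<Gamma>"
  shows "openin (torus_topology \<Gamma>) U \<longleftrightarrow>
           U \<subseteq> UNIV // {(z, w). w - z \<in> \<Gamma>} \<and> open (\<Union>U)"
proof -
  let ?R = "{(z, w). w - z \<in> \<Gamma>}"
  have neg: "- a \<in> \<Gamma>" if "a \<in> \<Gamma>" for a
    using assms(2)[OF assms(1) that] by simp
  have add: "a + b \<in> \<Gamma>" if "a \<in> \<Gamma>" "b \<in> \<Gamma>" for a b
    using assms(2)[OF that(1) neg[OF that(2)]] by simp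
  have equiv: "equiv UNIV ?R"
  proof (rule equivI)
    show "refl ?R" using assms(1) by (simp add: refl_on_def)
    show "sym ?R"
    proof (rule symI)
      fix z w assume "(z, w) \<in> ?R"
      then show "(w, z) \<in> ?R" using neg[of "w - z"] by simp
    qed
    show "trans ?R"
    proof (rule transI)
      fix x y z assume "(x, y) \<in> ?R" "(y, z) \<in> ?R"
      then show "(x, z) \<in> ?R" using add[of "y - x" "z - y"] by simp
    qed
  qed auto
  have "istopology (\<lambda>U. U \<subseteq> UNIV // ?R \<and> open (\<Union>U))"
    unfolding istopology_def
  proof (intro conjI allI impI)
    fix S T assume S: "S \<subseteq> UNIV // ?R \<and> open (\<Union>S)" and T: "T \<subseteq> UNIV // ?R \<and> open (\<Union>T)"
    show "S \<inter> T \<subseteq> UNIV // ?R" using S by blast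
    have "\<Union>(S \<inter> T) = \<Union>S \<inter> \<Union>T"
    proof
      show "\<Union>S \<inter> \<Union>T \<subseteq> \<Union>(S \<inter> T)"
      proof
        fix x assume "x \<in> \<Union>S \<inter> \<Union>T"
        then obtain A B where AB: "A \<in> S" "B \<in> T" "x \<in> A" "x \<in> B" by blast
        have "A = B"
          using quotient_disj[OF equiv, of A B] AB S T by blast
        then show "x \<in> \<Union>(S \<inter> T)" using AB by blast
      qed
    qed blast
    then show "open (\<Union>(S \<inter> T))" using S T open_Int by (metis (no_types))
  next
    fix \<K> assume K: "\<forall>K\<in>\<K>. K \<subseteq> UNIV // ?R \<and> open (\<Union>K)"
    then show "\<Union>\<K> \<subseteq> UNIV // ?R" by blast
    have "\<Union>(\<Union>\<K>) = (\<Union>K\<in>\<K>. \<Union>K)" by blast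
    then show "open (\<Union>(\<Union>\<K>))" using K by auto
  qed
  then show ?thesis by (simp add: torus_topology_def)
qed

text \<open>An immersion of the plane with periods \<open>\<Gamma>\<close> descends to an immersion of \<open>\<complex>/\<Gamma>\<close>; the torus is
  embedded when that map is an embedding. If \<open>\<Gamma>\<close> is a proper subgroup of the periods, the induced
  map is a covering of its image and the torus is not embedded.\<close>

definition embedded_torus :: "(complex \<Rightarrow> real ^ 4) \<Rightarrow> complex set \<Rightarrow> bool" where
  "embedded_torus f \<Gamma> \<longleftrightarrow> \<Gamma> \<subseteq> periods f \<and>
     embedding_map (torus_topology \<Gamma>) (top_of_set (sphere 0 1)) (\<lambda>C. the_elem (f ` C))"


section \<open>The flow\<close>

text \<open>At \<open>q\<^sup>2 = 1\<close> the right-hand sides for \<open>k\<close> and \<open>h\<close> have removable singularities with value 0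
  (the brackets vanish to second order in \<open>1 - q\<^sup>2\<close>), which is what division by zero yields here.\<close>

definition flow_q :: "real \<Rightarrow> real \<Rightarrow> real \<Rightarrow> real" where
  "flow_q q k h = (let \<kappa> = sqrt (1 - q^2) in
     q * (elliptic_E \<kappa> * k - q * elliptic_K \<kappa> * h))"

definition flow_k :: "real \<Rightarrow> real \<Rightarrow> real \<Rightarrow> real" where
  "flow_k q k h = (let \<kappa> = sqrt (1 - q^2) in
     (1 - k^2) / (1 - q^2) * ((1 + q^2) * elliptic_E \<kappa> - 2 * q^2 * elliptic_K \<kappa>))"

definition flow_h :: "real \<Rightarrow> real \<Rightarrow> real \<Rightarrow> real" where
  "flow_h q k h = (let \<kappa> = sqrt (1 - q^2) in
     q * ((1 - h^2) / (1 - q^2)) * (2 * elliptic_E \<kappa> - (1 + q^2) * elliptic_K \<kappa>))"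

text \<open>A continuous family of lattices over an interval is given by a continuous basis.\<close>

definition cmc_torus_family ::
  "real set \<Rightarrow> (real \<Rightarrow> real) \<Rightarrow> (real \<Rightarrow> real) \<Rightarrow> (real \<Rightarrow> real) \<Rightarrow>
   (real \<Rightarrow> complex \<Rightarrow> real ^ 4) \<Rightarrow> (real \<Rightarrow> complex) \<Rightarrow> (real \<Rightarrow> complex) \<Rightarrow> bool" where
  "cmc_torus_family I q \<theta>1 \<theta>2 f \<omega>1 \<omega>2 \<longleftrightarrow>
     (let k = (\<lambda>t. cos (\<theta>1 t + \<theta>2 t)); h = (\<lambda>t. cos (\<theta>1 t - \<theta>2 t)) in
      is_interval I \<and> continuous_on I \<theta>1 \<and> continuous_on I \<theta>2 \<and>
      (\<forall>t\<in>I. q t \<in> {-1..1} - {0} \<and> sym_point (\<theta>1 t) \<noteq> sym_point (\<theta>2 t) \<and>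
        (q has_real_derivative flow_q (q t) (k t) (h t)) (at t within I) \<and>
        (k has_real_derivative flow_k (q t) (k t) (h t)) (at t within I) \<and>
        (h has_real_derivative flow_h (q t) (k t) (h t)) (at t within I)) \<and>
      (\<forall>t\<in>I. equivariant_cmc_immersion (q t) (\<theta>1 t) (\<theta>2 t) (f t)) \<and>
      continuous_on I \<omega>1 \<and> continuous_on I \<omega>2 \<and>
      (\<forall>t\<in>I. lattice_basis (\<omega>1 t) (\<omega>2 t) \<and> lattice (\<omega>1 t) (\<omega>2 t) \<subseteq> periods (f t)))"


section \<open>Flat tori of revolution\<close>

text \<open>The integers below do not depend on the choice of square roots: replacing one of the
  \<open>m\<^sub>j\<close> by \<open>- m\<^sub>j\<close> changes the signs of the other two components of the cross product.\<close>

definition flat_torus_type ::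
  "complex \<Rightarrow> complex \<Rightarrow> complex \<Rightarrow> nat \<Rightarrow> nat \<Rightarrow> nat \<Rightarrow> bool" where
  "flat_torus_type \<zeta>0 \<zeta>1 \<zeta>2 l0 l1 l2 \<longleftrightarrow>
     (let m0 = csqrt \<zeta>0; m1 = csqrt \<zeta>1; m2 = csqrt \<zeta>2 in
      \<exists>(s0::int) (s1::int) (s2::int) (c::real).
        of_int s0 = of_real c * (\<i> * (m1 * cnj m2 - m2 * cnj m1)) \<and>
        of_int s1 = of_real c * (\<i> * (m2 * cnj m0 - m0 * cnj m2)) \<and>
        of_int s2 = of_real c * (\<i> * (m0 * cnj m1 - m1 * cnj m0)) \<and>
        gcd s0 (gcd (s1 + s2) (s1 - s2)) = 2 \<and>
        2 * int l0 = \<bar>s0\<bar> \<and>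
        2 * int l1 = min \<bar>s1 + s2\<bar> \<bar>s1 - s2\<bar> \<and>
        2 * int l2 = max \<bar>s1 + s2\<bar> \<bar>s1 - s2\<bar>)"

definition matrix_exp :: "complex ^ 2 ^ 2 \<Rightarrow> complex ^ 2 ^ 2" where
  "matrix_exp A = (\<Sum>n. (1 / fact n) *\<^sub>R (((**) A ^^ n) (mat 1)))"

definition flat_frame :: "complex \<Rightarrow> complex \<Rightarrow> complex ^ 2 ^ 2" where
  "flat_frame \<zeta> z =
     (let e = pi * \<i> in
      matrix_exp (vector [vector [0, e * (z * inverse \<zeta> + cnj z)],
                          vector [e * (z + cnj z * \<zeta>), 0]]))"

text \<open>The isometry of \<open>SU(2)\<close> (with first row \<open>(a, b)\<close>) with the unit sphere of \<open>real ^ 4\<close>.\<close>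

definition su2_vec :: "complex ^ 2 ^ 2 \<Rightarrow> real ^ 4" where
  "su2_vec X = vector [Re (X $ 1 $ 1), Im (X $ 1 $ 1), Re (X $ 1 $ 2), Im (X $ 1 $ 2)]"

definition flat_immersion :: "complex \<Rightarrow> complex \<Rightarrow> complex \<Rightarrow> real ^ 4" where
  "flat_immersion \<zeta>1 \<zeta>2 z = su2_vec (flat_frame \<zeta>1 z ** matrix_inv (flat_frame \<zeta>2 z))"

text \<open>The pairing is \<open>z * cnj w + cnj z * w = 2 * Re (z * cnj w)\<close>. The factor 2 belongs to the
  normalisation of \<open>flat_frame\<close>: with \<open>\<mu>\<^sup>2 = \<zeta>\<close>, the eigenvalues of \<open>flat_frame \<zeta> z\<close> are
  \<open>exp (\<plusminus> 2 \<pi> i Re (z * cnj \<mu>))\<close>, so the set below consists exactly of those \<open>\<gamma>\<close> for which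
  the frames at \<open>\<zeta>1\<close> and \<open>\<zeta>2\<close> are both equal to 1 or both equal to -1 (equivalently \<open>\<gamma>\<close> is a
  period) and the frame at the double point \<open>\<zeta>0\<close> is 1 or -1. Another choice of
  square roots gives the same set.\<close>

definition pairing :: "complex \<Rightarrow> complex \<Rightarrow> real" where
  "pairing z w = 2 * Re (z * cnj w)"

definition flat_lattice :: "complex \<Rightarrow> complex \<Rightarrow> complex \<Rightarrow> complex set" where
  "flat_lattice \<zeta>0 \<zeta>1 \<zeta>2 =
     (let \<kappa>1 = (csqrt \<zeta>1 + csqrt \<zeta>2) / 2; \<kappa>2 = (csqrt \<zeta>1 - csqrt \<zeta>2) / 2 in
      {\<gamma>. pairing \<gamma> \<kappa>1 \<in> \<int> \<and> pairing \<gamma> \<kappa>2 \<in> \<int> \<and> pairing \<gamma> (csqrt \<zeta>0) \<in> \<int>})"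

text \<open>In the coordinate \<open>z\<close> of \<open>flat_immersion\<close> the metric is \<open>4 \<pi>\<^sup>2 sin\<^sup>2 \<phi> (dx\<^sup>2 + dy\<^sup>2)\<close> and the
  curvature lines are permuted if \<open>q = 1\<close>; the coordinate used for the equivariant
  immersions is therefore a complex multiple \<open>c z\<close>, and the lattice is transported accordingly.\<close>

definition flat_revolution_torus ::
  "nat \<Rightarrow> nat \<Rightarrow> real \<Rightarrow> real \<Rightarrow> real \<Rightarrow> (complex \<Rightarrow> real ^ 4) \<Rightarrow> complex set \<Rightarrow> bool" where
  "flat_revolution_torus l0 l2 q \<theta>1 \<theta>2 f \<Gamma> \<longleftrightarrow>
     (let \<zeta>0 = of_real (sgn q); \<zeta>1 = sym_point \<theta>1; \<zeta>2 = sym_point \<theta>2 in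
      \<bar>q\<bar> = 1 \<and> \<zeta>2 = inverse \<zeta>1 \<and> flat_torus_type \<zeta>0 \<zeta>1 \<zeta>2 l0 0 l2 \<and>
      (\<exists>c T. c \<noteq> 0 \<and> orthogonal_transformation T \<and>
        (\<forall>z. f (c * z) = T (flat_immersion \<zeta>1 \<zeta>2 z)) \<and>
        \<Gamma> = (\<lambda>\<gamma>. c * \<gamma>) ` flat_lattice \<zeta>0 \<zeta>1 \<zeta>2))"

text \<open>\<open>f\<close> with period lattice \<open>\<Gamma>\<close> is a member of a family of tori of revolution starting, at
  parameter \<open>t0\<close>, at an \<open>(l0, 0, l2)\<close> flat torus.\<close>

definition cmc_torus_of_revolution ::
  "nat \<Rightarrow> nat \<Rightarrow> (complex \<Rightarrow> real ^ 4) \<Rightarrow> complex set \<Rightarrow> bool" where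
  "cmc_torus_of_revolution l0 l2 f \<Gamma> \<longleftrightarrow>
     (\<exists>I q \<theta>1 \<theta>2 F \<omega>1 \<omega>2 t0 t.
        cmc_torus_family I q \<theta>1 \<theta>2 F \<omega>1 \<omega>2 \<and>
        (\<forall>s\<in>I. sym_point (\<theta>2 s) = inverse (sym_point (\<theta>1 s))) \<and>
        t0 \<in> I \<and> t \<in> I \<and>
        flat_revolution_torus l0 l2 (q t0) (\<theta>1 t0) (\<theta>2 t0) (F t0)
          (lattice (\<omega>1 t0) (\<omega>2 t0)) \<and>
        f = F t \<and> \<Gamma> = lattice (\<omega>1 t) (\<omega>2 t))"

end

theory Submission
  imports Defs
begin

text \<open>
  Up to replacing \<open>(q, h)\<close> by \<open>(\<bar>q\<bar>, \<plusminus>h)\<close>, the structure equations of the immersion integrate to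
  \<open>f (x, y) = r (cos cx, sin cx) \<oplus> \<rho> (cos \<psi>, sin \<psi>)\<close> with \<open>c\<^sup>2 = 1 + q\<^sup>2 - 2qh\<close>, \<open>r = v sin \<phi> / c\<close> and
  \<open>\<rho>\<^sup>2 \<psi>' = (sin \<phi> / c) (q - h v\<^sup>2)\<close>. So the period lattice is generated by a rotation period and a
  profile period of \<open>l2\<close> lobes, and since the lattice varies continuously, its integer coordinates
  and the winding angle \<open>2 \<pi> p / l2\<close> per lobe are constant as long as the profile avoids the axis
  \<open>\<rho> = 0\<close>, that is, while \<open>h < q\<close>; at the flat torus \<open>p = l0\<close>. If \<open>p = 1\<close>, the family cannot reach
  \<open>h = 0\<close>, where a lobe winds by more than \<open>\<pi>\<close>; hence \<open>\<psi>\<close> stays monotone and the profile is simple. In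
  all other cases the reflection symmetries of the profile produce a double point: for \<open>p \<ge> 2\<close> by
  the intermediate value theorem, for \<open>h = q\<close> on the axis, and for \<open>h > q\<close> because \<open>\<psi>\<close> turns back.
\<close>

text \<open>Hence winding numbers other than 1 are never tracked. The value 1 is isolated: it forces
  a half turn of \<open>pi / l2 \<le> pi / 2\<close>, impossible for \<open>0 \<le> h < q\<close>,
  so that winding once with \<open>h \<le> 0\<close> is an open and closed condition on the
  parameter. It is used in both directions: from the flat torus to the given one when
  \<open>l0 = 1\<close>, and from a given embedded torus back to the flat one to obtain
  \<open>l0 = 1\<close>.

  The other obstacle is the flat torus itself. For \<open>\<bar>q\<bar> = 1\<close> the function dn
  is constant, lobes are invisible in the surface, and a period need not consist of whole lobes.
  Integrality at the start is therefore computed from the explicit flat lattice, and the flow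
  equation for \<open>q\<close> excludes a second parameter with
  \<open>\<bar>q\<bar> = 1\<close>.\<close>

section \<open>The Jacobi function dn\<close>

lemma primitive_continuous:
  fixes G :: "real \<Rightarrow> real"
  assumes "continuous_on UNIV G"
  shows "((\<lambda>x. LBINT t=ereal 0..ereal x. G t) has_real_derivative G x) (at x)"
proof -
  let ?a = "- \<bar>x\<bar> - 1" and ?b = "\<bar>x\<bar> + 1"
  have "((\<lambda>x. LBINT t=ereal 0..ereal x. G t) has_vector_derivative G x) (at x within {?a..?b})"
    by (rule interval_integral_FTC2) (auto intro: continuous_on_subset[OF assms])
  moreover have "at x within {?a..?b} = at x"
    by (rule at_within_interior) auto
  ultimately show ?thesis by (simp add: has_real_derivative_iff_has_vector_derivative)
qed

lemma primitive_eq_integral: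
  fixes G :: "real \<Rightarrow> real"
  assumes "continuous_on UNIV G" "0 \<le> x"
  shows "(LBINT t=ereal 0..ereal x. G t) = integral {0..x} G"
  by (rule interval_integral_eq_integral)
     (auto intro!: borel_integrable_atLeastAtMost' continuous_on_subset[OF assms(1)] assms(2))

lemma DERIV_const_diff:
  fixes f g :: "real \<Rightarrow> real"
  assumes "\<And>x. (f has_real_derivative d x) (at x)" "\<And>x. (g has_real_derivative d x) (at x)"
  shows "f x - g x = f y - g y"
  using DERIV_isconst_all[of "\<lambda>x. f x - g x" x y] DERIV_diff[OF assms] by simp

lemma odd_primitive:
  fixes F G :: "real \<Rightarrow> real"
  assumes "\<And>x. (F has_real_derivative G x) (at x)" "F 0 = 0" "\<And>x. G (- x) = G x"
  shows "F (- x) = - F x"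
proof -
  have "((\<lambda>x. - F (- x)) has_real_derivative G x) (at x)" for x
    by (auto intro!: derivative_eq_intros DERIV_chain'[OF _ assms(1)] simp: assms(3))
  from DERIV_const_diff[OF assms(1) this, of x 0] show ?thesis by (simp add: assms(2))
qed

text \<open>The difference of \<open>F (x + T)\<close> and \<open>F x\<close> is constant; evaluated
  at \<open>- (T / 2)\<close>, oddness turns it into \<open>2 * F (T / 2)\<close>. The elliptic
  integral and the profile angle are thereby governed by their values over half a period.\<close>

lemma quasiperiodic_primitive:
  fixes F G :: "real \<Rightarrow> real"
  assumes "\<And>x. (F has_real_derivative G x) (at x)" "F 0 = 0" "\<And>x. G (- x) = G x"
    "\<And>x. G (x + T) = G x"
  shows "F (x + T) = F x + 2 * F (T / 2)"
proof -
  have "((\<lambda>x. F (x + T)) has_real_derivative G x) (at x)" for x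
    using DERIV_shift[of F "G x" x T] assms(1)[of "x + T"] assms(4) by simp
  from DERIV_const_diff[OF this assms(1), of x "- (T / 2)"]
  show ?thesis using odd_primitive[OF assms(1-3), of "T/2"] by simp
qed

lemma quasiperiodic_int:
  fixes F :: "real \<Rightarrow> real"
  assumes "\<And>x. F (x + T) = F x + D"
  shows "F (x + of_int n * T) = F x + of_int n * D"
proof (induction n rule: int_induct[where k = 0])
  case base show ?case by simp
next
  case (step1 i) then show ?case using assms[of "x + of_int i * T"] by (simp add: algebra_simps)
next
  case (step2 i) then show ?case using assms[of "x + of_int (i - 1) * T"] by (simp add: algebra_simps)
qed

text \<open>The square of dn as a function of the amplitude. Here \<open>q\<close> is the
  complementary modulus, hence the minimum \<open>q^2\<close>.\<close>

definition delta2 :: "real \<Rightarrow> real \<Rightarrow> real" where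
  "delta2 q u = 1 - (1 - q^2) * (sin u)^2"

lemma delta2_bounds:
  assumes "0 < q" "q \<le> 1"
  shows "q^2 \<le> delta2 q u" "delta2 q u \<le> 1" "0 < delta2 q u"
proof -
  have q: "q^2 \<le> 1" using assms by (simp add: power_le_one)
  have s: "0 \<le> (sin u)^2" "(sin u)^2 \<le> 1" by (auto simp: abs_square_le_1)
  have "(1 - q^2) * (sin u)^2 \<le> (1 - q^2) * 1" using q s by (intro mult_left_mono) auto
  then show "q^2 \<le> delta2 q u" unfolding delta2_def by simp
  then show "0 < delta2 q u" using assms by (smt (verit) zero_less_power)
  show "delta2 q u \<le> 1" unfolding delta2_def using q s by simp
qed

lemma delta2_sym: "delta2 q (- u) = delta2 q u" "delta2 q (u + pi) = delta2 q u"
  by (simp_all add: delta2_def)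

lemma delta2_continuous [continuous_intros]: "continuous_on A (delta2 q)"
  unfolding delta2_def by (intro continuous_intros)

lemma delta2_parameter: "0 < q \<Longrightarrow> q \<le> 1 \<Longrightarrow> (sqrt (1 - q^2))^2 = 1 - q^2"
  by (simp add: power_le_one)

abbreviation Kc :: "real \<Rightarrow> real" where "Kc q \<equiv> elliptic_K (sqrt (1 - q^2))"

definition am :: "real \<Rightarrow> real \<Rightarrow> real" where "am q = jacobi_am (1 - q^2)"

definition dn :: "real \<Rightarrow> real \<Rightarrow> real" where "dn q y = jacobi_dn y (1 - q^2)"

context
  fixes q :: real
  assumes q: "0 < q" "q \<le> 1"
begin

abbreviation "FF \<equiv> elliptic_F (1 - q^2)"

lemma FF_eq: "FF = (\<lambda>x. LBINT t=ereal 0..ereal x. 1 / sqrt (delta2 q t))"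
  by (simp add: elliptic_F_def delta2_def fun_eq_iff)

lemma inv_sqrt_delta2_continuous: "continuous_on A (\<lambda>t. 1 / sqrt (delta2 q t))"
  using delta2_bounds(3)[OF q] by (intro continuous_intros) (simp add: less_imp_neq[symmetric])

lemma FF_deriv: "(FF has_real_derivative 1 / sqrt (delta2 q x)) (at x)"
  unfolding FF_eq by (rule primitive_continuous[OF inv_sqrt_delta2_continuous])

lemma FF_0: "FF 0 = 0" by (simp add: elliptic_F_def zero_ereal_def[symmetric])

lemma FF_odd: "FF (- x) = - FF x"
  by (rule odd_primitive[OF FF_deriv FF_0]) (simp add: delta2_sym)

lemma FF_half: "FF (pi / 2) = Kc q"
  unfolding FF_eq elliptic_K_def delta2_parameter[OF q] delta2_def[symmetric]
  by (rule primitive_eq_integral[OF inv_sqrt_delta2_continuous]) simp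

lemma FF_pi: "FF (x + pi) = FF x + 2 * Kc q"
  unfolding FF_half[symmetric]
  by (rule quasiperiodic_primitive[OF FF_deriv FF_0]) (simp_all add: delta2_sym)

lemma FF_strict_mono: "strict_mono FF"
proof (rule strict_monoI)
  fix x y :: real assume "x < y"
  then show "FF x < FF y"
    by (rule DERIV_pos_imp_increasing) (use FF_deriv delta2_bounds(3)[OF q] in force)
qed

lemma Kc_pos: "0 < Kc q"
  using strict_monoD[OF FF_strict_mono, of 0 "pi/2"] by (simp add: FF_0 FF_half)

lemma FF_cont: "isCont FF x" using FF_deriv DERIV_isCont by blast

lemma FF_surj: "\<exists>x. FF x = y"
proof -
  obtain n :: nat where n: "\<bar>y\<bar> < real n * (2 * Kc q)"
    using reals_Archimedean3[of "2 * Kc q"] Kc_pos by auto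
  have "FF (real n * pi) = real n * (2 * Kc q)"
    using quasiperiodic_int[of FF pi "2 * Kc q" 0 "int n", OF FF_pi] by (simp add: FF_0)
  then have "FF (- (real n * pi)) \<le> y" "y \<le> FF (real n * pi)"
    using n unfolding FF_odd by auto
  then show ?thesis
    using IVT[of FF "- (real n * pi)" y "real n * pi"] FF_cont by auto
qed

text \<open>\<open>FF\<close> is a strictly increasing bijection, so the definite description in
  \<open>jacobi_am\<close> is met. Values, parity and quasi-periodicity of \<open>am\<close> then
  follow from those of \<open>FF\<close>.\<close>

lemma am_eq_iff: "am q y = x \<longleftrightarrow> FF x = y"
proof -
  obtain x0 where x0: "FF x0 = y" using FF_surj by blast
  have "FF x = y \<longleftrightarrow> x = x0" for x
    using x0 strict_mono_eq[OF FF_strict_mono] by auto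
  then have "am q y = x0" unfolding am_def jacobi_am_def by (intro the_equality) auto
  then show ?thesis using x0 strict_mono_eq[OF FF_strict_mono] by auto
qed

lemma am_FF: "am q (FF x) = x" and FF_am: "FF (am q y) = y"
  using am_eq_iff by auto

lemma am_0: "am q 0 = 0" using am_eq_iff FF_0 by simp
lemma am_K: "am q (Kc q) = pi / 2" unfolding am_eq_iff by (rule FF_half)
lemma am_odd: "am q (- y) = - am q y" using am_eq_iff FF_odd FF_am by simp
lemma am_period: "am q (y + 2 * Kc q) = am q y + pi" using am_eq_iff FF_pi FF_am by simp

lemma am_deriv: "(am q has_real_derivative sqrt (delta2 q (am q y))) (at y)"
proof -
  have "isCont (am q) (FF x)" for x
    by (rule isCont_inverse_function[of 1]) (auto simp: am_FF FF_cont)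
  then have c: "isCont (am q) y" by (metis FF_am)
  have "(am q has_real_derivative inverse (1 / sqrt (delta2 q (am q y)))) (at y)"
    by (rule DERIV_inverse_function[where f = FF and a = "y - 1" and b = "y + 1"])
       (use FF_deriv delta2_bounds(3)[OF q] c FF_am in \<open>auto simp: less_imp_neq[symmetric]\<close>)
  then show ?thesis by simp
qed

lemma dn_am: "dn q y = sqrt (delta2 q (am q y))"
  by (simp add: dn_def jacobi_dn_def delta2_def am_def)

lemma dn_sq: "(dn q y)^2 = delta2 q (am q y)"
  unfolding dn_am using delta2_bounds(3)[OF q] by (simp add: less_imp_le)

lemma dn_pos: "0 < dn q y" unfolding dn_am using delta2_bounds(3)[OF q] by simp

lemma dn_even: "dn q (- y) = dn q y" by (simp add: dn_am am_odd delta2_sym)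
lemma dn_period: "dn q (y + 2 * Kc q) = dn q y" by (simp add: dn_am am_period delta2_sym)
lemma dn_0: "dn q 0 = 1" by (simp add: dn_am am_0 delta2_def)
lemma dn_K: "dn q (Kc q) = q" using q by (simp add: dn_am am_K delta2_def)

lemma dn_bounds: "q^2 \<le> (dn q y)^2" "(dn q y)^2 \<le> 1"
  unfolding dn_sq using delta2_bounds[OF q] by auto

definition dn' :: "real \<Rightarrow> real" where
  "dn' y = - (1 - q^2) * sin (am q y) * cos (am q y)"

lemma dn_deriv: "(dn q has_real_derivative dn' y) (at y)"
proof -
  have eq: "dn q = (\<lambda>y. sqrt (delta2 q (am q y)))" using dn_am by blast
  have "((\<lambda>y. 1 - (1 - q^2) * (sin (am q y))^2) has_real_derivative
     - ((1 - q^2) * (2 * sin (am q y) * (cos (am q y) * dn q y)))) (at y)"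
    by (auto intro!: derivative_eq_intros am_deriv simp: dn_am[symmetric])
  then have "((\<lambda>y. delta2 q (am q y)) has_real_derivative
     - ((1 - q^2) * (2 * sin (am q y) * (cos (am q y) * dn q y)))) (at y)"
    by (simp add: delta2_def)
  from DERIV_chain'[OF this DERIV_real_sqrt[OF delta2_bounds(3)[OF q]]]
  have "((\<lambda>y. sqrt (delta2 q (am q y))) has_real_derivative
    - ((1 - q^2) * (2 * sin (am q y) * (cos (am q y) * dn q y))) * (inverse (dn q y) / 2)) (at y)"
    by (simp add: dn_am mult.commute)
  moreover have "- ((1 - q^2) * (2 * sin (am q y) * (cos (am q y) * dn q y))) * (inverse (dn q y) / 2) = dn' y"
    using dn_pos[of y] by (simp add: dn'_def field_simps)
  ultimately show ?thesis unfolding eq by simp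
qed

text \<open>The first-order differential equation of dn. It is what makes the length of the second
  x-derivative of the immersion collapse to a constant multiple of dn.\<close>

lemma dn'_sq: "(dn' y)^2 = (1 - (dn q y)^2) * ((dn q y)^2 - q^2)"
proof -
  have c: "(cos (am q y))^2 = 1 - (sin (am q y))^2" by (simp add: cos_squared_eq)
  show ?thesis unfolding dn_sq delta2_def dn'_def power_mult_distrib c
    by (simp add: algebra_simps power2_eq_square)
qed

text \<open>dn attains its maximum exactly where the sine of the amplitude vanishes. This is the
  source of the integrality of periods in the y direction; for \<open>q = 1\<close> it fails, as dn
  is then constant.\<close>

lemma dn_1_imp: "q < 1 \<Longrightarrow> dn q y = 1 \<Longrightarrow> \<exists>n::int. y = of_int n * (2 * Kc q)"
proof -
  assume "q < 1" and "dn q y = 1"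
  then have "delta2 q (am q y) = 1" using dn_sq[of y] by simp
  moreover have "q^2 < 1" using q \<open>q < 1\<close> by (simp add: power_less_one_iff abs_square_less_1)
  ultimately have "sin (am q y) = 0" by (simp add: delta2_def)
  then obtain n :: int where n: "am q y = of_int n * pi" using sin_zero_iff_int2 by blast
  have "FF (of_int n * pi) = of_int n * (2 * Kc q)"
    using quasiperiodic_int[of FF pi "2 * Kc q" 0 n, OF FF_pi] by (simp add: FF_0)
  then have "y = of_int n * (2 * Kc q)" using FF_am[of y] unfolding n by simp
  then show ?thesis by blast
qed

end

section \<open>Complete integrals at q = 1 and continuity of K' in q\<close>

lemma Kc_1: "Kc 1 = pi / 2" unfolding elliptic_K_def by simp

lemma elliptic_E_0: "elliptic_E 0 = pi / 2" and elliptic_K_0: "elliptic_K 0 = pi / 2"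
  unfolding elliptic_E_def elliptic_K_def by simp_all

lemma Kc_continuous: "continuous_on {0<..1} Kc"
proof -
  have "continuous_on ({0<..1} \<times> cbox 0 (pi/2)) (\<lambda>(q, t). 1 / sqrt (delta2 q t))"
    unfolding case_prod_unfold
  proof (intro continuous_intros ballI)
    show "continuous_on ({0<..1} \<times> cbox 0 (pi / 2)) (\<lambda>x. delta2 (fst x) (snd x))"
      unfolding delta2_def by (intro continuous_intros)
    show "sqrt (delta2 (fst x) (snd x)) \<noteq> 0" if "x \<in> {0<..1} \<times> cbox 0 (pi/2)" for x
      using delta2_bounds(3)[of "fst x" "snd x"] that by auto
  qed
  from integral_continuous_on_param[OF this]
  have "continuous_on {0<..1} (\<lambda>q. integral {0..pi/2} (\<lambda>t. 1 / sqrt (delta2 q t)))" by simp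
  then show ?thesis
    by (rule continuous_on_eq) (auto simp: elliptic_K_def delta2_parameter delta2_def)
qed

section \<open>Maps of the plane into Euclidean 4-space\<close>

lemma differentiable_has_vector_derivative_x:
  assumes "g differentiable_on UNIV"
  shows "((\<lambda>x. g (Complex x y)) has_vector_derivative dir_deriv 1 g (Complex x y)) (at x)"
proof -
  have "(g has_derivative frechet_derivative g (at (Complex x y))) (at (Complex x y))"
    using assms by (simp add: differentiable_on_def frechet_derivative_works[symmetric])
  moreover have "((\<lambda>x. Complex x y) has_vector_derivative 1) (at x)"
    unfolding Complex_eq by (auto intro!: derivative_eq_intros)
  ultimately show ?thesis unfolding dir_deriv_def
    using vector_derivative_diff_chain_within[of "\<lambda>x. Complex x y" 1 x UNIV g] by (simp add: comp_def has_derivative_at_withinI)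
qed

lemma differentiable_has_vector_derivative_y:
  assumes "g differentiable_on UNIV"
  shows "((\<lambda>y. g (Complex x y)) has_vector_derivative dir_deriv \<i> g (Complex x y)) (at y)"
proof -
  have "(g has_derivative frechet_derivative g (at (Complex x y))) (at (Complex x y))"
    using assms by (simp add: differentiable_on_def frechet_derivative_works[symmetric])
  moreover have "((\<lambda>y. Complex x y) has_vector_derivative \<i>) (at y)"
    unfolding Complex_eq by (auto intro!: derivative_eq_intros)
  ultimately show ?thesis unfolding dir_deriv_def
    using vector_derivative_diff_chain_within[of "\<lambda>y. Complex x y" \<i> y UNIV g] by (simp add: comp_def has_derivative_at_withinI)
qed

lemma dir_deriv_add_direction:
  assumes "g differentiable_on UNIV"
  shows "dir_deriv (v + w) g z = dir_deriv v g z + dir_deriv w g z"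
proof -
  have "(g has_derivative frechet_derivative g (at z)) (at z)"
    using assms by (simp add: differentiable_on_def frechet_derivative_works[symmetric])
  then show ?thesis unfolding dir_deriv_def by (metis has_derivative_linear linear_add)
qed

lemma dir_deriv_add:
  assumes "g differentiable_on UNIV" "k differentiable_on UNIV"
  shows "dir_deriv w (\<lambda>z. g z + k z) z = dir_deriv w g z + dir_deriv w k z"
proof -
  have "(g has_derivative frechet_derivative g (at z)) (at z)" "(k has_derivative frechet_derivative k (at z)) (at z)"
    using assms by (simp_all add: differentiable_on_def frechet_derivative_works[symmetric])
  from has_derivative_add[OF this] show ?thesis
    unfolding dir_deriv_def by (simp add: frechet_derivative_at[symmetric])
qed

lemma smooth_map_dir_deriv: "smooth_map f \<Longrightarrow> smooth_map (dir_deriv w f)"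
  unfolding smooth_map_def
proof
  fix ws assume "\<forall>ws. fold dir_deriv ws f differentiable_on UNIV"
  then have "fold dir_deriv (w # ws) f differentiable_on UNIV" by blast
  then show "fold dir_deriv ws (dir_deriv w f) differentiable_on UNIV" by simp
qed

lemma smooth_map_differentiable: "smooth_map f \<Longrightarrow> f differentiable_on UNIV"
  unfolding smooth_map_def by (metis fold_simps(1))

lemma smooth_map_continuous: "smooth_map f \<Longrightarrow> continuous_on A f"
  by (meson smooth_map_differentiable differentiable_imp_continuous_on continuous_on_subset subset_UNIV)

lemma continuous_on_Complex_pair:
  assumes "continuous_on UNIV g" "continuous_on A a" "continuous_on A b"
  shows "continuous_on A (\<lambda>x. g (Complex (a x) (b x)))"
  unfolding Complex_eq
  by (rule continuous_on_compose2[OF assms(1)]) (auto intro!: continuous_intros assms)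

text \<open>The integral of f_x along a horizontal segment is an increment of f. Differentiating it
  in y under the integral expresses the increment of f_y as an integral of f_xy, and differentiating
  in the upper limit gives the claim. The left end \<open>x - 1\<close> is arbitrary; it only makes
  \<open>x\<close> an interior point.\<close>

lemma mixed_partials:
  assumes f: "smooth_map f"
  shows "dir_deriv 1 (dir_deriv \<i> f) z = dir_deriv \<i> (dir_deriv 1 f) z"
proof -
  define fx where "fx = dir_deriv 1 f"
  define fxy where "fxy = dir_deriv \<i> fx"
  have sx: "smooth_map fx" and sxy: "smooth_map fxy" and sy: "smooth_map (dir_deriv \<i> f)"
    unfolding fxy_def fx_def using f by (simp_all add: smooth_map_dir_deriv)
  obtain x y where z: "z = Complex x y" by (cases z)
  have cx: "continuous_on A (\<lambda>t. fx (Complex t y'))" for A y'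
    by (rule continuous_on_Complex_pair[OF smooth_map_continuous[OF sx]]) (intro continuous_intros)+
  have cxy: "continuous_on A (\<lambda>t. fxy (Complex t y'))" for A y'
    by (rule continuous_on_Complex_pair[OF smooth_map_continuous[OF sxy]]) (intro continuous_intros)+
  have inc: "dir_deriv \<i> f (Complex u y) - dir_deriv \<i> f (Complex (x - 1) y)
      = integral {x - 1..u} (\<lambda>t. fxy (Complex t y))" if u: "x - 1 \<le> u" for u
  proof -
    have ftc: "integral {x - 1..u} (\<lambda>t. fx (Complex t y')) = f (Complex u y') - f (Complex (x - 1) y')" for y'
      by (intro integral_unique fundamental_theorem_of_calculus u)
         (auto intro: has_vector_derivative_at_within differentiable_has_vector_derivative_x
            smooth_map_differentiable f simp: fx_def)
    have "((\<lambda>y'. integral (cbox (x - 1) u) (\<lambda>t. fx (Complex t y'))) has_vector_derivative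
        integral (cbox (x - 1) u) (\<lambda>t. fxy (Complex t y))) (at y within UNIV)"
    proof (rule leibniz_rule_vector_derivative)
      show "((\<lambda>y'. fx (Complex t y')) has_vector_derivative fxy (Complex t y')) (at y' within UNIV)" for y' t
        unfolding fxy_def by (intro differentiable_has_vector_derivative_y smooth_map_differentiable sx)
      show "(\<lambda>t. fx (Complex t y')) integrable_on cbox (x - 1) u" for y'
        by (rule integrable_continuous[OF cx])
      show "continuous_on (UNIV \<times> cbox (x - 1) u) (\<lambda>(y', t). fxy (Complex t y'))"
        unfolding case_prod_unfold
        by (rule continuous_on_Complex_pair[OF smooth_map_continuous[OF sxy]]) (intro continuous_intros)+
    qed auto
    then have "((\<lambda>y'. f (Complex u y') - f (Complex (x - 1) y')) has_vector_derivative
        integral {x - 1..u} (\<lambda>t. fxy (Complex t y))) (at y)"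
      by (simp add: ftc)
    moreover have "((\<lambda>y'. f (Complex u y') - f (Complex (x - 1) y')) has_vector_derivative
        dir_deriv \<i> f (Complex u y) - dir_deriv \<i> f (Complex (x - 1) y)) (at y)"
      by (intro has_vector_derivative_diff differentiable_has_vector_derivative_y smooth_map_differentiable f)
    ultimately show ?thesis using vector_derivative_unique_at by blast
  qed
  have int: "at x within {x - 1..x + 1} = at x" by (rule at_within_interior) auto
  have "((\<lambda>u. integral {x - 1..u} (\<lambda>t. fxy (Complex t y))) has_vector_derivative fxy (Complex x y))
      (at x within {x - 1..x + 1})"
    by (rule integral_has_vector_derivative[OF cxy]) auto
  then have "((\<lambda>u. dir_deriv \<i> f (Complex u y) - dir_deriv \<i> f (Complex (x - 1) y))
      has_vector_derivative fxy (Complex x y)) (at x within {x - 1..x + 1})"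
    by (rule has_vector_derivative_transform[rotated 2]) (auto simp: inc)
  then have "((\<lambda>u. dir_deriv \<i> f (Complex u y) - dir_deriv \<i> f (Complex (x - 1) y))
      has_vector_derivative fxy (Complex x y)) (at x)" unfolding int .
  moreover have "((\<lambda>u. dir_deriv \<i> f (Complex u y) - dir_deriv \<i> f (Complex (x - 1) y))
      has_vector_derivative dir_deriv 1 (dir_deriv \<i> f) (Complex x y) - 0) (at x)"
    by (intro has_vector_derivative_diff differentiable_has_vector_derivative_x
        smooth_map_differentiable sy has_vector_derivative_const)
  ultimately show ?thesis unfolding z fxy_def fx_def using vector_derivative_unique_at by force
qed

section \<open>Scalar products of derivatives and orthogonal frames\<close>

lemma has_real_derivative_inner:
  assumes "(g has_vector_derivative g') (at x)" "(k has_vector_derivative k') (at x)"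
  shows "((\<lambda>x. inner (g x) (k x)) has_real_derivative inner (g x) k' + inner g' (k x)) (at x)"
  using bounded_bilinear.has_vector_derivative[OF bounded_bilinear_inner assms]
  by (simp add: has_real_derivative_iff_has_vector_derivative)

text \<open>The metric coefficients depend on \<open>Im z\<close> alone, so the product rule in the
  x direction has right-hand side zero. Equivariance of the fundamental forms enters in this
  way.\<close>

lemma inner_deriv_x:
  assumes "smooth_map g" "smooth_map k" "\<And>z. inner (g z) (k z) = u (Im z)"
  shows "inner (g z) (dir_deriv 1 k z) + inner (dir_deriv 1 g z) (k z) = 0"
proof -
  obtain x y where z: "z = Complex x y" by (cases z)
  have "((\<lambda>x. inner (g (Complex x y)) (k (Complex x y))) has_real_derivative
     inner (g z) (dir_deriv 1 k z) + inner (dir_deriv 1 g z) (k z)) (at x)"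
    unfolding z by (intro has_real_derivative_inner differentiable_has_vector_derivative_x
        smooth_map_differentiable assms(1,2))
  then have "((\<lambda>x. u y) has_real_derivative
     inner (g z) (dir_deriv 1 k z) + inner (dir_deriv 1 g z) (k z)) (at x)" by (simp add: assms(3))
  then show ?thesis using DERIV_unique[OF _ DERIV_const] by blast
qed

lemma inner_deriv_y:
  assumes "smooth_map g" "smooth_map k" "\<And>z. inner (g z) (k z) = u (Im z)"
    "(u has_real_derivative u') (at (Im z))"
  shows "inner (g z) (dir_deriv \<i> k z) + inner (dir_deriv \<i> g z) (k z) = u'"
proof -
  obtain x y where z: "z = Complex x y" by (cases z)
  have "((\<lambda>y. inner (g (Complex x y)) (k (Complex x y))) has_real_derivative
     inner (g z) (dir_deriv \<i> k z) + inner (dir_deriv \<i> g z) (k z)) (at y)"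
    unfolding z by (intro has_real_derivative_inner differentiable_has_vector_derivative_y
        smooth_map_differentiable assms(1,2))
  then have "(u has_real_derivative
     inner (g z) (dir_deriv \<i> k z) + inner (dir_deriv \<i> g z) (k z)) (at y)" by (simp add: assms(3))
  then show ?thesis using DERIV_unique assms(4) z by force
qed

lemma has_vector_derivative_zero_eq:
  fixes F :: "real \<Rightarrow> 'a::real_normed_vector"
  assumes "\<And>x. (F has_vector_derivative 0) (at x)"
  shows "F x = F y"
  using has_vector_derivative_zero_constant[of UNIV F] assms by (metis UNIV_I convex_UNIV)

text \<open>Otherwise there would be five nonzero pairwise orthogonal vectors in dimension four.
  Vector identities along the surface are proved below by testing them against such a frame.\<close>

lemma orthogonal_frame_zero:
  fixes a b c d x :: "real ^ 4"
  assumes "a \<noteq> 0" "b \<noteq> 0" "c \<noteq> 0" "d \<noteq> 0"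
    and "inner a b = 0" "inner a c = 0" "inner a d = 0" "inner b c = 0" "inner b d = 0" "inner c d = 0"
    and "inner x a = 0" "inner x b = 0" "inner x c = 0" "inner x d = 0"
  shows "x = 0"
proof (rule ccontr)
  assume x: "x \<noteq> 0"
  have "pairwise orthogonal {x, a, b, c, d}"
    using assms by (auto simp: pairwise_def orthogonal_def inner_commute)
  then have "independent {x, a, b, c, d}"
    using pairwise_orthogonal_independent assms x by blast
  then have "card {x, a, b, c, d} \<le> 4" using independent_card_le by fastforce
  moreover have "x \<notin> {a, b, c, d}" "a \<notin> {b, c, d}" "b \<notin> {c, d}" "c \<noteq> d"
    using assms x by auto
  then have "card {x, a, b, c, d} = 5" by simp
  ultimately show False by simp
qed

lemma exists_unit_orthogonal:
  fixes S :: "(real ^ 4) set"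
  assumes "finite S" "card S < 4"
  obtains x where "inner x x = 1" "\<And>y. y \<in> S \<Longrightarrow> inner x y = 0"
proof -
  have "dim S < DIM(real ^ 4)" using dim_le_card'[OF assms(1)] assms(2) by simp
  then obtain x where x: "x \<noteq> 0" "\<And>y. y \<in> span S \<Longrightarrow> orthogonal x y"
    using orthogonal_to_subspace_exists by blast
  have "inner (x /\<^sub>R norm x) (x /\<^sub>R norm x) = 1" using x(1) by (simp add: dot_square_norm power2_eq_square)
  moreover have "inner (x /\<^sub>R norm x) y = 0" if "y \<in> S" for y
    using x(2)[of y] that by (simp add: orthogonal_def span_base)
  ultimately show ?thesis using that by blast
qed

definition orthonormal4 :: "real ^ 4 \<Rightarrow> real ^ 4 \<Rightarrow> real ^ 4 \<Rightarrow> real ^ 4 \<Rightarrow> bool" where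
  "orthonormal4 a b c d \<longleftrightarrow> inner a a = 1 \<and> inner b b = 1 \<and> inner c c = 1 \<and> inner d d = 1 \<and>
     inner a b = 0 \<and> inner a c = 0 \<and> inner a d = 0 \<and> inner b c = 0 \<and> inner b d = 0 \<and> inner c d = 0"

lemma orthonormal4_sym:
  assumes "orthonormal4 a b c d"
  shows "inner b a = 0" "inner c a = 0" "inner d a = 0" "inner c b = 0" "inner d b = 0" "inner d c = 0"
  using assms unfolding orthonormal4_def by (simp_all add: inner_commute)

lemma orthonormal4_expand:
  assumes "orthonormal4 a b c d"
  shows "x = inner x a *\<^sub>R a + inner x b *\<^sub>R b + inner x c *\<^sub>R c + inner x d *\<^sub>R d"
proof -
  let ?y = "x - (inner x a *\<^sub>R a + inner x b *\<^sub>R b + inner x c *\<^sub>R c + inner x d *\<^sub>R d)"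
  have "?y = 0"
    by (rule orthogonal_frame_zero[of a b c d])
       (use assms orthonormal4_sym[OF assms] in \<open>auto simp: orthonormal4_def inner_diff_left inner_add_left\<close>)
  then show ?thesis by simp
qed

lemma orthonormal_pair_extend:
  fixes a b :: "real ^ 4"
  assumes "inner a a = 1" "inner b b = 1" "inner a b = 0"
  obtains c d where "orthonormal4 a b c d"
proof -
  have "card {a, b} < 4" by (simp add: card_insert_if)
  then obtain c where c: "inner c c = 1" "\<And>y. y \<in> {a, b} \<Longrightarrow> inner c y = 0"
    using exists_unit_orthogonal[of "{a, b}"] by auto
  have "card {a, b, c} < 4" by (simp add: card_insert_if)
  then obtain d where d: "inner d d = 1" "\<And>y. y \<in> {a, b, c} \<Longrightarrow> inner d y = 0"
    using exists_unit_orthogonal[of "{a, b, c}"] by auto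
  have "orthonormal4 a b c d"
    using assms c d unfolding orthonormal4_def by (simp add: inner_commute)
  then show ?thesis using that by blast
qed

section \<open>Rotational symmetry from the fundamental forms\<close>

text \<open>For \<open>h = cos \<phi>\<close> this is the distance of the real number
  \<open>q\<close> from \<open>cis \<phi>\<close>. It turns out to be the angular velocity in x of
  the rotation that generates the surface.\<close>

definition freq :: "real \<Rightarrow> real \<Rightarrow> real" where
  "freq q h = sqrt (1 + q^2 - 2 * q * h)"

definition radius :: "real \<Rightarrow> real \<Rightarrow> real \<Rightarrow> real" where
  "radius q h y = sqrt (1 - h^2) * dn q y / freq q h"

text \<open>\<open>s\<close> is \<open>sin \<phi>\<close> up to sign. The Hopf differential is real,
  so the coordinate lines are curvature lines; the sign of its coefficient has been moved into
  \<open>h\<close> and \<open>s\<close> so that \<open>q\<close> is positive.\<close>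

locale revolution_surface =
  fixes f N :: "complex \<Rightarrow> real ^ 4" and q h s :: real
  assumes smooth: "smooth_map f" and sphere: "range f \<subseteq> sphere 0 1"
    and normal: "unit_normal_field f N"
    and q: "0 < q" "q \<le> 1" and s: "s \<noteq> 0" "s^2 = 1 - h^2"
    and first: "\<And>z w. first_form f z w = s^2 * (dn q (Im z))^2 * (cmod w)^2"
    and second: "\<And>z w. second_form f N z w = s * (h * (dn q (Im z))^2 * (cmod w)^2 - q * Re (w^2))"
begin

abbreviation "fx \<equiv> dir_deriv 1 f"
abbreviation "fy \<equiv> dir_deriv \<i> f"
abbreviation "fxx \<equiv> dir_deriv 1 fx"
abbreviation "fxy \<equiv> dir_deriv \<i> fx"
abbreviation "fxxx \<equiv> dir_deriv 1 fxx"
abbreviation "v z \<equiv> dn q (Im z)"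
abbreviation "v' z \<equiv> dn' q (Im z)"

abbreviation "c \<equiv> freq q h"

lemma c_sq_pos: "0 < 1 + q^2 - 2 * q * h"
proof -
  have "1 + q^2 - 2 * q * h = (q - h)^2 + s^2" using s by (simp add: power2_eq_square algebra_simps)
  then show ?thesis using s(1) by (simp add: add_nonneg_pos)
qed

lemma c_pos: "0 < c" and c_sq: "c^2 = 1 + q^2 - 2 * q * h"
  unfolding freq_def using c_sq_pos by (simp_all add: less_imp_le)

lemma h_abs_less: "\<bar>h\<bar> < 1"
proof -
  have "0 < s^2" using s(1) by simp
  then have "h^2 < 1" using s(2) by simp
  then show ?thesis by (simp add: abs_square_less_1)
qed

lemmas smooth' = smooth smooth_map_dir_deriv[OF smooth]
  smooth_map_dir_deriv[OF smooth_map_dir_deriv[OF smooth]]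
  smooth_map_dir_deriv[OF smooth_map_dir_deriv[OF smooth_map_dir_deriv[OF smooth]]]

lemma diff': "f differentiable_on UNIV" "dir_deriv w f differentiable_on UNIV"
  using smooth' smooth_map_differentiable by blast+

lemma v_pos: "0 < dn q y" by (rule dn_pos[OF q])
lemma v_ne: "dn q y \<noteq> 0" using v_pos[of y] by simp

lemma v_sq_deriv: "((\<lambda>y. k * (dn q y)^2) has_real_derivative k * (2 * dn q y * dn' q y)) (at y)"
  by (auto intro!: derivative_eq_intros dn_deriv[OF q])

lemma ff: "inner (f z) (f z) = 1"
proof -
  have "f z \<in> sphere 0 1" using sphere by blast
  then show ?thesis by (simp add: dot_square_norm)
qed

lemma f_fx: "inner (f z) (fx z) = 0"
  using inner_deriv_x[OF smooth smooth, of "\<lambda>_. 1" z] ff by (simp add: inner_commute)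

lemma f_fy: "inner (f z) (fy z) = 0"
  using inner_deriv_y[OF smooth smooth, of "\<lambda>_. 1" 0 z] ff by (simp add: inner_commute)

lemma fx_fx: "inner (fx z) (fx z) = s^2 * (v z)^2"
  using first[of z 1] by (simp add: first_form_def)

lemma fy_fy: "inner (fy z) (fy z) = s^2 * (v z)^2"
  using first[of z \<i>] by (simp add: first_form_def)

lemma dir_deriv_diagonal: "dir_deriv (1 + \<i>) f = (\<lambda>z. fx z + fy z)"
  using dir_deriv_add_direction[OF diff'(1)] by blast

lemma fx_fy: "inner (fx z) (fy z) = 0"
proof -
  have "inner (fx z + fy z) (fx z + fy z) = s^2 * (v z)^2 * 2"
    using first[of z "1 + \<i>"] by (simp add: first_form_def dir_deriv_diagonal cmod_power2)
  then show ?thesis using fx_fx[of z] fy_fy[of z]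
    by (simp add: inner_add_left inner_add_right inner_commute)
qed

lemma N_f: "inner (N z) (f z) = 0" and N_fx: "inner (N z) (fx z) = 0" and N_fy: "inner (N z) (fy z) = 0"
  and N_N: "inner (N z) (N z) = 1"
  using normal unfolding unit_normal_field_def by (auto simp: dot_square_norm)

lemma fyx: "dir_deriv 1 fy = fxy" using mixed_partials[OF smooth] by blast

section \<open>Structure equations in the frame f, f_x, f_y, N\<close>

definition L :: "real \<Rightarrow> real" where "L y = s * (h * (dn q y)^2 - q)"

lemma fxx_N: "inner (fxx z) (N z) = L (Im z)"
  using second[of z 1] by (simp add: second_form_def L_def)

text \<open>Polarisation: the second form is given only as a quadratic form. In the direction 1 + i
  the term \<open>Re (w^2)\<close> vanishes, and subtracting the values in the directions 1 and i
  leaves the mixed coefficient.\<close>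

lemma fxy_N: "inner (fxy z) (N z) = 0"
proof -
  have 1: "dir_deriv (1 + \<i>) (dir_deriv (1 + \<i>) f) z = fxx z + fxy z + (fxy z + dir_deriv \<i> fy z)"
    unfolding dir_deriv_diagonal dir_deriv_add[OF diff'(2) diff'(2)]
      dir_deriv_add_direction[OF diff'(2)] fyx by simp
  have "(cmod (1 + \<i>))^2 = 2" "Re ((1 + \<i>)^2) = 0"
    by (simp add: cmod_power2) (simp add: power2_eq_square)
  then have "inner (fxx z + fxy z + (fxy z + dir_deriv \<i> fy z)) (N z) = s * (h * (v z)^2 * 2)"
    using second[of z "1 + \<i>"] unfolding second_form_def 1 by simp
  moreover have "inner (dir_deriv \<i> fy z) (N z) = s * (h * (v z)^2 + q)"
    using second[of z \<i>] by (simp add: second_form_def)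
  ultimately show ?thesis using fxx_N[of z] unfolding inner_add_left L_def by (simp add: algebra_simps)
qed

lemma frame_zero:
  assumes "inner x (f z) = 0" "inner x (fx z) = 0" "inner x (fy z) = 0" "inner x (N z) = 0"
  shows "x = 0"
proof (rule orthogonal_frame_zero[OF _ _ _ _ _ _ _ _ _ _ assms])
  show "f z \<noteq> 0" "N z \<noteq> 0" using ff[of z] N_N[of z] by auto
  have "0 < s^2 * (v z)^2" using s(1) v_pos[of "Im z"] by simp
  then show "fx z \<noteq> 0" "fy z \<noteq> 0" using fx_fx[of z] fy_fy[of z] by auto
qed (use f_fx[of z] f_fy[of z] fx_fy[of z] N_f[of z] N_fx[of z] N_fy[of z] in \<open>simp_all add: inner_commute\<close>)

text \<open>Since the metric depends on y alone and the mixed coefficient of the second form is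
  zero, only the component along f_x survives. Consequently f_x divided by dn is constant in
  y.\<close>

lemma fxy_eq: "fxy z = (v' z / v z) *\<^sub>R fx z"
proof -
  have 1: "inner (fxy z) (f z) = 0"
    using inner_deriv_y[OF smooth'(2) smooth, of 1 "\<lambda>_. 0" 0 z] f_fx fx_fy by (simp add: inner_commute)
  have 2: "inner (fxy z) (fx z) = s^2 * v z * v' z"
    using inner_deriv_y[OF smooth'(2) smooth'(2) fx_fx v_sq_deriv, of z] by (simp add: inner_commute)
  have 3: "inner (fxy z) (fy z) = 0"
    using inner_deriv_x[OF smooth'(2) smooth'(2) fy_fy, of z] by (simp add: inner_commute fyx)
  have "fxy z - (v' z / v z) *\<^sub>R fx z = 0"
    by (rule frame_zero[of _ z])
       (use 1 2 3 f_fx[of z] fx_fx[of z] fx_fy[of z] fxy_N[of z] N_fx[of z] v_ne[of "Im z"] in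
        \<open>auto simp: inner_diff_left inner_diff_right inner_commute power2_eq_square\<close>)
  then show ?thesis by simp
qed

lemma fxx_f: "inner (fxx z) (f z) = - (s^2) * (v z)^2"
  using inner_deriv_x[OF smooth'(2) smooth, of 1 "\<lambda>_. 0" z] f_fx fx_fx[of z] by (simp add: inner_commute)

lemma fxx_fx: "inner (fxx z) (fx z) = 0"
  using inner_deriv_x[OF smooth'(2) smooth'(2) fx_fx, of z] by (simp add: inner_commute)

lemma fxx_fy: "inner (fxx z) (fy z) = - (s^2) * v z * v' z"
proof -
  have "inner (fx z) (fxy z) = s^2 * v z * v' z"
    unfolding fxy_eq using fx_fx[of z] v_ne[of "Im z"] by (simp add: power2_eq_square)
  then show ?thesis
    using inner_deriv_x[OF smooth'(2) smooth'(2), of 1 \<i> "\<lambda>_. 0" z] fx_fy by (simp add: fyx)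
qed

lemma fxx_eq: "fxx z = - (s^2 * (v z)^2) *\<^sub>R f z - (v' z / v z) *\<^sub>R fy z + L (Im z) *\<^sub>R N z"
proof -
  have "fxx z - (- (s^2 * (v z)^2) *\<^sub>R f z - (v' z / v z) *\<^sub>R fy z + L (Im z) *\<^sub>R N z) = 0"
    by (rule frame_zero[of _ z])
       (use fxx_f[of z] fxx_fx[of z] fxx_fy[of z] fxx_N[of z] ff[of z] f_fx[of z] f_fy[of z] fx_fy[of z]
         fy_fy[of z] N_f[of z] N_fx[of z] N_fy[of z] N_N[of z] v_ne[of "Im z"] in
        \<open>simp_all add: inner_diff_left inner_add_left inner_diff_right inner_add_right inner_commute power2_eq_square\<close>)
  then show ?thesis by simp
qed

text \<open>After expansion in the frame, the differential equation of dn cancels the terms in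
  \<open>dn^4\<close> and the constant terms of \<open>s^2 * v^4 + v'^2 + (h * v^2 - q)^2\<close>;
  the remaining coefficient of \<open>v^2\<close> is the square of the frequency.\<close>

lemma fxx_fxx: "inner (fxx z) (fxx z) = s^2 * c^2 * (v z)^2"
proof -
  let ?v = "v z"
  have "inner (fxx z) (fxx z) = inner (fxx z) (- (s^2 * ?v^2) *\<^sub>R f z - (v' z / ?v) *\<^sub>R fy z + L (Im z) *\<^sub>R N z)"
    by (subst (2) fxx_eq) simp
  also have "\<dots> = (s^2 * ?v^2) * (s^2 * ?v^2) + (v' z / ?v) * (s^2 * ?v * v' z) + L (Im z) * L (Im z)"
    by (simp add: inner_diff_right inner_add_right fxx_f fxx_fy fxx_N)
  also have "\<dots> = s^2 * (s^2 * ?v^4 + (v' z)^2 + (h * ?v^2 - q)^2)"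
    using v_ne[of "Im z"] by (simp add: L_def power2_eq_square field_simps eval_nat_numeral)
  also have "\<dots> = s^2 * c^2 * ?v^2"
    unfolding dn'_sq[OF q] c_sq s(2) by (simp add: power2_eq_square algebra_simps eval_nat_numeral)
  finally show ?thesis .
qed

lemma fxxx_f: "inner (fxxx z) (f z) = 0"
  using inner_deriv_x[OF smooth'(3) smooth fxx_f, of z] fxx_fx[of z] by simp

lemma fxxx_fx: "inner (fxxx z) (fx z) = - (s^2) * c^2 * (v z)^2"
  using inner_deriv_x[OF smooth'(3) smooth'(2), of 1 1 1 "\<lambda>_. 0" z] fxx_fx fxx_fxx[of z]
  by (simp add: inner_commute)

lemma fxxx_fy: "inner (fxxx z) (fy z) = 0"
  using inner_deriv_x[OF smooth'(3) smooth'(2) fxx_fy, of z] fxx_fx[of z] by (simp add: fyx fxy_eq)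

lemma fxxx_fxx: "inner (fxxx z) (fxx z) = 0"
  using inner_deriv_x[OF smooth'(3) smooth'(3) fxx_fxx, of z] by (simp add: inner_commute)

text \<open>\<open>N\<close> is only known to be continuous, so \<open>\<langle>f\<^sub>x\<^sub>x\<^sub>x, N\<rangle>\<close> is read off from \<open>\<langle>f\<^sub>x\<^sub>x\<^sub>x, f\<^sub>x\<^sub>x\<rangle>\<close>, which needs \<open>L \<noteq> 0\<close>;
  this holds at \<open>y = K'\<close> for every \<open>h\<close>.\<close>

lemma fxxx_eq_at_K: "fxxx (Complex x (Kc q)) = - (c^2) *\<^sub>R fx (Complex x (Kc q))"
proof -
  let ?z = "Complex x (Kc q)"
  have "h * q < 1"
  proof (cases "h \<le> 0")
    case True then have "h * q \<le> 0" using q by (simp add: mult_nonpos_nonneg) then show ?thesis by simp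
  next
    case False
    then have "h * q \<le> h * 1" using q by (intro mult_left_mono) auto
    then show ?thesis using h_abs_less by simp
  qed
  then have "q * (h * q - 1) \<noteq> 0" using q by simp
  moreover have "L (Kc q) = s * (q * (h * q - 1))"
    unfolding L_def dn_K[OF q] by (simp add: power2_eq_square algebra_simps)
  ultimately have "L (Kc q) \<noteq> 0" using s by simp
  moreover have "L (Kc q) * inner (fxxx ?z) (N ?z) = 0"
  proof -
    have "inner (fxxx ?z) (fxx ?z) = inner (fxxx ?z) (- (s^2 * (v ?z)^2) *\<^sub>R f ?z - (v' ?z / v ?z) *\<^sub>R fy ?z + L (Im ?z) *\<^sub>R N ?z)"
      by (rule arg_cong[OF fxx_eq])
    then show ?thesis
      unfolding fxxx_fxx by (simp add: inner_diff_right inner_add_right fxxx_f fxxx_fy)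
  qed
  ultimately have n: "inner (fxxx ?z) (N ?z) = 0" by simp
  have "fxxx ?z + (c^2) *\<^sub>R fx ?z = 0"
    by (rule frame_zero[of _ ?z])
       (use n fxxx_f[of ?z] fxxx_fx[of ?z] fxxx_fy[of ?z] f_fx[of ?z] fx_fx[of ?z] fx_fy[of ?z] N_fx[of ?z]
         in \<open>simp_all add: inner_add_left inner_add_right inner_commute\<close>)
  then show ?thesis by (simp add: eq_neg_iff_add_eq_0)
qed

section \<open>Integration of the structure equations: circles plus a profile\<close>

lemma fx_eq: "fx (Complex x y) = dn q y *\<^sub>R fx (Complex x 0)"
proof -
  have "((\<lambda>y. inverse (dn q y) *\<^sub>R fx (Complex x y)) has_vector_derivative 0) (at y)" for y
  proof -
    have "((\<lambda>y. inverse (dn q y)) has_real_derivative - (inverse (dn q y) * dn' q y * inverse (dn q y))) (at y)"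
      by (rule DERIV_inverse'[OF dn_deriv[OF q] v_ne])
    from has_vector_derivative_scaleR[OF this differentiable_has_vector_derivative_y[OF diff'(2)[of 1], of x y]]
    show ?thesis unfolding fxy_eq by (simp add: divide_inverse mult_ac)
  qed
  from has_vector_derivative_zero_eq[OF this, of y 0] 
  have "inverse (dn q y) *\<^sub>R fx (Complex x y) = fx (Complex x 0)" by (simp add: dn_0[OF q])
  then have "dn q y *\<^sub>R (inverse (dn q y) *\<^sub>R fx (Complex x y)) = dn q y *\<^sub>R fx (Complex x 0)" by simp
  then show ?thesis using v_ne[of y] by simp
qed

lemma dir_deriv_x_separated:
  assumes g: "g differentiable_on UNIV" "\<And>x y. g (Complex x y) = dn q y *\<^sub>R g (Complex x 0)"
  shows "dir_deriv 1 g (Complex x y) = dn q y *\<^sub>R dir_deriv 1 g (Complex x 0)"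
proof -
  have "((\<lambda>x. g (Complex x y)) has_vector_derivative dir_deriv 1 g (Complex x y)) (at x)"
    by (rule differentiable_has_vector_derivative_x[OF g(1)])
  moreover have "((\<lambda>x. dn q y *\<^sub>R g (Complex x 0)) has_vector_derivative dn q y *\<^sub>R dir_deriv 1 g (Complex x 0)) (at x)"
    using has_vector_derivative_scaleR[OF DERIV_const differentiable_has_vector_derivative_x[OF g(1)]] by simp
  ultimately show ?thesis unfolding g(2)[of _ y] using vector_derivative_unique_at by blast
qed

lemma fxx_sep: "fxx (Complex x y) = dn q y *\<^sub>R fxx (Complex x 0)"
  by (rule dir_deriv_x_separated[OF diff'(2) fx_eq])

text \<open>Along a vertical line both sides are proportional to dn, so the identity at height K'
  can be moved to height 0.\<close>

lemma fxxx_eq: "fxxx (Complex x 0) = - (c^2) *\<^sub>R fx (Complex x 0)"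
proof -
  have 2: "fxxx (Complex x y) = dn q y *\<^sub>R fxxx (Complex x 0)" for x y
    by (rule dir_deriv_x_separated[OF _ fxx_sep]) (rule smooth_map_differentiable[OF smooth'(3)])
  have "dn q (Kc q) *\<^sub>R fxxx (Complex x 0) = dn q (Kc q) *\<^sub>R (- (c^2) *\<^sub>R fx (Complex x 0))"
    using fxxx_eq_at_K[of x] unfolding 2[of x "Kc q"] fx_eq[of x "Kc q"] by simp
  then show ?thesis by (rule scaleR_left_imp_eq[OF v_ne])
qed

definition "A = fx 0"
definition "B = (1 / c) *\<^sub>R fxx 0"

lemma AB: "inner A A = s^2" "inner B B = s^2" "inner A B = 0"
proof -
  show "inner A A = s^2" unfolding A_def using fx_fx[of 0] by (simp add: dn_0[OF q])
  have "inner (fxx 0) (fxx 0) = s^2 * c^2" using fxx_fxx[of 0] by (simp add: dn_0[OF q])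
  then show "inner B B = s^2" unfolding B_def using c_pos by (simp add: power2_eq_square)
  show "inner A B = 0" unfolding A_def B_def using fxx_fx[of 0] by (simp add: inner_commute)
qed

text \<open>The pair formed by f_x and f_xx / c solves the harmonic oscillator. Rotating it back by
  the angle c x gives two constant vectors, found to be \<open>A\<close> and \<open>B\<close> at x =
  0, and the rotation is then inverted.\<close>

lemma fx_trig: "fx (Complex x 0) = cos (c * x) *\<^sub>R A + sin (c * x) *\<^sub>R B"
proof -
  let ?g = "\<lambda>x. fx (Complex x 0)" and ?g1 = "\<lambda>x. fxx (Complex x 0)"
  have g: "(?g has_vector_derivative ?g1 x) (at x)" for x
    by (rule differentiable_has_vector_derivative_x[OF diff'(2)])
  have g1: "(?g1 has_vector_derivative - (c^2) *\<^sub>R ?g x) (at x)" for x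
    unfolding fxxx_eq[symmetric]
    by (rule differentiable_has_vector_derivative_x[OF smooth_map_differentiable[OF smooth'(3)]])
  have dc: "((\<lambda>x. cos (c * x)) has_real_derivative - c * sin (c * x)) (at x)"
    and ds: "((\<lambda>x. sin (c * x)) has_real_derivative c * cos (c * x)) (at x)"
    and dc': "((\<lambda>x. cos (c * x) / c) has_real_derivative - sin (c * x)) (at x)"
    and ds': "((\<lambda>x. sin (c * x) / c) has_real_derivative cos (c * x)) (at x)" for x
    using c_pos by (auto intro!: derivative_eq_intros)
  have "((\<lambda>x. cos (c * x) *\<^sub>R ?g x - (sin (c * x) / c) *\<^sub>R ?g1 x) has_vector_derivative 0) (at x)" for x
    using has_vector_derivative_diff[OF has_vector_derivative_scaleR[OF dc g] has_vector_derivative_scaleR[OF ds' g1], of x]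
      c_pos by (simp add: power2_eq_square algebra_simps)
  from has_vector_derivative_zero_eq[OF this, of x 0]
  have 1: "cos (c * x) *\<^sub>R ?g x - (sin (c * x) / c) *\<^sub>R ?g1 x = A" by (simp add: A_def Complex_eq)
  have "((\<lambda>x. sin (c * x) *\<^sub>R ?g x + (cos (c * x) / c) *\<^sub>R ?g1 x) has_vector_derivative 0) (at x)" for x
    using has_vector_derivative_add[OF has_vector_derivative_scaleR[OF ds g] has_vector_derivative_scaleR[OF dc' g1], of x]
      c_pos by (simp add: power2_eq_square algebra_simps)
  from has_vector_derivative_zero_eq[OF this, of x 0]
  have 2: "sin (c * x) *\<^sub>R ?g x + (cos (c * x) / c) *\<^sub>R ?g1 x = B" by (simp add: B_def Complex_eq)
  have "cos (c * x) *\<^sub>R A + sin (c * x) *\<^sub>R B =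
      (cos (c * x) * cos (c * x)) *\<^sub>R ?g x + (sin (c * x) * sin (c * x)) *\<^sub>R ?g x"
    unfolding 1[symmetric] 2[symmetric] by (simp add: algebra_simps)
  also have "\<dots> = ?g x"
    unfolding scaleR_left_distrib[symmetric] by (simp only: sin_cos_squared_add3 scaleR_one)
  finally show ?thesis by simp
qed

definition "P y = f (Complex 0 y) + (dn q y / c) *\<^sub>R B"

lemma f_eq: "f (Complex x y) = (dn q y / c) *\<^sub>R (sin (c * x) *\<^sub>R A - cos (c * x) *\<^sub>R B) + P y"
proof -
  have "((\<lambda>x. f (Complex x y) - (dn q y / c) *\<^sub>R (sin (c * x) *\<^sub>R A - cos (c * x) *\<^sub>R B)) has_vector_derivative 0) (at x)" for x
  proof -
    have dc: "((\<lambda>x. cos (c * x)) has_real_derivative - c * sin (c * x)) (at x)"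
      and ds: "((\<lambda>x. sin (c * x)) has_real_derivative c * cos (c * x)) (at x)"
      by (auto intro!: derivative_eq_intros)
    have "((\<lambda>x. sin (c * x) *\<^sub>R A - cos (c * x) *\<^sub>R B) has_vector_derivative c *\<^sub>R fx (Complex x 0)) (at x)"
      using has_vector_derivative_diff[OF has_vector_derivative_scaleR[OF ds has_vector_derivative_const]
          has_vector_derivative_scaleR[OF dc has_vector_derivative_const], of A B]
      unfolding fx_trig by (simp add: algebra_simps)
    from has_vector_derivative_diff[OF differentiable_has_vector_derivative_x[OF diff'(1)]
        has_vector_derivative_scaleR[OF DERIV_const this], of y "dn q y / c"]
    show ?thesis using c_pos unfolding fx_eq[of x y] by simp
  qed
  from has_vector_derivative_zero_eq[OF this, of x 0] show ?thesis by (simp add: P_def algebra_simps)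
qed

lemma P_AB: "inner (P y) A = 0" "inner (P y) B = 0"
proof -
  have *: "inner (P y) (cos (c * x) *\<^sub>R A + sin (c * x) *\<^sub>R B) = 0" for x
  proof -
    have "inner (f (Complex x y)) (fx (Complex x y)) = 0" by (rule f_fx)
    then have "inner (f (Complex x y)) (cos (c * x) *\<^sub>R A + sin (c * x) *\<^sub>R B) = 0"
      unfolding fx_eq[of x y] fx_trig using v_ne by simp
    moreover have "inner (sin (c * x) *\<^sub>R A - cos (c * x) *\<^sub>R B) (cos (c * x) *\<^sub>R A + sin (c * x) *\<^sub>R B) = 0"
      using AB by (simp add: inner_diff_left inner_add_right inner_commute algebra_simps)
    ultimately show ?thesis unfolding f_eq by (simp add: inner_add_left)
  qed
  show "inner (P y) A = 0" using *[of 0] by simp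
  show "inner (P y) B = 0" using *[of "pi / (2 * c)"] c_pos by simp
qed

end

section \<open>Areal velocity and polar form of the profile\<close>

lemma orthonormal4_inner:
  assumes "orthonormal4 a b c d"
  shows "inner x y = inner x a * inner y a + inner x b * inner y b + inner x c * inner y c + inner x d * inner y d"
proof -
  have "inner x y = inner (inner x a *\<^sub>R a + inner x b *\<^sub>R b + inner x c *\<^sub>R c + inner x d *\<^sub>R d) y"
    using arg_cong[OF orthonormal4_expand[OF assms, of x], of "\<lambda>t. inner t y"] .
  then show ?thesis
    by (simp add: inner_add_left inner_commute[of a y] inner_commute[of b y] inner_commute[of c y] inner_commute[of d y])
qed

text \<open>The cross product of u and w is a multiple of their common unit normal n, the factor
  being the determinant D. It will be applied to the profile point, its velocity and the surface
  normal in the coordinates \<open>a\<close>, \<open>e1\<close>, \<open>e2\<close>; the first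
  component is then the areal velocity X Y' - Y X', known once the component of \<open>N\<close>
  along \<open>a\<close> is known.\<close>

lemma cross_product_normal:
  fixes n1 :: real
  assumes u: "u1^2 + u2^2 + u3^2 = 1" and w: "w1^2 + w2^2 + w3^2 = m" and n: "n1^2 + n2^2 + n3^2 = 1"
    and uw: "u1 * w1 + u2 * w2 + u3 * w3 = 0" and un: "u1 * n1 + u2 * n2 + u3 * n3 = 0"
    and wn: "w1 * n1 + w2 * n2 + w3 * n3 = 0"
  defines "D \<equiv> n1 * (u2 * w3 - u3 * w2) + n2 * (u3 * w1 - u1 * w3) + n3 * (u1 * w2 - u2 * w1)"
  shows "u2 * w3 - u3 * w2 = D * n1" and "D^2 = m"
proof -
  let ?c1 = "u2 * w3 - u3 * w2" and ?c2 = "u3 * w1 - u1 * w3" and ?c3 = "u1 * w2 - u2 * w1"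
  have n': "n1 * n1 + n2 * n2 + n3 * n3 = 1" using n by (simp add: power2_eq_square)
  have 12: "n2 * ?c1 - n1 * ?c2 = 0" using un wn by algebra
  have 13: "n3 * ?c1 - n1 * ?c3 = 0" using un wn by algebra
  have 23: "n3 * ?c2 - n2 * ?c3 = 0" using un wn by algebra
  have c1: "?c1 = D * n1" unfolding D_def using n' 12 13 by algebra
  have c2: "?c2 = D * n2" unfolding D_def using n' 12 23 by algebra
  have c3: "?c3 = D * n3" unfolding D_def using n' 13 23 by algebra
  show "?c1 = D * n1" by (rule c1)
  have "D^2 = ?c1^2 + ?c2^2 + ?c3^2" unfolding c1 c2 c3 using n by algebra
  also have "\<dots> = m" using u w uw by algebra
  finally show "D^2 = m" .
qed

lemma continuous_sign_constant:
  fixes g :: "real \<Rightarrow> real"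
  assumes "continuous_on UNIV g" "\<And>y. (g y)^2 = 1"
  obtains e where "e^2 = 1" "\<And>y. g y = e"
proof -
  have "g ` UNIV \<subseteq> {1, -1}" using assms(2) by (auto simp: power2_eq_1_iff)
  then have "finite (range g)" by (rule finite_subset) simp
  then have "g constant_on UNIV"
    using continuous_finite_range_constant[OF _ assms(1)] by simp
  then show ?thesis using that assms(2) unfolding constant_on_def by (metis UNIV_I)
qed

context revolution_surface
begin

lemma abs_s: "sqrt (1 - h^2) = \<bar>s\<bar>" using s(2) by (metis real_sqrt_abs)

lemma radius_eq: "radius q h y = \<bar>s\<bar> * dn q y / c" by (simp add: radius_def abs_s)

text \<open>The sign \<open>\<epsilon>\<close> is the orientation of the frame; it is constant because \<open>N\<close> is continuous, and it is what
  excludes a reflection at the zeros of \<open>q - h v\<^sup>2\<close>.\<close>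

lemma representation:
  obtains a b e1 e2 X Y X' Y' \<epsilon> where "orthonormal4 a b e1 e2" "\<epsilon>^2 = (1::real)"
    "\<And>z. f z = (radius q h (Im z) * cos (c * Re z)) *\<^sub>R a + (radius q h (Im z) * sin (c * Re z)) *\<^sub>R b
       + X (Im z) *\<^sub>R e1 + Y (Im z) *\<^sub>R e2"
    "\<And>y. (X has_real_derivative X' y) (at y)" "\<And>y. (Y has_real_derivative Y' y) (at y)"
    "\<And>y. (X y)^2 + (Y y)^2 = 1 - (radius q h y)^2"
    "\<And>y. X y * Y' y - Y y * X' y = \<epsilon> * (\<bar>s\<bar> / c * (q - h * (dn q y)^2))"
proof -
  \<comment> \<open>\<open>B\<close> is the normalised acceleration of the rotation and points
    towards the axis; the minus sign makes \<open>a\<close> the outward direction at x = 0.\<close>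
  define a where "a = (- 1 / \<bar>s\<bar>) *\<^sub>R B"
  define b where "b = (1 / \<bar>s\<bar>) *\<^sub>R A"
  have ab: "inner a a = 1" "inner b b = 1" "inner a b = 0"
    unfolding a_def b_def using AB s(1) by (simp_all add: power2_eq_square inner_commute)
  obtain e1 e2 where on: "orthonormal4 a b e1 e2" using orthonormal_pair_extend[OF ab] .
  have As: "A = \<bar>s\<bar> *\<^sub>R b" "B = - (\<bar>s\<bar> *\<^sub>R a)" unfolding a_def b_def using s(1) by simp_all
  define F where "F y = f (Complex 0 y)" for y
  define G where "G y = fy (Complex 0 y)" for y
  define M where "M y = N (Complex 0 y)" for y
  have F_deriv: "(F has_vector_derivative G y) (at y)" for y
    unfolding F_def G_def by (rule differentiable_has_vector_derivative_y[OF diff'(1)])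
  have coord_deriv: "((\<lambda>y. inner (F y) e) has_real_derivative inner (G y) e) (at y)" for e y
    using has_real_derivative_inner[OF F_deriv[of y] has_vector_derivative_const[of e]] by simp
  have P_ab: "inner (P y) a = 0" "inner (P y) b = 0" for y
    unfolding a_def b_def using P_AB by simp_all
  have f': "f (Complex x y) = (radius q h y * cos (c * x)) *\<^sub>R a + (radius q h y * sin (c * x)) *\<^sub>R b + P y" for x y
    unfolding f_eq As radius_eq by (simp add: algebra_simps)
  have F_eq: "F y = radius q h y *\<^sub>R a + P y" for y unfolding F_def f' by simp
  have F_a: "inner (F y) a = radius q h y" and F_b: "inner (F y) b = 0" for y
    unfolding F_eq using ab P_ab by (simp_all add: inner_add_left)
  have G_b: "inner (G y) b = 0" for y
  proof -
    have "((\<lambda>y. 0) has_real_derivative inner (G y) b) (at y)" using coord_deriv[where e = b and y = y] by (simp add: F_b)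
    then show ?thesis using DERIV_unique DERIV_const by blast
  qed
  have M_b: "inner (M y) b = 0" for y
  proof -
    have "fx (Complex 0 y) = (dn q y * \<bar>s\<bar>) *\<^sub>R b" unfolding fx_eq[of 0 y] fx_trig As by simp
    then have "(dn q y * \<bar>s\<bar>) * inner (M y) b = 0" using N_fx[of "Complex 0 y"] by (simp add: M_def)
    then show ?thesis using v_ne s(1) by simp
  qed
  have M_a: "inner (M y) a = - L y / (dn q y * c * \<bar>s\<bar>)" for y
  proof -
    have "fxx 0 = c *\<^sub>R B" unfolding B_def using c_pos by simp
    then have "fxx (Complex 0 y) = - (dn q y * c * \<bar>s\<bar>) *\<^sub>R a"
      unfolding fxx_sep[of 0 y] As by (simp add: Complex_eq)
    then have "- (dn q y * c * \<bar>s\<bar>) * inner (M y) a = L y"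
      using fxx_N[of "Complex 0 y"] by (simp add: M_def inner_commute)
    then show ?thesis using v_ne[of y] c_pos s(1) by (simp add: field_simps)
  qed
  define X where "X y = inner (F y) e1" for y
  define Y where "Y y = inner (F y) e2" for y
  define X' where "X' y = inner (G y) e1" for y
  define Y' where "Y' y = inner (G y) e2" for y
  define R' where "R' y = inner (G y) a" for y
  define D where "D y = inner (M y) a * (X y * Y' y - Y y * X' y)
      + inner (M y) e1 * (Y y * R' y - radius q h y * Y' y)
      + inner (M y) e2 * (radius q h y * X' y - X y * R' y)" for y
  note inn = orthonormal4_inner[OF on]
  have FF: "(radius q h y)^2 + (X y)^2 + (Y y)^2 = 1" for y
    using ff[of "Complex 0 y"] inn[of "F y" "F y"]
    by (simp add: F_def[symmetric] F_a F_b X_def Y_def power2_eq_square)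
  have GG: "(R' y)^2 + (X' y)^2 + (Y' y)^2 = s^2 * (dn q y)^2" for y
    using fy_fy[of "Complex 0 y"] inn[of "G y" "G y"]
    by (simp add: G_def[symmetric] G_b R'_def X'_def Y'_def power2_eq_square)
  have MM: "(inner (M y) a)^2 + (inner (M y) e1)^2 + (inner (M y) e2)^2 = 1" for y
    using N_N[of "Complex 0 y"] inn[of "M y" "M y"]
    by (simp add: M_def[symmetric] M_b power2_eq_square)
  have FG: "radius q h y * R' y + X y * X' y + Y y * Y' y = 0" for y
    using f_fy[of "Complex 0 y"] inn[of "F y" "G y"]
    by (simp add: F_def[symmetric] G_def[symmetric] F_a F_b R'_def X_def Y_def X'_def Y'_def)
  have FM: "radius q h y * inner (M y) a + X y * inner (M y) e1 + Y y * inner (M y) e2 = 0" for y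
    using N_f[of "Complex 0 y"] inn[of "M y" "F y"]
    by (simp add: F_def[symmetric] M_def[symmetric] F_a F_b X_def Y_def mult.commute)
  have GM: "R' y * inner (M y) a + X' y * inner (M y) e1 + Y' y * inner (M y) e2 = 0" for y
    using N_fy[of "Complex 0 y"] inn[of "M y" "G y"]
    by (simp add: G_def[symmetric] M_def[symmetric] G_b R'_def X'_def Y'_def mult.commute)
  note cross = cross_product_normal[OF FF GG MM FG FM GM, folded D_def]
  have contM: "continuous_on UNIV M" unfolding M_def
    using normal unfolding unit_normal_field_def
    by (auto intro!: continuous_on_Complex_pair continuous_intros)
  have contG: "continuous_on UNIV G" unfolding G_def
    by (rule continuous_on_Complex_pair[OF smooth_map_continuous[OF smooth'(2)]]) (intro continuous_intros)+
  have contF: "continuous_on UNIV F"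
    using F_deriv by (meson continuous_at_imp_continuous_on has_vector_derivative_continuous)
  have contv: "continuous_on UNIV (dn q)"
    using dn_deriv[OF q] by (meson DERIV_isCont continuous_at_imp_continuous_on)
  have "continuous_on UNIV (\<lambda>y. D y / (\<bar>s\<bar> * dn q y))"
    unfolding D_def X_def Y_def X'_def Y'_def R'_def radius_eq
    using contM contG contF contv v_ne s(1) c_pos by (intro continuous_intros) auto
  moreover have "(D y / (\<bar>s\<bar> * dn q y))^2 = 1" for y
    using cross(2)[of y] v_ne[of y] s(1) by (simp add: power_divide power_mult_distrib)
  ultimately obtain \<epsilon> where \<epsilon>: "\<epsilon>^2 = 1" "\<And>y. D y / (\<bar>s\<bar> * dn q y) = \<epsilon>"
    using continuous_sign_constant[of "\<lambda>y. D y / (\<bar>s\<bar> * dn q y)"] by metis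
  have "X y * Y' y - Y y * X' y = (\<epsilon> * sgn s) * (\<bar>s\<bar> / c * (q - h * (dn q y)^2))" for y
  proof -
    have "D y = \<epsilon> * (\<bar>s\<bar> * dn q y)" using \<epsilon>(2)[of y] v_ne[of y] s(1) by (simp add: field_simps)
    then have "X y * Y' y - Y y * X' y = \<epsilon> * (\<bar>s\<bar> * dn q y) * (- L y / (dn q y * c * \<bar>s\<bar>))"
      using cross(1)[of y] unfolding M_a by simp
    also have "\<dots> = \<epsilon> * (- L y / c)" using v_ne[of y] s(1) by (simp add: field_simps)
    also have "\<dots> = \<epsilon> * (sgn s * \<bar>s\<bar>) / c * (q - h * (dn q y)^2)"
      unfolding L_def sgn_mult_abs by (simp add: field_simps)
    finally show ?thesis by simp
  qed
  moreover have "(\<epsilon> * sgn s)^2 = 1" using \<epsilon>(1) s(1) by (simp add: power_mult_distrib sgn_if)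
  moreover have "f z = (radius q h (Im z) * cos (c * Re z)) *\<^sub>R a + (radius q h (Im z) * sin (c * Re z)) *\<^sub>R b
       + X (Im z) *\<^sub>R e1 + Y (Im z) *\<^sub>R e2" for z
  proof -
    have "P y = X y *\<^sub>R e1 + Y y *\<^sub>R e2" for y
    proof -
      have "inner (P y) e1 = X y" "inner (P y) e2 = Y y"
        unfolding X_def Y_def F_eq using on by (simp_all add: inner_add_left orthonormal4_def)
      then show ?thesis using orthonormal4_expand[OF on, of "P y"] P_ab by simp
    qed
    then show ?thesis using f'[of "Re z" "Im z"] by simp
  qed
  moreover have "(X y)^2 + (Y y)^2 = 1 - (radius q h y)^2" for y using FF[of y] by simp
  moreover have "(X has_real_derivative X' y) (at y)" "(Y has_real_derivative Y' y) (at y)" for y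
    unfolding X_def Y_def X'_def Y'_def by (rule coord_deriv)+
  ultimately show ?thesis using that on by blast
qed

end

text \<open>The hypothesis on the areal velocity says that the unit vector (X, Y) / \<rho> rotates
  with angular velocity \<psi>'. Rotated back by \<psi> it becomes the constant unit vector (C, S),
  whose argument is \<alpha>. No lifting of angles is required.\<close>

lemma polar_form:
  fixes X Y :: "real \<Rightarrow> real"
  assumes X: "\<And>y. (X has_real_derivative X' y) (at y)" and Y: "\<And>y. (Y has_real_derivative Y' y) (at y)"
    and \<psi>: "\<And>y. (\<psi> has_real_derivative \<psi>' y) (at y)"
    and pos: "\<And>y. 0 < (X y)^2 + (Y y)^2"
    and W: "\<And>y. X y * Y' y - Y y * X' y = ((X y)^2 + (Y y)^2) * \<psi>' y"
  obtains \<alpha> where "\<And>y. X y = sqrt ((X y)^2 + (Y y)^2) * cos (\<psi> y + \<alpha>)"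
    "\<And>y. Y y = sqrt ((X y)^2 + (Y y)^2) * sin (\<psi> y + \<alpha>)"
proof -
  define \<rho> where "\<rho> y = sqrt ((X y)^2 + (Y y)^2)" for y
  have \<rho>: "0 < \<rho> y" "(\<rho> y)^2 = (X y)^2 + (Y y)^2" for y using pos[of y] by (simp_all add: \<rho>_def)
  have d\<rho>: "(\<rho> has_real_derivative (X y * X' y + Y y * Y' y) / \<rho> y) (at y)" for y
  proof -
    have "((\<lambda>y. (X y)^2 + (Y y)^2) has_real_derivative 2 * (X y * X' y + Y y * Y' y)) (at y)"
      by (auto intro!: derivative_eq_intros X Y simp: algebra_simps)
    from DERIV_chain'[OF this DERIV_real_sqrt[OF pos]]
    have "(\<rho> has_real_derivative 2 * (X y * X' y + Y y * Y' y) * (inverse (\<rho> y) / 2)) (at y)"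
      unfolding \<rho>_def[abs_def] by (simp add: mult.commute)
    moreover have "2 * a * (inverse r / 2) = a / r" for a r :: real by (simp add: field_simps)
    ultimately show ?thesis by (simp only:)
  qed
  define \<xi> where "\<xi> y = X y / \<rho> y" for y
  define \<eta> where "\<eta> y = Y y / \<rho> y" for y
  \<comment> \<open>The quotient rule for X / \<rho> and Y / \<rho> with \<rho>' = m / \<rho>,
    stated abstractly because both components use it, with k = - \<psi>' and k = \<psi>'.\<close>
  have quot: "(x' * r - x * (m / r)) / (r * r) = k * (y / r)"
    if "x' * r^2 - x * m = k * y * r^2" "r \<noteq> 0" for x' x r m k y :: real
  proof -
    have "(x' * r - x * (m / r)) / (r * r) = (x' * r^2 - x * m) / r^3"
      using that(2) by (simp add: field_simps power2_eq_square power3_eq_cube)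
    also have "\<dots> = k * (y / r)"
      unfolding that(1) using that(2) by (simp add: power2_eq_square power3_eq_cube)
    finally show ?thesis .
  qed
  have d\<xi>: "(\<xi> has_real_derivative - \<psi>' y * \<eta> y) (at y)" and d\<eta>: "(\<eta> has_real_derivative \<psi>' y * \<xi> y) (at y)" for y
  proof -
    have ne: "\<rho> y \<noteq> 0" using \<rho>(1)[of y] by simp
    have "(\<xi> has_real_derivative (X' y * \<rho> y - X y * ((X y * X' y + Y y * Y' y) / \<rho> y)) / (\<rho> y * \<rho> y)) (at y)"
      unfolding \<xi>_def[abs_def] by (rule DERIV_divide[OF X d\<rho> ne])
    moreover have "(X' y * \<rho> y - X y * ((X y * X' y + Y y * Y' y) / \<rho> y)) / (\<rho> y * \<rho> y) = - \<psi>' y * \<eta> y"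
    proof -
      have "X' y * (\<rho> y)^2 - X y * (X y * X' y + Y y * Y' y) = - (X y * Y' y - Y y * X' y) * Y y"
        unfolding \<rho>(2) by algebra
      also have "\<dots> = - \<psi>' y * Y y * (\<rho> y)^2" unfolding W \<rho>(2) by algebra
      finally show ?thesis unfolding \<eta>_def by (rule quot[OF _ ne])
    qed
    ultimately show "(\<xi> has_real_derivative - \<psi>' y * \<eta> y) (at y)" by simp
    have "(\<eta> has_real_derivative (Y' y * \<rho> y - Y y * ((X y * X' y + Y y * Y' y) / \<rho> y)) / (\<rho> y * \<rho> y)) (at y)"
      unfolding \<eta>_def[abs_def] by (rule DERIV_divide[OF Y d\<rho> ne])
    moreover have "(Y' y * \<rho> y - Y y * ((X y * X' y + Y y * Y' y) / \<rho> y)) / (\<rho> y * \<rho> y) = \<psi>' y * \<xi> y"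
    proof -
      have "Y' y * (\<rho> y)^2 - Y y * (X y * X' y + Y y * Y' y) = (X y * Y' y - Y y * X' y) * X y"
        unfolding \<rho>(2) by algebra
      also have "\<dots> = \<psi>' y * X y * (\<rho> y)^2" unfolding W \<rho>(2) by algebra
      finally show ?thesis unfolding \<xi>_def by (rule quot[OF _ ne])
    qed
    ultimately show "(\<eta> has_real_derivative \<psi>' y * \<xi> y) (at y)" by simp
  qed
  define C where "C y = \<xi> y * cos (\<psi> y) + \<eta> y * sin (\<psi> y)" for y
  define S where "S y = \<eta> y * cos (\<psi> y) - \<xi> y * sin (\<psi> y)" for y
  have "(C has_real_derivative 0) (at y)" for y
    unfolding C_def[abs_def] by (auto intro!: derivative_eq_intros d\<xi> d\<eta> \<psi> simp: algebra_simps)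
  then have C: "C y = C 0" for y using DERIV_isconst_all[of C y 0] by blast
  have "(S has_real_derivative 0) (at y)" for y
    unfolding S_def[abs_def] by (auto intro!: derivative_eq_intros d\<xi> d\<eta> \<psi> simp: algebra_simps)
  then have S: "S y = S 0" for y using DERIV_isconst_all[of S y 0] by blast
  have unit: "(\<xi> y)^2 + (\<eta> y)^2 = 1" for y
    unfolding \<xi>_def \<eta>_def power_divide add_divide_distrib[symmetric] \<rho>(2)[symmetric]
    using \<rho>(1)[of y] by simp
  have cs: "(cos t)^2 + (sin t)^2 = 1" for t :: real by simp
  have "(C 0)^2 + (S 0)^2 = ((\<xi> 0)^2 + (\<eta> 0)^2) * ((cos (\<psi> 0))^2 + (sin (\<psi> 0))^2)"
    unfolding C_def S_def by algebra
  then have "(C 0)^2 + (S 0)^2 = 1" using unit[of 0] cs by simp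
  then obtain \<alpha> where \<alpha>: "C 0 = cos \<alpha>" "S 0 = sin \<alpha>" using sincos_total_2pi by metis
  have "\<xi> y = cos (\<psi> y + \<alpha>)" "\<eta> y = sin (\<psi> y + \<alpha>)" for y
  proof -
    have k: "C y = cos \<alpha>" "S y = sin \<alpha>" using C S \<alpha> by auto
    have "cos (\<psi> y + \<alpha>) = \<xi> y * ((cos (\<psi> y))^2 + (sin (\<psi> y))^2)"
      unfolding cos_add k[symmetric] C_def S_def by algebra
    then show "\<xi> y = cos (\<psi> y + \<alpha>)" using cs by simp
    have "sin (\<psi> y + \<alpha>) = \<eta> y * ((cos (\<psi> y))^2 + (sin (\<psi> y))^2)"
      unfolding sin_add k[symmetric] C_def S_def by algebra
    then show "\<eta> y = sin (\<psi> y + \<alpha>)" using cs by simp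
  qed
  then have "X y = \<rho> y * cos (\<psi> y + \<alpha>)" "Y y = \<rho> y * sin (\<psi> y + \<alpha>)" for y
    using \<rho>(1)[of y] unfolding \<xi>_def \<eta>_def by (metis nonzero_mult_div_cancel_left order_less_irrefl times_divide_eq_right)+
  then show ?thesis using that unfolding \<rho>_def by blast
qed

section \<open>The angle of the profile curve\<close>

text \<open>This is c^2 times the squared distance \<open>1 - r^2\<close> of the profile from the
  axis at dn^2 = V. In this form it is visibly a sum of nonnegative terms that vanishes, for
  \<open>\<bar>h\<bar> < 1\<close> and \<open>V \<le> 1\<close>, only if \<open>h = q\<close> and
  \<open>V = 1\<close>.\<close>

definition denom :: "real \<Rightarrow> real \<Rightarrow> real \<Rightarrow> real" where
  "denom q h V = (q - h)^2 + (1 - h^2) * (1 - V)"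

definition ang_density :: "real \<Rightarrow> real \<Rightarrow> real \<Rightarrow> real" where
  "ang_density q h V = freq q h * sqrt (1 - h^2) * (q - h * V) / denom q h V"

text \<open>The angle as a function of the amplitude: with dy = du / dn the half period [0, K']
  becomes the fixed interval [0, pi/2], which makes the dependence on \<open>q\<close> and
  \<open>h\<close> a matter of a parameter integral.\<close>

definition Psi :: "real \<Rightarrow> real \<Rightarrow> real \<Rightarrow> real" where
  "Psi q h x = (LBINT u=ereal 0..ereal x. ang_density q h (delta2 q u) / sqrt (delta2 q u))"

definition angle :: "real \<Rightarrow> real \<Rightarrow> real \<Rightarrow> real" where
  "angle q h y = Psi q h (am q y)"

definition half_turn :: "real \<Rightarrow> real \<Rightarrow> real" where
  "half_turn q h = Psi q h (pi / 2)"

lemma abs_less_1_sq: "\<bar>h\<bar> < 1 \<Longrightarrow> 0 < 1 - (h::real)^2"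
  by (simp add: abs_square_less_1)

lemma denom_pos:
  assumes "\<bar>h\<bar> < 1" "h \<noteq> q" "V \<le> 1"
  shows "0 < denom q h V"
proof -
  have "0 < (q - h)^2" using assms(2) by simp
  moreover have "0 \<le> (1 - h^2) * (1 - V)" using abs_less_1_sq[OF assms(1)] assms(3) by simp
  ultimately show ?thesis unfolding denom_def by (rule add_pos_nonneg)
qed

lemma freq_sq: 
  assumes "\<bar>h\<bar> < 1"
  shows "(freq q h)^2 = 1 + q^2 - 2 * q * h" "0 < freq q h"
proof -
  have "1 + q^2 - 2 * q * h = (q - h)^2 + (1 - h^2)" by (simp add: power2_eq_square algebra_simps)
  also have "\<dots> > 0" using abs_less_1_sq[OF assms] by (intro add_nonneg_pos) auto
  finally have "0 < 1 + q^2 - 2 * q * h" .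
  then show "(freq q h)^2 = 1 + q^2 - 2 * q * h" "0 < freq q h" by (simp_all add: freq_def)
qed

lemma denom_eq:
  assumes "\<bar>h\<bar> < 1"
  shows "denom q h V = (freq q h)^2 - (1 - h^2) * V"
  unfolding denom_def freq_sq(1)[OF assms] by (simp add: power2_eq_square algebra_simps)

lemma angle_factor_pos:
  assumes q: "0 < q" "q \<le> 1" and hq: "h < (q::real)" and V: "0 < V" "V \<le> 1"
  shows "0 < q - h * V"
proof (cases "h \<le> 0")
  case True then have "h * V \<le> 0" using V by (simp add: mult_nonpos_nonneg) then show ?thesis using q by simp
next
  case False
  then have "h * V \<le> h * 1" using V by (intro mult_left_mono) auto
  then show ?thesis using hq by simp
qed

context
  fixes q h :: real
  assumes q: "0 < q" "q \<le> 1" and h: "\<bar>h\<bar> < 1" and hq: "h \<noteq> q"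
begin

lemma ang_density_continuous: "continuous_on A (\<lambda>u. ang_density q h (delta2 q u) / sqrt (delta2 q u))"
  unfolding ang_density_def
proof (intro continuous_intros ballI)
  show "denom q h (delta2 q x) \<noteq> 0" for x using denom_pos[OF h hq delta2_bounds(2)[OF q], of x] by simp
  show "continuous_on A (\<lambda>x. denom q h (delta2 q x))" unfolding denom_def by (intro continuous_intros)
  show "sqrt (delta2 q x) \<noteq> 0" for x using delta2_bounds(3)[OF q, of x] by simp
qed

lemma Psi_deriv: "(Psi q h has_real_derivative ang_density q h (delta2 q u) / sqrt (delta2 q u)) (at u)"
  unfolding Psi_def[abs_def] by (rule primitive_continuous[OF ang_density_continuous])

lemma Psi_0: "Psi q h 0 = 0" by (simp add: Psi_def zero_ereal_def[symmetric])

lemma Psi_odd: "Psi q h (- u) = - Psi q h u"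
  by (rule odd_primitive[OF Psi_deriv Psi_0]) (simp add: delta2_sym)

lemma Psi_pi: "Psi q h (u + pi) = Psi q h u + 2 * half_turn q h"
  unfolding half_turn_def
  by (rule quasiperiodic_primitive[OF Psi_deriv Psi_0]) (simp_all add: delta2_sym)

lemma angle_deriv: "(angle q h has_real_derivative ang_density q h ((dn q y)^2)) (at y)"
proof -
  have "((\<lambda>y. Psi q h (am q y)) has_real_derivative
      ang_density q h (delta2 q (am q y)) / sqrt (delta2 q (am q y)) * sqrt (delta2 q (am q y))) (at y)"
    by (rule DERIV_chain2[OF Psi_deriv am_deriv[OF q]])
  then show ?thesis unfolding angle_def[abs_def] dn_sq[OF q]
    using delta2_bounds(3)[OF q, of "am q y"] by simp
qed

lemma angle_0: "angle q h 0 = 0" by (simp add: angle_def am_0[OF q] Psi_0)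
lemma angle_odd: "angle q h (- y) = - angle q h y" by (simp add: angle_def am_odd[OF q] Psi_odd)
lemma angle_K: "angle q h (Kc q) = half_turn q h" by (simp add: angle_def am_K[OF q] half_turn_def)
lemma angle_period: "angle q h (y + of_int n * (2 * Kc q)) = angle q h y + of_int n * (2 * half_turn q h)"
  by (rule quasiperiodic_int) (simp add: angle_def am_period[OF q] Psi_pi)

lemma angle_continuous: "isCont (angle q h) y"
  using angle_deriv DERIV_isCont by blast

lemma half_turn_eq_integral:
  "half_turn q h = integral {0..pi/2} (\<lambda>u. ang_density q h (delta2 q u) / sqrt (delta2 q u))"
  unfolding half_turn_def Psi_def by (rule primitive_eq_integral[OF ang_density_continuous]) simp

lemma ang_density_pos: "h < q \<Longrightarrow> 0 < V \<Longrightarrow> V \<le> 1 \<Longrightarrow> 0 < ang_density q h V"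
  unfolding ang_density_def using angle_factor_pos[OF q] freq_sq(2)[OF h] abs_less_1_sq[OF h] denom_pos[OF h hq]
  by simp

lemma angle_strict_mono: "h < q \<Longrightarrow> x < y \<Longrightarrow> angle q h x < angle q h y"
  by (rule DERIV_pos_imp_increasing)
     (use angle_deriv ang_density_pos dn_sq[OF q] delta2_bounds[OF q] in \<open>metis+\<close>)

end

lemma half_turn_pos: "0 < q \<Longrightarrow> q \<le> 1 \<Longrightarrow> \<bar>h\<bar> < 1 \<Longrightarrow> h < q \<Longrightarrow> 0 < half_turn q h"
  using angle_strict_mono[of q h 0 "Kc q"] Kc_pos[of q] by (simp add: angle_0 angle_K)

lemma half_turn_1:
  assumes "\<bar>h\<bar> < 1"
  shows "half_turn 1 h = pi * sqrt ((1 + h) / 2)"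
proof -
  have h: "-1 < h" "h < 1" using assms by auto
  have "denom 1 h 1 = (1 - h)^2" by (simp add: denom_def)
  moreover have "freq 1 h = sqrt (2 * (1 - h))" by (simp add: freq_def)
  moreover have "1 - h^2 = (1 - h) * (1 + h)" by algebra
  ultimately have "ang_density 1 h 1 = sqrt (2 * (1 - h)) * sqrt ((1 - h) * (1 + h)) / (1 - h)"
    using h unfolding ang_density_def by (simp add: power2_eq_square)
  also have "\<dots> = sqrt 2 * sqrt (1 + h) * (sqrt (1 - h) * sqrt (1 - h)) / (1 - h)"
    unfolding real_sqrt_mult by (simp only: mult_ac)
  also have "\<dots> = 2 * sqrt ((1 + h) / 2)"
    using h by (simp add: real_sqrt_divide field_simps)
  finally show ?thesis
    using h by (simp add: half_turn_eq_integral delta2_def)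
qed

text \<open>A parameter integral over a fixed interval. The domain stops at \<open>h < q\<close>,
  because for \<open>h = q\<close> the denominator vanishes at u = 0.\<close>

lemma half_turn_continuous:
  "continuous_on {(q, h). 0 < q \<and> q \<le> 1 \<and> \<bar>h\<bar> < 1 \<and> h < q} (\<lambda>(q, h). half_turn q h)"
proof -
  let ?U = "{(q::real, h::real). 0 < q \<and> q \<le> 1 \<and> \<bar>h\<bar> < 1 \<and> h < q}"
  let ?g = "\<lambda>(p, u). ang_density (fst p) (snd p) (delta2 (fst p) u) / sqrt (delta2 (fst p) u)"
  have "continuous_on (?U \<times> cbox 0 (pi/2)) ?g"
    unfolding case_prod_unfold ang_density_def
  proof (intro continuous_intros ballI)
    show "continuous_on ({p. 0 < fst p \<and> fst p \<le> 1 \<and> \<bar>snd p\<bar> < 1 \<and> snd p < fst p} \<times> cbox 0 (pi / 2))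
        (\<lambda>x. freq (fst (fst x)) (snd (fst x)))"
      unfolding freq_def by (intro continuous_intros)
    show "continuous_on ({p. 0 < fst p \<and> fst p \<le> 1 \<and> \<bar>snd p\<bar> < 1 \<and> snd p < fst p} \<times> cbox 0 (pi / 2))
        (\<lambda>x. delta2 (fst (fst x)) (snd x))"
      unfolding delta2_def by (intro continuous_intros)
    then show "continuous_on ({p. 0 < fst p \<and> fst p \<le> 1 \<and> \<bar>snd p\<bar> < 1 \<and> snd p < fst p} \<times> cbox 0 (pi / 2))
        (\<lambda>x. delta2 (fst (fst x)) (snd x))" .
    show "continuous_on ({p. 0 < fst p \<and> fst p \<le> 1 \<and> \<bar>snd p\<bar> < 1 \<and> snd p < fst p} \<times> cbox 0 (pi / 2))
        (\<lambda>x. denom (fst (fst x)) (snd (fst x)) (delta2 (fst (fst x)) (snd x)))"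
      unfolding denom_def delta2_def by (intro continuous_intros)
  next
    fix x :: "(real \<times> real) \<times> real"
    assume x: "x \<in> {p. 0 < fst p \<and> fst p \<le> 1 \<and> \<bar>snd p\<bar> < 1 \<and> snd p < fst p} \<times> cbox 0 (pi / 2)"
    then have b: "0 < fst (fst x)" "fst (fst x) \<le> 1" "\<bar>snd (fst x)\<bar> < 1" "snd (fst x) < fst (fst x)" by auto
    show "denom (fst (fst x)) (snd (fst x)) (delta2 (fst (fst x)) (snd x)) \<noteq> 0"
      using denom_pos[OF b(3) _ delta2_bounds(2)[OF b(1,2)]] b(4) by (metis less_irrefl)
    show "sqrt (delta2 (fst (fst x)) (snd x)) \<noteq> 0"
      using delta2_bounds(3)[OF b(1,2), of "snd x"] by simp
  qed
  from integral_continuous_on_param[OF this]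
  have "continuous_on ?U (\<lambda>p. integral {0..pi/2} (\<lambda>u. ang_density (fst p) (snd p) (delta2 (fst p) u) / sqrt (delta2 (fst p) u)))"
    by simp
  then show ?thesis
    by (rule continuous_on_eq) (auto simp: half_turn_eq_integral)
qed

text \<open>The primitive \<open>arctan (\<alpha> tan u)\<close> of \<open>\<alpha> / (cos\<^sup>2 u + \<alpha>\<^sup>2 sin\<^sup>2 u)\<close>, written so that it is smooth
  at \<open>u = \<pi>/2\<close>.\<close>

lemma integral_cos_sin_squares:
  assumes \<alpha>: "0 < \<alpha>"
  shows "((\<lambda>u. \<alpha> / ((cos u)^2 + \<alpha>^2 * (sin u)^2)) has_integral pi / 2) {0..pi/2}"
proof -
  \<comment> \<open>By the addition theorem the tangent of arctan(\<alpha> tan u) - u is (\<alpha> -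
    1) tan u / (1 + \<alpha> tan^2 u); multiplication by cos^2 u gives n / d, whose denominator has
    no zero.\<close>
  define n where "n u = (\<alpha> - 1) * sin u * cos u" for u
  define d where "d u = (cos u)^2 + \<alpha> * (sin u)^2" for u
  have d: "0 < d u" for u
  proof (cases "sin u = 0")
    case True then show ?thesis using sin_cos_squared_add[of u] by (simp add: d_def)
  next
    case False then show ?thesis using \<alpha> by (simp add: d_def add_nonneg_pos)
  qed
  have D: "0 < (cos u)^2 + \<alpha>^2 * (sin u)^2" for u
  proof (cases "sin u = 0")
    case True then show ?thesis using sin_cos_squared_add[of u] by simp
  next
    case False then show ?thesis using \<alpha> by (simp add: add_nonneg_pos)
  qed
  let ?G = "\<lambda>u. u + arctan (n u / d u)"
  have G: "(?G has_real_derivative \<alpha> / ((cos u)^2 + \<alpha>^2 * (sin u)^2)) (at u)" for u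
  proof -
    have dn: "(n has_real_derivative (\<alpha> - 1) * ((cos u)^2 - (sin u)^2)) (at u)"
      unfolding n_def[abs_def] by (auto intro!: derivative_eq_intros simp: power2_eq_square algebra_simps)
    have dd: "(d has_real_derivative 2 * n u) (at u)"
      unfolding d_def[abs_def] n_def by (auto intro!: derivative_eq_intros simp: power2_eq_square algebra_simps)
    have "((\<lambda>u. n u / d u) has_real_derivative
        ((\<alpha> - 1) * ((cos u)^2 - (sin u)^2) * d u - n u * (2 * n u)) / (d u * d u)) (at u)"
      using DERIV_divide[OF dn dd] d[of u] by simp
    from DERIV_add[OF DERIV_ident DERIV_chain2[OF DERIV_arctan this]]
    have "(?G has_real_derivative 1 + inverse (1 + (n u / d u)^2) *
        (((\<alpha> - 1) * ((cos u)^2 - (sin u)^2) * d u - n u * (2 * n u)) / (d u * d u))) (at u)" .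
    moreover have "1 + inverse (1 + (n u / d u)^2) *
        (((\<alpha> - 1) * ((cos u)^2 - (sin u)^2) * d u - n u * (2 * n u)) / (d u * d u))
        = \<alpha> / ((cos u)^2 + \<alpha>^2 * (sin u)^2)"
    proof -
      have cs: "(cos u)^2 = 1 - (sin u)^2" by (simp add: cos_squared_eq)
      have e1: "(d u)^2 + (n u)^2 = (cos u)^2 + \<alpha>^2 * (sin u)^2"
        unfolding d_def n_def power_mult_distrib cs by algebra
      have e2: "(\<alpha> - 1) * ((cos u)^2 - (sin u)^2) * d u - n u * (2 * n u) = \<alpha> - ((d u)^2 + (n u)^2)"
        unfolding d_def n_def power_mult_distrib power2_eq_square[of "_ * _"] using cs by algebra
      have "inverse (1 + (n u / d u)^2) = (d u)^2 / ((d u)^2 + (n u)^2)"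
        using d[of u] by (simp add: field_simps)
      then have "1 + inverse (1 + (n u / d u)^2) * ((\<alpha> - ((d u)^2 + (n u)^2)) / (d u * d u))
          = 1 + (\<alpha> - ((d u)^2 + (n u)^2)) / ((d u)^2 + (n u)^2)"
        using d[of u] by (simp add: power2_eq_square)
      also have "\<dots> = \<alpha> / ((d u)^2 + (n u)^2)"
      proof -
        have "1 + (\<alpha> - T) / T = \<alpha> / T" if "0 < T" for T :: real using that by (simp add: field_simps)
        then show ?thesis using D[of u] unfolding e1[symmetric] .
      qed
      finally show ?thesis unfolding e2 e1 .
    qed
    ultimately show ?thesis by simp
  qed
  have "((\<lambda>u. \<alpha> / ((cos u)^2 + \<alpha>^2 * (sin u)^2)) has_integral ?G (pi/2) - ?G 0) {0..pi/2}"
  proof (rule fundamental_theorem_of_calculus)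
    show "(?G has_vector_derivative \<alpha> / ((cos u)^2 + \<alpha>^2 * (sin u)^2)) (at u within {0..pi/2})" for u
      using G[of u] by (simp only: has_real_derivative_iff_has_vector_derivative has_vector_derivative_at_within)
  qed simp
  then show ?thesis by (simp add: n_def)
qed

text \<open>Replace q - h V by \<open>D = q - h\<close> and drop 1 / sqrt V. The denominator is D^2
  cos^2 u + R^2 sin^2 u, with D^2 and R^2 its values at u = 0 and u = pi/2, so the minorant is c s /
  R times the elementary integrand with \<open>\<alpha> = R / D\<close>. It integrates to (c s / R)
  (pi / 2), and R < c s because s^2 c^2 - R^2 factors as (q - h) (q + h - 2 q h^2).\<close>

lemma half_turn_lower_bound:
  assumes q: "0 < q" "q \<le> 1" and h: "0 \<le> h" "h < q"
  shows "pi / 2 < half_turn q h"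
proof -
  have h1: "\<bar>h\<bar> < 1" using q h by auto
  have hq: "h \<noteq> q" using h by simp
  define c where "c = freq q h"
  define s where "s = sqrt (1 - h^2)"
  define D where "D = q - h"
  define m where "m = 1 - q^2"
  have s: "0 < s" "s^2 = 1 - h^2" and D: "0 < D"
    using abs_less_1_sq[OF h1] h by (simp_all add: s_def D_def)
  have m: "0 \<le> m" using q by (simp add: m_def power_le_one)
  have c: "0 < c" "c^2 = D^2 + s^2"
    using freq_sq[OF h1, of q] unfolding c_def[symmetric] s(2) D_def by (simp, algebra)
  define R where "R = sqrt (D^2 + s^2 * m)"
  have R: "0 < R" "R^2 = D^2 + s^2 * m" using D m by (simp_all add: R_def add_pos_nonneg)
  have "q + h - 2 * q * h^2 > 0"
  proof -
    have "q * h^2 \<le> 1 * (h * 1)" unfolding power2_eq_square using q h h1 by (intro mult_mono) auto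
    then have "2 * q * h^2 \<le> 2 * h" by simp
    then show ?thesis using h by simp
  qed
  then have "0 < (q - h) * (q + h - 2 * q * h^2)" using h by simp
  also have "\<dots> = s^2 * c^2 - R^2"
    unfolding R(2) c(2) s(2) D_def m_def by algebra
  finally have "R^2 < (s * c)^2" by (simp add: power_mult_distrib)
  then have Rsc: "R < s * c" using s c by (intro power2_less_imp_less[of R "s * c"]) auto
  define \<alpha> where "\<alpha> = R / D"
  have \<alpha>: "0 < \<alpha>" using R D by (simp add: \<alpha>_def)
  have bound: "c * s / R * (\<alpha> / ((cos u)^2 + \<alpha>^2 * (sin u)^2)) \<le> ang_density q h (delta2 q u) / sqrt (delta2 q u)" for u
  proof -
    define V where "V = delta2 q u"
    have V: "0 < V" "V \<le> 1" using delta2_bounds[OF q] by (simp_all add: V_def)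
    have den: "denom q h V = D^2 + s^2 * m * (sin u)^2"
      unfolding denom_def V_def delta2_def s(2) D_def m_def by (simp add: algebra_simps)
    have dpos: "0 < denom q h V" by (rule denom_pos[OF h1 hq V(2)])
    have "(cos u)^2 + \<alpha>^2 * (sin u)^2 = denom q h V / D^2"
    proof -
      have "D^2 * ((cos u)^2 + \<alpha>^2 * (sin u)^2) = D^2 * (1 - (sin u)^2) + R^2 * (sin u)^2"
        unfolding cos_squared_eq using D by (simp add: \<alpha>_def power_divide algebra_simps)
      also have "\<dots> = denom q h V" unfolding den R(2) by (simp add: algebra_simps)
      finally show ?thesis using D by (simp add: field_simps)
    qed
    then have "c * s / R * (\<alpha> / ((cos u)^2 + \<alpha>^2 * (sin u)^2)) = c * s * D / denom q h V"
      using D R dpos by (simp add: \<alpha>_def power2_eq_square)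
    also have "\<dots> \<le> c * s * (q - h * V) / denom q h V"
    proof -
      have "h * V \<le> h * 1" using V h by (intro mult_left_mono) auto
      then show ?thesis using c s dpos by (intro divide_right_mono mult_left_mono) (auto simp: D_def)
    qed
    also have "\<dots> = ang_density q h V" by (simp add: ang_density_def c_def s_def)
    also have "\<dots> \<le> ang_density q h V / sqrt V"
    proof -
      have "0 < ang_density q h V" using ang_density_pos[OF q h1 hq h(2) V] .
      then show ?thesis using V by (simp add: le_divide_eq mult_left_le)
    qed
    finally show ?thesis by (simp add: V_def)
  qed
  have lower: "c * s / R * (pi / 2) \<le> half_turn q h"
    unfolding half_turn_eq_integral[OF q h1 hq]
  proof (rule has_integral_le)
    show "((\<lambda>u. c * s / R * (\<alpha> / ((cos u)^2 + \<alpha>^2 * (sin u)^2))) has_integral c * s / R * (pi / 2)) {0..pi/2}"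
      by (rule has_integral_mult_right[OF integral_cos_sin_squares[OF \<alpha>]])
    show "((\<lambda>u. ang_density q h (delta2 q u) / sqrt (delta2 q u)) has_integral
        integral {0..pi/2} (\<lambda>u. ang_density q h (delta2 q u) / sqrt (delta2 q u))) {0..pi/2}"
      using integrable_integral[OF integrable_continuous[OF ang_density_continuous[OF q h1 hq], of 0 "pi/2"]] by simp
  qed (rule bound)
  have "pi / 2 = 1 * (pi / 2)" by simp
  also have "\<dots> < c * s / R * (pi / 2)"
    using Rsc R(1) by (intro mult_strict_right_mono) (simp_all add: field_simps)
  also note lower
  finally show ?thesis .
qed

context revolution_surface
begin

lemma polar_representation:
  assumes hq: "h \<noteq> q"
  obtains a b e1 e2 where "orthonormal4 a b e1 e2"
    "\<And>z. f z = (radius q h (Im z) * cos (freq q h * Re z)) *\<^sub>R a + (radius q h (Im z) * sin (freq q h * Re z)) *\<^sub>R b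
       + (sqrt (1 - (radius q h (Im z))^2) * cos (angle q h (Im z))) *\<^sub>R e1
       + (sqrt (1 - (radius q h (Im z))^2) * sin (angle q h (Im z))) *\<^sub>R e2"
proof -
  obtain a b e1 e2 X Y X' Y' \<epsilon> where on: "orthonormal4 a b e1 e2" and \<epsilon>: "\<epsilon>^2 = (1::real)" and
    f: "\<And>z. f z = (radius q h (Im z) * cos (c * Re z)) *\<^sub>R a + (radius q h (Im z) * sin (c * Re z)) *\<^sub>R b
       + X (Im z) *\<^sub>R e1 + Y (Im z) *\<^sub>R e2" and
    X: "\<And>y. (X has_real_derivative X' y) (at y)" and Y: "\<And>y. (Y has_real_derivative Y' y) (at y)" and
    XY: "\<And>y. (X y)^2 + (Y y)^2 = 1 - (radius q h y)^2" and
    W: "\<And>y. X y * Y' y - Y y * X' y = \<epsilon> * (\<bar>s\<bar> / c * (q - h * (dn q y)^2))"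
    using representation by metis
  have XY': "(X y)^2 + (Y y)^2 = denom q h ((dn q y)^2) / c^2" for y
    unfolding XY radius_eq denom_eq[OF h_abs_less] power_divide power_mult_distrib power2_abs s(2)
    using c_pos by (simp add: field_simps)
  have dpos: "0 < denom q h ((dn q y)^2)" for y by (rule denom_pos[OF h_abs_less hq dn_bounds(2)[OF q]])
  have \<psi>: "((\<lambda>y. \<epsilon> * angle q h y) has_real_derivative \<epsilon> * ang_density q h ((dn q y)^2)) (at y)" for y
    by (rule DERIV_cmult[OF angle_deriv[OF q h_abs_less hq]])
  have pos: "0 < (X y)^2 + (Y y)^2" for y unfolding XY' using dpos[of y] c_pos by simp
  have W': "X y * Y' y - Y y * X' y = ((X y)^2 + (Y y)^2) * (\<epsilon> * ang_density q h ((dn q y)^2))" for y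
    unfolding W XY' ang_density_def abs_s using dpos[of y] c_pos by (simp add: power2_eq_square)
  obtain \<alpha> where \<alpha>: "\<And>y. X y = sqrt ((X y)^2 + (Y y)^2) * cos (\<epsilon> * angle q h y + \<alpha>)"
    "\<And>y. Y y = sqrt ((X y)^2 + (Y y)^2) * sin (\<epsilon> * angle q h y + \<alpha>)"
    using polar_form[OF X Y \<psi> pos W'] by blast
  \<comment> \<open>A rotation by \<alpha>, followed by a reflection if \<epsilon> = -1, absorbs the
    phase and the orientation into the choice of the basis of the profile plane.\<close>
  define u1 where "u1 = cos \<alpha> *\<^sub>R e1 + sin \<alpha> *\<^sub>R e2"
  define u2 where "u2 = (\<epsilon> * - sin \<alpha>) *\<^sub>R e1 + (\<epsilon> * cos \<alpha>) *\<^sub>R e2"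
  have \<epsilon>': "\<epsilon> = 1 \<or> \<epsilon> = -1" using \<epsilon> by (simp add: power2_eq_1_iff)
  have "orthonormal4 a b u1 u2"
    using on orthonormal4_sym[OF on] \<epsilon>' sin_cos_squared_add3[of \<alpha>] unfolding orthonormal4_def u1_def u2_def
    by (auto simp: inner_add_left inner_add_right algebra_simps)
  moreover have "f z = (radius q h (Im z) * cos (freq q h * Re z)) *\<^sub>R a + (radius q h (Im z) * sin (freq q h * Re z)) *\<^sub>R b
       + (sqrt (1 - (radius q h (Im z))^2) * cos (angle q h (Im z))) *\<^sub>R u1
       + (sqrt (1 - (radius q h (Im z))^2) * sin (angle q h (Im z))) *\<^sub>R u2" for z
  proof -
    define t where "t = angle q h (Im z)"
    define \<rho> where "\<rho> = sqrt (1 - (radius q h (Im z))^2)"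
    have "cos (\<epsilon> * t) = cos t" "sin (\<epsilon> * t) = \<epsilon> * sin t" using \<epsilon>' by auto
    then have XY_eq: "X (Im z) = \<rho> * (cos t * cos \<alpha> - \<epsilon> * sin t * sin \<alpha>)"
      "Y (Im z) = \<rho> * (\<epsilon> * sin t * cos \<alpha> + cos t * sin \<alpha>)"
      using \<alpha>[of "Im z"] unfolding XY cos_add sin_add t_def[symmetric] \<rho>_def[symmetric] by simp_all
    have "X (Im z) *\<^sub>R e1 + Y (Im z) *\<^sub>R e2 = (\<rho> * cos t) *\<^sub>R u1 + (\<rho> * sin t) *\<^sub>R u2"
      unfolding XY_eq u1_def u2_def by (simp add: algebra_simps)
    then show ?thesis unfolding f[of z] t_def \<rho>_def by (simp add: add.assoc)
  qed
  ultimately show ?thesis using that by blast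
qed

end

section \<open>Embedded tori\<close>

definition coset_rel :: "complex set \<Rightarrow> (complex \<times> complex) set" where
  "coset_rel \<Gamma> = {(z, w). w - z \<in> \<Gamma>}"

lemma zero_in_lattice: "0 \<in> lattice w1 w2"
  unfolding lattice_def by (rule CollectI, rule exI[of _ 0], rule exI[of _ 0]) simp

lemma lattice_diff: "a \<in> lattice w1 w2 \<Longrightarrow> b \<in> lattice w1 w2 \<Longrightarrow> a - b \<in> lattice w1 w2"
proof -
  assume "a \<in> lattice w1 w2" "b \<in> lattice w1 w2"
  then obtain i j k l where "a = of_int i * w1 + of_int j * w2" "b = of_int k * w1 + of_int l * w2"
    unfolding lattice_def by blast
  then have "a - b = of_int (i - k) * w1 + of_int (j - l) * w2" by (simp add: algebra_simps)
  then show ?thesis unfolding lattice_def by blast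
qed

lemma coset_rel_image: "coset_rel \<Gamma> `` {z} = {w. w - z \<in> \<Gamma>}"
  by (auto simp: coset_rel_def)

lemma equiv_coset_rel: "equiv UNIV (coset_rel (lattice w1 w2))"
proof (rule equivI)
  show "refl (coset_rel (lattice w1 w2))"
    by (simp add: refl_on_def coset_rel_def zero_in_lattice)
  show "sym (coset_rel (lattice w1 w2))"
  proof (rule symI)
    fix x y assume "(x, y) \<in> coset_rel (lattice w1 w2)"
    then show "(y, x) \<in> coset_rel (lattice w1 w2)"
      using lattice_diff[OF zero_in_lattice, of "y - x" w1 w2] by (simp add: coset_rel_def)
  qed
  show "trans (coset_rel (lattice w1 w2))"
  proof (rule transI)
    fix x y z
    assume "(x, y) \<in> coset_rel (lattice w1 w2)" "(y, z) \<in> coset_rel (lattice w1 w2)"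
    then have "y - x \<in> lattice w1 w2" "z - y \<in> lattice w1 w2" by (auto simp: coset_rel_def)
    then have "(z - y) - (0 - (y - x)) \<in> lattice w1 w2"
      using lattice_diff[of "z - y" w1 w2 "0 - (y - x)"] lattice_diff[OF zero_in_lattice, of "y - x" w1 w2]
      by simp
    then show "(x, z) \<in> coset_rel (lattice w1 w2)" by (simp add: coset_rel_def)
  qed
qed auto

lemma openin_torus:
  "openin (torus_topology (lattice w1 w2)) U \<longleftrightarrow>
     U \<subseteq> UNIV // coset_rel (lattice w1 w2) \<and> open (\<Union>U)"
  unfolding coset_rel_def
  by (rule openin_torus_topology) (auto intro: zero_in_lattice lattice_diff)

lemma topspace_torus:
  "topspace (torus_topology (lattice w1 w2)) = UNIV // coset_rel (lattice w1 w2)"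
proof -
  have "openin (torus_topology (lattice w1 w2)) (UNIV // coset_rel (lattice w1 w2))"
    unfolding openin_torus using Union_quotient[OF equiv_coset_rel[of w1 w2]] by simp
  from openin_subset[OF this] show ?thesis
    using openin_topspace[of "torus_topology (lattice w1 w2)"] unfolding openin_torus by blast
qed

lemma the_elem_image_coset:
  assumes "lattice w1 w2 \<subseteq> periods f"
  shows "the_elem (f ` (coset_rel (lattice w1 w2) `` {z})) = f z"
proof -
  have "f ` (coset_rel (lattice w1 w2) `` {z}) = {f z}"
  proof
    show "f ` (coset_rel (lattice w1 w2) `` {z}) \<subseteq> {f z}"
    proof
      fix y assume "y \<in> f ` (coset_rel (lattice w1 w2) `` {z})"
      then obtain w where w: "w - z \<in> lattice w1 w2" "y = f w" by (auto simp: coset_rel_image)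
      then have "f (z + (w - z)) = f z" using assms unfolding periods_def by blast
      then show "y \<in> {f z}" using w by simp
    qed
    show "{f z} \<subseteq> f ` (coset_rel (lattice w1 w2) `` {z})"
      by (auto simp: coset_rel_image zero_in_lattice intro!: imageI)
  qed
  then show ?thesis by simp
qed

lemma lattice_cell:
  assumes "lattice_basis w1 w2"
  obtains a b where "a \<in> {0..1}" "b \<in> {0..1}" "z - (of_real a * w1 + of_real b * w2) \<in> lattice w1 w2"
proof -
  have ind: "independent {w1, w2}" and ne: "w1 \<noteq> w2" using assms unfolding lattice_basis_def by auto
  then have "card {w1, w2} = DIM(complex)" by simp
  then have "span {w1, w2} = (UNIV :: complex set)"
    using ind by (metis dim_eq_full indep_card_eq_dim_span dim_span)
  then have "z \<in> span (insert w1 {w2})" by simp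
  then obtain u where "z - u *\<^sub>R w1 \<in> span {w2}" by (auto simp: span_insert)
  then obtain v where "z - u *\<^sub>R w1 = v *\<^sub>R w2" by (auto simp: span_singleton)
  then have z: "z = u *\<^sub>R w1 + v *\<^sub>R w2" by (simp add: algebra_simps)
  let ?a = "frac u" and ?b = "frac v"
  have "z - (of_real ?a * w1 + of_real ?b * w2) = of_int \<lfloor>u\<rfloor> * w1 + of_int \<lfloor>v\<rfloor> * w2"
    unfolding z frac_def by (simp add: scaleR_conv_of_real algebra_simps)
  then have "z - (of_real ?a * w1 + of_real ?b * w2) \<in> lattice w1 w2"
    unfolding lattice_def by blast
  moreover have "?a \<in> {0..1}" "?b \<in> {0..1}"
    by (simp_all add: frac_lt_1 less_imp_le)
  ultimately show ?thesis using that by blast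
qed

text \<open>The quotient map is continuous and already maps the closed fundamental parallelogram
  onto all cosets.\<close>

lemma compact_torus:
  assumes "lattice_basis w1 w2"
  shows "compact_space (torus_topology (lattice w1 w2))"
proof -
  let ?R = "coset_rel (lattice w1 w2)"
  let ?\<pi> = "\<lambda>z. ?R `` {z}"
  have cont: "continuous_map euclidean (torus_topology (lattice w1 w2)) ?\<pi>"
    unfolding continuous_map
  proof (intro conjI allI impI)
    show "?\<pi> ` topspace euclidean \<subseteq> topspace (torus_topology (lattice w1 w2))"
      unfolding topspace_torus by (auto intro: quotientI)
    fix U assume "openin (torus_topology (lattice w1 w2)) U"
    then have U: "U \<subseteq> UNIV // ?R" "open (\<Union>U)" unfolding openin_torus by auto
    have "{x \<in> topspace euclidean. ?\<pi> x \<in> U} = \<Union>U"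
    proof (intro equalityI subsetI)
      fix x assume "x \<in> {x \<in> topspace euclidean. ?\<pi> x \<in> U}"
      then show "x \<in> \<Union>U" using equiv_class_self[OF equiv_coset_rel[of w1 w2], of x] by blast
    next
      fix x assume "x \<in> \<Union>U"
      then obtain C where C: "C \<in> U" "x \<in> C" by blast
      then have "C = ?\<pi> x"
        using U(1) equiv_class_self[OF equiv_coset_rel[of w1 w2], of x]
          quotient_disj[OF equiv_coset_rel[of w1 w2], of C "?\<pi> x"] quotientI[of x UNIV ?R] by blast
      then show "x \<in> {x \<in> topspace euclidean. ?\<pi> x \<in> U}" using C by simp
    qed
    then show "openin euclidean {x \<in> topspace euclidean. ?\<pi> x \<in> U}" using U by simp
  qed
  define cell where "cell = (\<lambda>(a, b). of_real a * w1 + of_real b * w2) ` ({0..1::real} \<times> {0..1::real})"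
  have "compact cell" unfolding cell_def case_prod_unfold
    by (intro compact_continuous_image continuous_intros compact_Times) auto
  then have "compactin (torus_topology (lattice w1 w2)) (?\<pi> ` cell)"
    using image_compactin[OF _ cont, of cell] by simp
  moreover have "?\<pi> ` cell = UNIV // ?R"
  proof
    show "?\<pi> ` cell \<subseteq> UNIV // ?R" by (auto intro: quotientI)
    show "UNIV // ?R \<subseteq> ?\<pi> ` cell"
    proof
      fix C assume "C \<in> UNIV // ?R"
      then obtain z where z: "C = ?\<pi> z" by (blast elim: quotientE)
      obtain a b where ab: "a \<in> {0..1}" "b \<in> {0..1}"
        "z - (of_real a * w1 + of_real b * w2) \<in> lattice w1 w2" using lattice_cell[OF assms] .
      then have "(of_real a * w1 + of_real b * w2, z) \<in> ?R" by (simp add: coset_rel_def)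
      then have "?\<pi> (of_real a * w1 + of_real b * w2) = C"
        using equiv_class_eq[OF equiv_coset_rel] z by blast
      then show "C \<in> ?\<pi> ` cell" unfolding cell_def using ab by force
    qed
  qed
  ultimately show ?thesis unfolding compact_space_def topspace_torus by simp
qed

text \<open>A continuous injection of a compact space into a Hausdorff space is an embedding, so
  injectivity modulo the lattice is the one condition to be checked for a given surface.\<close>

lemma embedded_torusI:
  assumes basis: "lattice_basis w1 w2" and per: "lattice w1 w2 \<subseteq> periods f"
    and sph: "range f \<subseteq> sphere 0 1" and cont: "continuous_on UNIV f"
    and inj: "\<And>z w. f z = f w \<Longrightarrow> w - z \<in> lattice w1 w2"
  shows "embedded_torus f (lattice w1 w2)"
  unfolding embedded_torus_def
proof (intro conjI continuous_imp_embedding_map)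
  let ?R = "coset_rel (lattice w1 w2)"
  let ?g = "\<lambda>C. the_elem (f ` C)"
  have g: "?g (?R `` {z}) = f z" for z by (rule the_elem_image_coset[OF per])
  have fs: "f z \<in> sphere 0 1" for z using sph by blast
  show "lattice w1 w2 \<subseteq> periods f" by (rule per)
  show "compact_space (torus_topology (lattice w1 w2))" by (rule compact_torus[OF basis])
  show "Hausdorff_space (top_of_set (sphere (0 :: real^4) 1))"
    by (simp add: Hausdorff_space_subtopology)
  show "inj_on ?g (topspace (torus_topology (lattice w1 w2)))"
    unfolding topspace_torus
  proof (rule inj_onI)
    fix C D assume "C \<in> UNIV // ?R" "D \<in> UNIV // ?R" and eq: "?g C = ?g D"
    then obtain z w where zw: "C = ?R `` {z}" "D = ?R `` {w}" by (blast elim: quotientE)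
    then have "w - z \<in> lattice w1 w2" using eq g inj by simp
    then have "(z, w) \<in> ?R" by (simp add: coset_rel_def)
    then show "C = D" using equiv_class_eq[OF equiv_coset_rel] zw by blast
  qed
  show "continuous_map (torus_topology (lattice w1 w2)) (top_of_set (sphere 0 1)) ?g"
    unfolding continuous_map
  proof (intro conjI allI impI)
    show "?g ` topspace (torus_topology (lattice w1 w2)) \<subseteq> topspace (top_of_set (sphere 0 1))"
    proof
      fix y assume "y \<in> ?g ` topspace (torus_topology (lattice w1 w2))"
      then obtain C where C: "C \<in> UNIV // ?R" "y = ?g C" unfolding topspace_torus by blast
      then obtain z where "C = ?R `` {z}" by (blast elim: quotientE)
      then have "y = f z" using C g by simp
      then show "y \<in> topspace (top_of_set (sphere 0 1))" using fs[of z] by simp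
    qed
    fix U assume "openin (top_of_set (sphere (0 :: real^4) 1)) U"
    then obtain V where V: "open V" "U = sphere 0 1 \<inter> V" unfolding openin_open by auto
    let ?W = "{C \<in> topspace (torus_topology (lattice w1 w2)). ?g C \<in> U}"
    have "\<Union>?W = f -` V"
    proof (intro equalityI subsetI)
      fix x assume "x \<in> \<Union>?W"
      then obtain C where C: "C \<in> UNIV // ?R" "x \<in> C" "?g C \<in> U"
        unfolding topspace_torus by blast
      then obtain z where z: "x \<in> ?R `` {z}" "?g (?R `` {z}) \<in> U" by (blast elim: quotientE)
      then have "?R `` {z} = ?R `` {x}"
        using equiv_class_eq[OF equiv_coset_rel[of w1 w2], of z x] by blast
      then show "x \<in> f -` V" using z g V by simp
    next
      fix x assume "x \<in> f -` V"
      then have "?g (?R `` {x}) \<in> U" using g V(2) fs[of x] by simp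
      then show "x \<in> \<Union>?W" unfolding topspace_torus
        using equiv_class_self[OF equiv_coset_rel[of w1 w2], of x] quotientI[of x UNIV ?R] by blast
    qed
    then have "open (\<Union>?W)" using open_vimage[OF V(1) cont] by simp
    moreover have "?W \<subseteq> UNIV // ?R" unfolding topspace_torus by blast
    ultimately show "openin (torus_topology (lattice w1 w2)) ?W"
      unfolding openin_torus by blast
  qed
qed

lemma embedded_torusD:
  assumes "embedded_torus f (lattice w1 w2)" "f z = f w"
  shows "w - z \<in> lattice w1 w2"
proof -
  let ?R = "coset_rel (lattice w1 w2)"
  have per: "lattice w1 w2 \<subseteq> periods f"
    and inj: "inj_on (\<lambda>C. the_elem (f ` C)) (UNIV // ?R)"
    using assms(1) homeomorphic_imp_injective_map
    unfolding embedded_torus_def embedding_map_def topspace_torus[symmetric] by blast+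
  have "?R `` {z} = ?R `` {w}"
    by (rule inj_onD[OF inj]) (simp_all add: the_elem_image_coset[OF per] assms(2) quotientI)
  then have "(z, w) \<in> ?R"
    using eq_equiv_class[OF _ equiv_coset_rel] by blast
  then show ?thesis by (simp add: coset_rel_def)
qed

section \<open>Embeddedness of a single surface\<close>

context revolution_surface
begin

lemma radius_pos: "0 < radius q h y"
  unfolding radius_eq using s(1) v_pos c_pos by simp

lemma radius_cong: "radius q h y = radius q h y' \<longleftrightarrow> dn q y = dn q y'"
  unfolding radius_eq using s(1) c_pos by simp

text \<open>The equality case of Cauchy-Schwarz. The adapted frames are only known to exist; scalar
  products of points do not depend on them, so coincidences of points can be read off without fixing
  a frame.\<close>

lemma unit_eq_iff: "f z = f w \<longleftrightarrow> inner (f z) (f w) = 1"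
proof -
  have "(norm (f z - f w))^2 = 2 - 2 * inner (f z) (f w)"
    unfolding power2_norm_eq_inner by (simp add: inner_diff_left inner_diff_right ff inner_commute)
  moreover have "f z = f w \<longleftrightarrow> (norm (f z - f w))^2 = 0" by simp
  ultimately show ?thesis by linarith
qed

text \<open>Only the components in the rotation plane are compared, which needs no polar form of the
  profile; the conclusion is thus available at \<open>h = q\<close> as well.\<close>

lemma same_point:
  assumes "f z = f w"
  shows "dn q (Im z) = dn q (Im w)" "cos (c * (Re z - Re w)) = 1"
proof -
  obtain a b e1 e2 X Y X' Y' \<epsilon> where on: "orthonormal4 a b e1 e2" and "\<epsilon>^2 = (1::real)" and
    f: "\<And>z. f z = (radius q h (Im z) * cos (c * Re z)) *\<^sub>R a + (radius q h (Im z) * sin (c * Re z)) *\<^sub>R b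
       + X (Im z) *\<^sub>R e1 + Y (Im z) *\<^sub>R e2" and
    "\<And>y. (X has_real_derivative X' y) (at y)" and "\<And>y. (Y has_real_derivative Y' y) (at y)" and
    "\<And>y. (X y)^2 + (Y y)^2 = 1 - (radius q h y)^2" and
    "\<And>y. X y * Y' y - Y y * X' y = \<epsilon> * (\<bar>s\<bar> / c * (q - h * (dn q y)^2))"
    using representation by metis
  let ?r = "radius q h (Im z)" and ?r' = "radius q h (Im w)"
  have ia: "inner (f z) a = radius q h (Im z) * cos (c * Re z)" "inner (f z) b = radius q h (Im z) * sin (c * Re z)" for z
    unfolding f using on orthonormal4_sym[OF on] by (simp_all add: inner_add_left orthonormal4_def)
  have e: "?r * cos (c * Re z) = ?r' * cos (c * Re w)" "?r * sin (c * Re z) = ?r' * sin (c * Re w)"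
    using assms ia[of z] ia[of w] by simp_all
  have sc: "(r * cos t)^2 + (r * sin t)^2 = r^2" for r t :: real
    unfolding power_mult_distrib distrib_left[symmetric] by simp
  have "?r^2 = ?r'^2" using e sc[of ?r "c * Re z"] sc[of ?r' "c * Re w"] by simp
  then have rr: "?r = ?r'" using radius_pos by (simp add: power2_eq_iff_nonneg less_imp_le)
  then show "dn q (Im z) = dn q (Im w)" unfolding radius_cong .
  have "cos (c * Re z) = cos (c * Re w)" "sin (c * Re z) = sin (c * Re w)"
    using e radius_pos[of "Im w"] unfolding rr by simp_all
  then show "cos (c * (Re z - Re w)) = 1"
    unfolding right_diff_distrib cos_diff by (simp add: sin_cos_squared_add3)
qed

lemma inner_f_f:
  assumes "h \<noteq> q"
  shows "inner (f z) (f w) = radius q h (Im z) * radius q h (Im w) * cos (c * (Re z - Re w))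
    + sqrt (1 - (radius q h (Im z))^2) * sqrt (1 - (radius q h (Im w))^2) * cos (angle q h (Im z) - angle q h (Im w))"
proof -
  obtain a b e1 e2 where on: "orthonormal4 a b e1 e2" and
    f: "\<And>z. f z = (radius q h (Im z) * cos (c * Re z)) *\<^sub>R a + (radius q h (Im z) * sin (c * Re z)) *\<^sub>R b
       + (sqrt (1 - (radius q h (Im z))^2) * cos (angle q h (Im z))) *\<^sub>R e1
       + (sqrt (1 - (radius q h (Im z))^2) * sin (angle q h (Im z))) *\<^sub>R e2"
    using polar_representation[OF assms] by metis
  have co: "inner (f z) a = radius q h (Im z) * cos (c * Re z)" "inner (f z) b = radius q h (Im z) * sin (c * Re z)"
    "inner (f z) e1 = sqrt (1 - (radius q h (Im z))^2) * cos (angle q h (Im z))"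
    "inner (f z) e2 = sqrt (1 - (radius q h (Im z))^2) * sin (angle q h (Im z))" for z
    unfolding f using on orthonormal4_sym[OF on] by (simp_all add: inner_add_left orthonormal4_def)
  show ?thesis
    unfolding orthonormal4_inner[OF on, of "f z" "f w"] co right_diff_distrib[of c] cos_diff by algebra
qed

lemma radius_less_1: "h \<noteq> q \<Longrightarrow> (radius q h y)^2 < 1"
proof -
  assume hq: "h \<noteq> q"
  have "0 < denom q h ((dn q y)^2)" by (rule denom_pos[OF h_abs_less hq dn_bounds(2)[OF q]])
  then show ?thesis
    unfolding radius_eq denom_eq[OF h_abs_less] power_divide power_mult_distrib power2_abs s(2)
    using c_pos by simp
qed

lemma f_eq_iff:
  assumes hq: "h \<noteq> q"
  shows "f z = f w \<longleftrightarrow> dn q (Im z) = dn q (Im w) \<and> cos (c * (Re z - Re w)) = 1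
     \<and> cos (angle q h (Im z) - angle q h (Im w)) = 1"
proof
  let ?r = "radius q h (Im z)"
  let ?\<rho> = "sqrt (1 - ?r^2)"
  have \<rho>: "0 < ?\<rho>" "?\<rho> * ?\<rho> = 1 - ?r^2" using radius_less_1[OF hq, of "Im z"] by simp_all
  { assume "f z = f w"
    note sp = same_point[OF this]
    have rr: "radius q h (Im w) = ?r" using sp(1) radius_cong by simp
    have "inner (f z) (f w) = 1" using \<open>f z = f w\<close> unit_eq_iff by blast
    then have "?r * ?r + (?\<rho> * ?\<rho>) * cos (angle q h (Im z) - angle q h (Im w)) = 1"
      unfolding inner_f_f[OF hq] sp(2) rr by simp
    moreover have "R * t = R * 1" if "r * r + R * t = 1" "R = 1 - r^2" for r R t :: real
      using that by algebra
    ultimately have "(?\<rho> * ?\<rho>) * cos (angle q h (Im z) - angle q h (Im w)) = (?\<rho> * ?\<rho>) * 1"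
      using \<rho>(2) by blast
    then have "cos (angle q h (Im z) - angle q h (Im w)) = 1"
      using \<rho>(1) by (metis mult_cancel_left mult_eq_0_iff less_irrefl)
    then show "dn q (Im z) = dn q (Im w) \<and> cos (c * (Re z - Re w)) = 1
     \<and> cos (angle q h (Im z) - angle q h (Im w)) = 1" using sp by simp }
  { assume a: "dn q (Im z) = dn q (Im w) \<and> cos (c * (Re z - Re w)) = 1
     \<and> cos (angle q h (Im z) - angle q h (Im w)) = 1"
    then have rr: "radius q h (Im w) = ?r" using radius_cong by simp
    have "inner (f z) (f w) = ?r * ?r + ?\<rho> * ?\<rho>" unfolding inner_f_f[OF hq] rr using a by simp
    then have "inner (f z) (f w) = 1" unfolding \<rho>(2) by (simp add: power2_eq_square)
    then show "f z = f w" using unit_eq_iff by blast }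
qed

text \<open>A period carries height 0, a maximum of dn, to another maximum. There is no condition on
  \<open>h\<close>: the lattice can be continued through \<open>h = q\<close>, where the angle
  cannot.\<close>

lemma periods_integral:
  assumes "\<gamma> \<in> periods f" "q < 1"
  shows "\<exists>a::int. c * Re \<gamma> = 2 * pi * of_int a" "\<exists>b::int. Im \<gamma> = 2 * Kc q * of_int b"
proof -
  have "f \<gamma> = f 0" using assms(1) unfolding periods_def by (metis (mono_tags) add_0 mem_Collect_eq)
  note sp = same_point[OF this]
  have "cos (c * Re \<gamma>) = 1" using sp(2) by simp
  then show "\<exists>a::int. c * Re \<gamma> = 2 * pi * of_int a" unfolding cos_one_2pi_int by (auto simp: mult_ac)
  have "dn q (Im \<gamma>) = 1" using sp(1) dn_0[OF q] by simp
  from dn_1_imp[OF q assms(2) this] show "\<exists>b::int. Im \<gamma> = 2 * Kc q * of_int b" by (auto simp: mult_ac)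
qed

lemma dn_period_int: "dn q (y + of_int n * (2 * Kc q)) = dn q y"
  using quasiperiodic_int[of "dn q" "2 * Kc q" 0 y n] dn_period[OF q] by simp

lemma half_turn_closing:
  assumes hq: "h \<noteq> q" and per: "Complex 0 (2 * Kc q * real l) \<in> periods f" and l: "0 < l"
  obtains n :: int where "half_turn q h = pi * of_int n / real l"
proof -
  have "f (Complex 0 (2 * Kc q * real l)) = f 0" using per unfolding periods_def by (metis (mono_tags) add_0 mem_Collect_eq)
  then have "cos (angle q h (2 * Kc q * real l) - angle q h 0) = 1" unfolding f_eq_iff[OF hq] by simp
  moreover have "angle q h (2 * Kc q * real l) = real l * (2 * half_turn q h)"
    using angle_period[OF q h_abs_less hq, of 0 "int l"] angle_0[OF q h_abs_less hq] by (simp add: mult_ac)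
  ultimately have "cos (real l * (2 * half_turn q h)) = 1" using angle_0[OF q h_abs_less hq] by simp
  then obtain n :: int where "real l * (2 * half_turn q h) = of_int n * 2 * pi" unfolding cos_one_2pi_int by blast
  then have "half_turn q h = pi * of_int n / real l" using l by (simp add: field_simps)
  then show ?thesis using that by blast
qed

section \<open>Double points of the profile modulo the period lattice\<close>

context
  fixes w1 w2 :: complex and l :: nat
  assumes l: "2 \<le> l"
    and \<Gamma>: "\<And>\<gamma>. \<gamma> \<in> lattice w1 w2 \<longleftrightarrow> (\<exists>a b::int. c * Re \<gamma> = 2 * pi * of_int a \<and> Im \<gamma> = 2 * Kc q * real l * of_int b)"
begin

text \<open>For \<open>h < q\<close> the angle is strictly increasing, and \<open>l\<close> lobes
  turn by exactly one full turn. Equal angles modulo 2 pi therefore belong to heights that differ by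
  a multiple of \<open>l\<close> lobes, and these are periods.\<close>

lemma embedded_of_half_turn:
  assumes basis: "lattice_basis w1 w2" and per: "lattice w1 w2 \<subseteq> periods f"
    and hq: "h < q" and ht: "half_turn q h = pi / real l"
  shows "embedded_torus f (lattice w1 w2)"
proof (rule embedded_torusI[OF basis per sphere smooth_map_continuous[OF smooth]])
  fix z w assume "f z = f w"
  then have a: "cos (c * (Re z - Re w)) = 1" "cos (angle q h (Im z) - angle q h (Im w)) = 1"
    using f_eq_iff[of z w] hq by auto
  obtain i :: int where i: "c * (Re z - Re w) = of_int i * 2 * pi" using a(1) unfolding cos_one_2pi_int by blast
  obtain j :: int where j: "angle q h (Im z) - angle q h (Im w) = of_int j * 2 * pi" using a(2) unfolding cos_one_2pi_int by blast
  have hne: "h \<noteq> q" using hq by simp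
  have "angle q h (Im w + of_int (j * int l) * (2 * Kc q)) = angle q h (Im w) + of_int (j * int l) * (2 * half_turn q h)"
    by (rule angle_period[OF q h_abs_less hne])
  also have "\<dots> = angle q h (Im z)" unfolding ht using j l by (simp add: field_simps)
  finally have "Im w + of_int (j * int l) * (2 * Kc q) = Im z"
    using angle_strict_mono[OF q h_abs_less hne hq] by (metis less_irrefl linorder_neqE)
  then have "Im (w - z) = 2 * Kc q * real l * of_int (- j)" by (simp add: mult_ac)
  moreover have "c * Re (w - z) = 2 * pi * of_int (- i)" using i by (simp add: algebra_simps)
  ultimately show "w - z \<in> lattice w1 w2" unfolding \<Gamma> by blast
qed

lemma not_embedded_vertical:
  assumes "f (Complex 0 y) = f (Complex 0 y')" "\<And>b::int. y' - y \<noteq> 2 * Kc q * real l * of_int b"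
  shows "\<not> embedded_torus f (lattice w1 w2)"
proof
  assume "embedded_torus f (lattice w1 w2)"
  from embedded_torusD[OF this assms(1)] have "Complex 0 y' - Complex 0 y \<in> lattice w1 w2" .
  then show False unfolding \<Gamma> using assms(2) by auto
qed

lemma not_embedded_translation:
  assumes "f (Complex 0 0) = f (Complex 0 (2 * Kc q * real k))" "0 < k" "k < l"
  shows "\<not> embedded_torus f (lattice w1 w2)"
proof (rule not_embedded_vertical[OF assms(1)])
  fix b :: int
  show "2 * Kc q * real k - 0 \<noteq> 2 * Kc q * real l * of_int b"
  proof
    assume "2 * Kc q * real k - 0 = 2 * Kc q * real l * of_int b"
    then have "real k = real l * of_int b" using Kc_pos[OF q] by simp
    then have "of_int (int k) = (of_int (int l * b) :: real)" by simp
    then have "int k = int l * b" by (simp only: of_int_eq_iff)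
    then have "int l dvd int k" by simp
    then have "l dvd k" by simp
    then show False using assms(2,3) by (simp add: nat_dvd_not_less)
  qed
qed

text \<open>The reflection of the height at \<open>n * Kc q\<close> preserves dn and sends the angle
  to 2 n half turns minus itself. If the angle is fixed by this modulo 2 pi, the point is met twice;
  the two heights are not congruent, since \<open>y\<close> lies strictly between 0 and K' and is no
  multiple of K'.\<close>

lemma not_embedded_reflection:
  assumes hq: "h \<noteq> q" and y: "0 < y" "y < Kc q"
    and eq: "angle q h y = of_int n * half_turn q h + pi * of_int j"
  shows "\<not> embedded_torus f (lattice w1 w2)"
proof (rule not_embedded_vertical)
  let ?y' = "- y + of_int n * (2 * Kc q)"
  have "angle q h ?y' = - angle q h y + of_int n * (2 * half_turn q h)"
    by (simp only: angle_period[OF q h_abs_less hq] angle_odd[OF q h_abs_less hq])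
  then have "angle q h y - angle q h ?y' = of_int j * 2 * pi" unfolding eq by (simp add: algebra_simps)
  then have "cos (angle q h y - angle q h ?y') = 1" unfolding cos_one_2pi_int by blast
  moreover have "dn q ?y' = dn q y" by (simp only: dn_period_int dn_even[OF q])
  ultimately show "f (Complex 0 y) = f (Complex 0 ?y')" unfolding f_eq_iff[OF hq] by simp
  fix b :: int
  show "?y' - y \<noteq> 2 * Kc q * real l * of_int b"
  proof
    assume "?y' - y = 2 * Kc q * real l * of_int b"
    then have "y = Kc q * of_int (n - int l * b)" by (simp add: algebra_simps)
    then have "0 < Kc q * of_int (n - int l * b)" "Kc q * of_int (n - int l * b) < Kc q * 1" using y by simp_all
    then have "0 < (of_int (n - int l * b) :: real)" "(of_int (n - int l * b) :: real) < 1"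
      using Kc_pos[OF q] by (simp_all only: zero_less_mult_iff mult_less_cancel_left_pos) auto
    then have "0 < n - int l * b" "n - int l * b < 1" by (simp_all only: of_int_0_less_iff of_int_less_1_iff)
    then show False by linarith
  qed
qed

text \<open>Here the frequency equals \<bar>s\<bar>, so the radius is 1 at every maximum of dn. All
  maxima on the line x = 0 give the same point, and as \<open>2 \<le> l\<close> a single lobe is not
  a period in the lattice.\<close>

lemma not_embedded_axis:
  assumes "h = q"
  shows "\<not> embedded_torus f (lattice w1 w2)"
proof (rule not_embedded_translation[of 1])
  obtain a b e1 e2 X Y X' Y' \<epsilon> where "orthonormal4 a b e1 e2" and "\<epsilon>^2 = (1::real)" and
    f: "\<And>z. f z = (radius q h (Im z) * cos (c * Re z)) *\<^sub>R a + (radius q h (Im z) * sin (c * Re z)) *\<^sub>R b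
       + X (Im z) *\<^sub>R e1 + Y (Im z) *\<^sub>R e2" and
    "\<And>y. (X has_real_derivative X' y) (at y)" and "\<And>y. (Y has_real_derivative Y' y) (at y)" and
    XY: "\<And>y. (X y)^2 + (Y y)^2 = 1 - (radius q h y)^2" and
    "\<And>y. X y * Y' y - Y y * X' y = \<epsilon> * (\<bar>s\<bar> / c * (q - h * (dn q y)^2))"
    using representation by metis
  have "c^2 = s^2" unfolding c_sq s(2) using assms by (simp add: power2_eq_square)
  then have sc: "\<bar>s\<bar> = c" using c_pos by (metis abs_of_pos power2_eq_iff abs_minus_cancel)
  have "dn q (2 * Kc q * real 1) = 1" using dn_period[OF q, of 0] dn_0[OF q] by simp
  then have r: "radius q h (2 * Kc q * real 1) = 1" "radius q h 0 = 1"
    unfolding radius_eq sc using dn_0[OF q] c_pos by simp_all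
  then have "X (2 * Kc q * real 1) = 0" "Y (2 * Kc q * real 1) = 0" "X 0 = 0" "Y 0 = 0"
    using XY[of "2 * Kc q * real 1"] XY[of 0] by (simp_all add: sum_power2_eq_zero_iff)
  then show "f (Complex 0 0) = f (Complex 0 (2 * Kc q * real 1))" unfolding f using r by simp
qed (use l in simp_all)

text \<open>If \<open>n\<close> and \<open>l\<close> are coprime, Bezout writes pi / l as u half
  turns plus v pi. This angle lies strictly between 0 and the half turn because
  \<open>2 \<le> n\<close>, so it is attained inside the half period, and the reflection criterion
  applies. If they share a factor g, the profile closes already after l / g lobes.\<close>

lemma not_embedded_multiple_winding:
  assumes hq: "h \<noteq> q" and ht: "half_turn q h = pi * real n / real l" and n: "2 \<le> n"
  shows "\<not> embedded_torus f (lattice w1 w2)"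
proof (cases "coprime n l")
  case True
  then obtain u v :: int where "u * int n + v * int l = 1"
    by (metis bezout_int coprime_int_iff coprime_iff_gcd_eq_1)
  then have uv: "of_int u * real n + of_int v * real l = 1"
    by (metis of_int_1 of_int_add of_int_mult of_int_of_nat_eq)
  have "pi / real l < half_turn q h" unfolding ht using n l by (simp add: field_simps)
  moreover have "0 < pi / real l" using l by simp
  ultimately obtain y where y: "0 \<le> y" "y \<le> Kc q" "angle q h y = pi / real l"
    using IVT[of "angle q h" 0 "pi / real l" "Kc q"] angle_0[OF q h_abs_less hq] angle_K[OF q h_abs_less hq]
      angle_continuous[OF q h_abs_less hq] Kc_pos[OF q] by force
  have "y \<noteq> 0" "y \<noteq> Kc q"
    using y(3) \<open>pi / real l < half_turn q h\<close> \<open>0 < pi / real l\<close> angle_0[OF q h_abs_less hq] angle_K[OF q h_abs_less hq] by auto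
  moreover have "angle q h y = of_int u * half_turn q h + pi * of_int v"
  proof -
    have "of_int u * half_turn q h + pi * of_int v = pi * (of_int u * real n + of_int v * real l) / real l"
      unfolding ht using l by (simp add: field_simps)
    then show ?thesis unfolding uv y(3) by simp
  qed
  ultimately show ?thesis using not_embedded_reflection[OF hq, of y u v] y by simp
next
  case False
  define g where "g = gcd n l"
  have "g \<noteq> 1" using False by (simp add: g_def coprime_iff_gcd_eq_1)
  moreover have "g \<noteq> 0" using l by (simp add: g_def)
  ultimately have g: "2 \<le> g" by simp
  obtain n' l' where n': "n = g * n'" and l': "l = g * l'" using g_def by (meson dvdE gcd_dvd1 gcd_dvd2)
  have "0 < l'" using l l' by (cases l') auto
  moreover have "l' < l" using g \<open>0 < l'\<close> unfolding l' by simp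
  moreover have "f (Complex 0 0) = f (Complex 0 (2 * Kc q * real l'))"
  proof -
    have "angle q h (0 + of_int (int l') * (2 * Kc q)) = of_int (int l') * (2 * half_turn q h)"
      using angle_period[OF q h_abs_less hq, of 0 "int l'"] angle_0[OF q h_abs_less hq] by simp
    also have "\<dots> = of_int (int n') * 2 * pi" unfolding ht n' l' using g \<open>0 < l'\<close> by simp
    finally have "angle q h 0 - angle q h (2 * Kc q * real l') = of_int (- int n') * 2 * pi"
      using angle_0[OF q h_abs_less hq] by (simp add: mult_ac)
    then have "cos (angle q h 0 - angle q h (2 * Kc q * real l')) = 1" unfolding cos_one_2pi_int by blast
    moreover have "dn q 0 = dn q (2 * Kc q * real l')" using dn_period_int[of 0 "int l'"] by (simp add: mult_ac)
    ultimately show ?thesis unfolding f_eq_iff[OF hq] by simp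
  qed
  ultimately show ?thesis using not_embedded_translation[of l'] by blast
qed

text \<open>For \<open>h > q\<close> the profile curve is nodoidal: the angle turns back near both ends of a half period.\<close>

lemma not_embedded_nodoid:
  assumes hq: "q < h" and ht: "half_turn q h = pi * of_int n / real l"
  shows "\<not> embedded_torus f (lattice w1 w2)"
proof -
  have hne: "h \<noteq> q" using hq by simp
  note ang = angle_0[OF q h_abs_less hne] angle_K[OF q h_abs_less hne] angle_continuous[OF q h_abs_less hne]
  have factor: "0 < freq q h * sqrt (1 - h^2) / denom q h V" if "V \<le> 1" for V
    using c_pos abs_less_1_sq[OF h_abs_less] denom_pos[OF h_abs_less hne that] by simp
  \<comment> \<open>The angle falls just after 0 and rises just before K'. A positive total forces
    it to return through 0, a negative one forces it to pass its final value earlier; for total 0 a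
    single lobe closes up.\<close>
  consider "n = 0" | "0 < n" | "n < 0" by linarith
  then show ?thesis
  proof cases
    case 1
    then have "angle q h (2 * Kc q * real 1) = 0"
      using angle_period[OF q h_abs_less hne, of 0 1] ang(1) ht by simp
    moreover have "dn q 0 = dn q (2 * Kc q * real 1)" using dn_period[OF q, of 0] by simp
    ultimately have "f (Complex 0 0) = f (Complex 0 (2 * Kc q * real 1))"
      unfolding f_eq_iff[OF hne] using ang(1) by simp
    then show ?thesis using not_embedded_translation[of 1] l by simp
  next
    case 2
    have "ang_density q h 1 = freq q h * sqrt (1 - h^2) / denom q h 1 * (q - h)" by (simp add: ang_density_def)
    also have "\<dots> < 0" by (rule mult_pos_neg[OF factor]) (use hq in simp_all)
    finally have "ang_density q h ((dn q 0)^2) < 0" by (simp add: dn_0[OF q])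
    from DERIV_neg_dec_right[OF angle_deriv[OF q h_abs_less hne] this]
    obtain d where d: "0 < d" "\<And>t. 0 < t \<Longrightarrow> t < d \<Longrightarrow> angle q h (0 + t) < angle q h 0" by blast
    define y1 where "y1 = min (d / 2) (Kc q / 2)"
    have y1: "0 < y1" "y1 < d" "y1 < Kc q" using d(1) Kc_pos[OF q] by (auto simp: y1_def min_def)
    have "angle q h y1 < 0" using d(2)[of y1] y1 ang(1) by simp
    moreover have "0 < half_turn q h" unfolding ht using 2 l by simp
    ultimately obtain y where y: "y1 \<le> y" "y \<le> Kc q" "angle q h y = 0"
      using IVT[of "angle q h" y1 0 "Kc q"] ang y1 by force
    have "y \<noteq> Kc q" using y(3) ang(2) \<open>0 < half_turn q h\<close> by auto
    then show ?thesis using not_embedded_reflection[OF hne, of y 0 0] y y1 by simp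
  next
    case 3
    have "h * q^2 < 1 * q"
    proof -
      have "h * q^2 < 1 * q^2" using h_abs_less q by (intro mult_strict_right_mono) auto
      also have "1 * q^2 \<le> 1 * q" using q by (simp add: power2_eq_square mult_left_le)
      finally show ?thesis .
    qed
    then have "0 < freq q h * sqrt (1 - h^2) / denom q h (q^2) * (q - h * q^2)"
      by (intro mult_pos_pos factor) (use q in \<open>simp_all add: power_le_one\<close>)
    then have "0 < ang_density q h ((dn q (Kc q))^2)" by (simp add: ang_density_def dn_K[OF q])
    from DERIV_pos_inc_left[OF angle_deriv[OF q h_abs_less hne] this]
    obtain d where d: "0 < d" "\<And>t. 0 < t \<Longrightarrow> t < d \<Longrightarrow> angle q h (Kc q - t) < angle q h (Kc q)" by blast
    define t where "t = min (d / 2) (Kc q / 2)"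
    have t: "0 < t" "t < d" "t < Kc q" using d(1) Kc_pos[OF q] by (auto simp: t_def min_def)
    have "angle q h (Kc q - t) < half_turn q h" using d(2)[of t] t ang(2) by simp
    moreover have neg: "half_turn q h < 0" unfolding ht using 3 l by (simp add: divide_neg_pos mult_pos_neg)
    ultimately obtain y where y: "0 \<le> y" "y \<le> Kc q - t" "angle q h y = half_turn q h"
      using IVT2[of "angle q h" "Kc q - t" "half_turn q h" 0] ang t by force
    have "y \<noteq> 0" using y(3) ang(1) neg by auto
    then show ?thesis using not_embedded_reflection[OF hne, of y 1 0] y t by simp
  qed
qed

end

end

section \<open>Flat tori of revolution\<close>

text \<open>The powers of \<open>J\<close> alternate between the identity and \<open>J\<close>, so
  the series splits into the even and odd parts of the scalar exponential.\<close>

lemma matrix_exp_involution: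
  fixes J :: "complex ^ 2 ^ 2"
  assumes J: "J ** J = mat 1"
  shows "matrix_exp (\<chi> i j. a * J $ i $ j) =
    (\<chi> i j. (exp a + exp (- a)) / 2 * mat 1 $ i $ j + (exp a - exp (- a)) / 2 * J $ i $ j)"
proof -
  let ?A = "\<chi> i j. a * J $ i $ j"
  let ?M = "\<lambda>M t. (\<chi> i j. t * M $ i $ j) :: complex ^ 2 ^ 2"
  have lin: "bounded_linear (?M M)" for M
    by (intro linear_conv_bounded_linear[THEN iffD1] linearI) (simp_all add: vec_eq_iff algebra_simps)
  have mult: "?A ** ?M N t = ?M (J ** N) (a * t)" for N t
    by (simp add: vec_eq_iff matrix_matrix_mult_def sum_distrib_left mult_ac)
  have pow: "((**) ?A ^^ n) (mat 1) = ?M (if even n then mat 1 else J) (a ^ n)" for n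
  proof (induction n)
    case 0 show ?case by (simp add: vec_eq_iff)
  next
    case (Suc n) then show ?case by (simp add: mult J)
  qed
  have e: "(\<lambda>n. a ^ n /\<^sub>R fact n) sums exp a" "(\<lambda>n. (- a) ^ n /\<^sub>R fact n) sums exp (- a)"
    by (rule exp_converges)+
  have "(\<lambda>n. ?M (mat 1) ((a ^ n /\<^sub>R fact n + (- a) ^ n /\<^sub>R fact n) / 2) + ?M J ((a ^ n /\<^sub>R fact n - (- a) ^ n /\<^sub>R fact n) / 2))
     sums (?M (mat 1) ((exp a + exp (- a)) / 2) + ?M J ((exp a - exp (- a)) / 2))"
    by (intro sums_add bounded_linear.sums[OF lin] sums_divide sums_diff e)
  moreover have "?M (mat 1) ((a ^ n /\<^sub>R fact n + (- a) ^ n /\<^sub>R fact n) / 2) + ?M J ((a ^ n /\<^sub>R fact n - (- a) ^ n /\<^sub>R fact n) / 2)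
      = (1 / fact n) *\<^sub>R ((**) ?A ^^ n) (mat 1)" for n
  proof (cases "even n")
    case True
    then have "(- a) ^ n = a ^ n" by simp
    then show ?thesis unfolding pow using True by (simp add: vec_eq_iff scaleR_conv_of_real[where 'a = complex] field_simps)
  next
    case False
    then have "(- a) ^ n = - (a ^ n)" by simp
    then show ?thesis unfolding pow using False by (simp add: vec_eq_iff scaleR_conv_of_real[where 'a = complex] field_simps)
  qed
  ultimately have "(\<lambda>n. (1 / fact n) *\<^sub>R ((**) ?A ^^ n) (mat 1)) sums
      (?M (mat 1) ((exp a + exp (- a)) / 2) + ?M J ((exp a - exp (- a)) / 2))" by simp
  then have "matrix_exp ?A = ?M (mat 1) ((exp a + exp (- a)) / 2) + ?M J ((exp a - exp (- a)) / 2)"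
    unfolding matrix_exp_def by (simp add: sums_iff)
  then show ?thesis by (simp add: vec_eq_iff)
qed

text \<open>The exponent equals i p J for the involution J with off-diagonal entries
  \<open>cnj \<mu>\<close> and \<open>\<mu>\<close>, since \<mu> is a unitary square root of \<zeta>
  and the pairing equals \<open>z * cnj \<mu> + cnj z * \<mu>\<close>.\<close>

lemma flat_frame_eq:
  fixes z :: complex
  assumes \<mu>: "\<mu>^2 = \<zeta>" "cmod \<mu> = 1"
  defines "p \<equiv> pi * pairing z \<mu>"
  shows "flat_frame \<zeta> z = vector [vector [of_real (cos p), \<i> * of_real (sin p) * cnj \<mu>],
                                  vector [\<i> * of_real (sin p) * \<mu>, of_real (cos p)]]"
proof -
  have inv: "\<mu> * cnj \<mu> = 1" using \<mu>(2) by (simp add: complex_norm_square[symmetric])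
  have \<mu>0: "\<mu> \<noteq> 0" using \<mu>(2) by auto
  have inv\<zeta>: "inverse \<zeta> = (cnj \<mu>)^2"
    unfolding \<mu>(1)[symmetric] by (rule inverse_unique) (simp add: power_mult_distrib[symmetric] inv)
  define J :: "complex ^ 2 ^ 2" where "J = vector [vector [0, cnj \<mu>], vector [\<mu>, 0]]"
  have J: "J ** J = mat 1"
    by (simp add: J_def vec_eq_iff matrix_matrix_mult_def sum_2 forall_2 mat_def inv mult.commute)
  define a where "a = \<i> * of_real p"
  have pair: "of_real (pairing z \<mu>) = z * cnj \<mu> + cnj z * \<mu>"
    by (simp add: pairing_def complex_eq_iff)
  have 1: "pi * \<i> * (z * inverse \<zeta> + cnj z) = a * cnj \<mu>"
    unfolding a_def p_def of_real_mult pair inv\<zeta> using inv by algebra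
  have 2: "pi * \<i> * (z + cnj z * \<zeta>) = a * \<mu>"
    unfolding a_def p_def of_real_mult pair \<mu>(1)[symmetric] using inv by algebra
  have "vector [vector [0, pi * \<i> * (z * inverse \<zeta> + cnj z)], vector [pi * \<i> * (z + cnj z * \<zeta>), 0]]
      = (\<chi> i j. a * J $ i $ j)"
    unfolding 1 2 by (simp add: vec_eq_iff forall_2 J_def)
  then have ff: "flat_frame \<zeta> z = matrix_exp (\<chi> i j. a * J $ i $ j)"
    unfolding flat_frame_def Let_def by simp
  have e: "exp a = of_real (cos p) + \<i> * of_real (sin p)" "exp (- a) = of_real (cos p) - \<i> * of_real (sin p)"
    using exp_Euler[of "of_real p"] exp_Euler[of "- of_real p"]
    by (simp_all add: a_def cos_of_real sin_of_real)
  have "(exp a + exp (- a)) / 2 = of_real (cos p)" "(exp a - exp (- a)) / 2 = \<i> * of_real (sin p)"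
    unfolding e by simp_all
  then show ?thesis
    unfolding ff matrix_exp_involution[OF J] by (simp add: vec_eq_iff forall_2 J_def mat_def)
qed

lemma matrix_inv_eqI:
  fixes A B :: "complex ^ 2 ^ 2"
  assumes "A ** B = mat 1" "B ** A = mat 1"
  shows "matrix_inv A = B"
proof -
  have "A ** matrix_inv A = mat 1 \<and> matrix_inv A ** A = mat 1"
    unfolding matrix_inv_def
    using someI[of "\<lambda>A'. A ** A' = mat 1 \<and> A' ** A = mat 1" B] assms by blast
  then have "B = (matrix_inv A ** A) ** B" by simp
  also have "\<dots> = matrix_inv A" unfolding matrix_mul_assoc[symmetric] assms(1) by simp
  finally show ?thesis by simp
qed

lemma vector_4_nth:
  "(vector [a, b, c, d] :: 'a::zero ^ 4) $ 1 = a" "(vector [a, b, c, d] :: 'a ^ 4) $ 2 = b"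
  "(vector [a, b, c, d] :: 'a ^ 4) $ 3 = c" "(vector [a, b, c, d] :: 'a ^ 4) $ 4 = d"
  by (simp_all add: vector_def)

text \<open>The flat immersion is identified with a member of the family only up to an unknown
  isometry and a complex factor. Scalar products with the point at 0 eliminate the isometry.\<close>

lemma flat_immersion_inner_0:
  fixes z :: complex
  assumes \<mu>: "\<mu>1^2 = \<zeta>1" "cmod \<mu>1 = 1" "\<mu>2^2 = \<zeta>2" "cmod \<mu>2 = 1"
  defines "p1 \<equiv> pi * pairing z \<mu>1" and "p2 \<equiv> pi * pairing z \<mu>2"
  shows "inner (flat_immersion \<zeta>1 \<zeta>2 z) (flat_immersion \<zeta>1 \<zeta>2 0) =
    cos p1 * cos p2 + sin p1 * sin p2 * Re (cnj \<mu>1 * \<mu>2)"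
proof -
  have inv: "\<mu>2 * cnj \<mu>2 = 1" using \<mu>(4) by (simp add: complex_norm_square[symmetric])
  have matinv: "matrix_inv (flat_frame \<zeta>2 z) = vector [vector [of_real (cos p), - \<i> * of_real (sin p) * cnj \<mu>2],
                                  vector [- \<i> * of_real (sin p) * \<mu>2, of_real (cos p)]]" (is "_ = ?G")
    if p: "p = pi * pairing z \<mu>2" for p z
  proof -
    have cs: "of_real (cos p) * of_real (cos p) + of_real (sin p) * of_real (sin p) = (1::complex)"
      by (metis of_real_1 of_real_add of_real_mult sin_cos_squared_add3)
    have cs': "of_real (cos p) * of_real (cos p) + \<mu>2 * (cnj \<mu>2 * (of_real (sin p) * of_real (sin p))) = (1::complex)"
      "of_real (cos p) * of_real (cos p) + cnj \<mu>2 * (\<mu>2 * (of_real (sin p) * of_real (sin p))) = (1::complex)"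
      using cs inv by algebra+
    have G: "flat_frame \<zeta>2 z ** ?G = mat 1" "?G ** flat_frame \<zeta>2 z = mat 1"
      unfolding flat_frame_eq[OF \<mu>(3,4)] p[symmetric] using cs'
      by (simp_all add: vec_eq_iff matrix_matrix_mult_def sum_2 forall_2 mat_def algebra_simps)
    then show ?thesis by (rule matrix_inv_eqI)
  qed
  have 11: "(flat_frame \<zeta>1 z ** matrix_inv (flat_frame \<zeta>2 z)) $ 1 $ 1
      = of_real (cos (pi * pairing z \<mu>1) * cos (pi * pairing z \<mu>2)) + of_real (sin (pi * pairing z \<mu>1) * sin (pi * pairing z \<mu>2)) * (cnj \<mu>1 * \<mu>2)" for z
    unfolding matinv[OF refl] flat_frame_eq[OF \<mu>(1,2)]
    by (simp add: matrix_matrix_mult_def sum_2 algebra_simps)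
  have 12: "(flat_frame \<zeta>1 0 ** matrix_inv (flat_frame \<zeta>2 0)) $ 1 $ 2 = 0"
    unfolding matinv[OF refl] flat_frame_eq[OF \<mu>(1,2)]
    by (simp add: matrix_matrix_mult_def sum_2 pairing_def)
  have "flat_immersion \<zeta>1 \<zeta>2 0 = vector [1, 0, 0, 0]"
    unfolding flat_immersion_def su2_vec_def 12 11 by (simp add: pairing_def)
  then have "inner (flat_immersion \<zeta>1 \<zeta>2 z) (flat_immersion \<zeta>1 \<zeta>2 0) = flat_immersion \<zeta>1 \<zeta>2 z $ 1"
    by (simp add: inner_vec_def sum_4 vector_4_nth)
  also have "\<dots> = Re ((flat_frame \<zeta>1 z ** matrix_inv (flat_frame \<zeta>2 z)) $ 1 $ 1)"
    by (simp add: flat_immersion_def su2_vec_def vector_4_nth)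
  also have "\<dots> = cos p1 * cos p2 + sin p1 * sin p2 * Re (cnj \<mu>1 * \<mu>2)"
    unfolding 11 p1_def p2_def by simp
  finally show ?thesis .
qed

text \<open>Minus the second derivative replaces the amplitudes A, B by A a^2, B b^2 and keeps the
  shape of the identity. Evaluation at 0 after one and after two applications gives the two
  moments.\<close>

lemma cos_combination_moments:
  fixes A B A' B' a b a' b' :: real
  assumes eq: "\<And>t. A * cos (a * t) + B * cos (b * t) = A' * cos (a' * t) + B' * cos (b' * t)"
  shows "A * a^2 + B * b^2 = A' * a'^2 + B' * b'^2" "A * a^4 + B * b^4 = A' * a'^4 + B' * b'^4"
proof -
  have dcos: "((\<lambda>t. A * cos (a * t) + B * cos (b * t)) has_real_derivative
      - (A * a * sin (a * t) + B * b * sin (b * t))) (at t)" for A B a b t :: real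
    by (auto intro!: derivative_eq_intros simp: algebra_simps)
  have dsin: "((\<lambda>t. - (A * sin (a * t) + B * sin (b * t))) has_real_derivative
      - (A * a * cos (a * t) + B * b * cos (b * t))) (at t)" for A B a b t :: real
    by (auto intro!: derivative_eq_intros simp: algebra_simps)
  have step: "(A * a^2) * cos (a * t) + (B * b^2) * cos (b * t) = (A' * a'^2) * cos (a' * t) + (B' * b'^2) * cos (b' * t)"
    if eq: "\<And>t. A * cos (a * t) + B * cos (b * t) = A' * cos (a' * t) + B' * cos (b' * t)"
    for A B A' B' t
  proof -
    have eq': "- (A * a * sin (a * t) + B * b * sin (b * t)) = - (A' * a' * sin (a' * t) + B' * b' * sin (b' * t))" for t
      using DERIV_unique[OF dcos[of A a B b t]] dcos[of A' a' B' b' t] unfolding eq by blast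
    have "- (A * a * a * cos (a * t) + B * b * b * cos (b * t)) = - (A' * a' * a' * cos (a' * t) + B' * b' * b' * cos (b' * t))"
      using DERIV_unique[OF dsin[of "A * a" a "B * b" b t]] dsin[of "A' * a'" a' "B' * b'" b' t]
      unfolding eq' by blast
    then show ?thesis by (simp add: power2_eq_square mult.assoc)
  qed
  show "A * a^2 + B * b^2 = A' * a'^2 + B' * b'^2" using step[OF eq, of 0] by simp
  show "A * a^4 + B * b^4 = A' * a'^4 + B' * b'^4" using step[OF step[OF eq], of 0] by (simp add: power4_eq_xxxx power2_eq_square)
qed


text \<open>The two points are conjugate and, being distinct, not real; hence their principal roots
  are conjugate with positive real part.\<close>

lemma csqrt_conjugate_pair:
  assumes "\<zeta>2 = inverse \<zeta>1" "cmod \<zeta>1 = 1" "\<zeta>1 \<noteq> \<zeta>2"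
  obtains C S where "C^2 + S^2 = (1::real)" "0 < C" "S \<noteq> 0" "csqrt \<zeta>1 = Complex C S" "csqrt \<zeta>2 = Complex C (- S)"
proof -
  define m where "m = csqrt \<zeta>1"
  have m2: "m^2 = \<zeta>1" by (simp add: m_def)
  have "(cmod m)^2 = 1" using assms(2) m2 by (simp add: norm_power[symmetric])
  then have sq: "(Re m)^2 + (Im m)^2 = 1" by (simp add: cmod_power2)
  have inv: "\<zeta>2 = cnj \<zeta>1"
    unfolding assms(1) by (rule inverse_unique) (use assms(2) in \<open>simp add: complex_norm_square[symmetric]\<close>)
  have "Re m \<noteq> 0"
  proof
    assume "Re m = 0"
    then have "\<zeta>1 = - of_real ((Im m)^2)" unfolding m2[symmetric] by (simp add: complex_eq_iff power2_eq_square)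
    then have "cnj \<zeta>1 = \<zeta>1" by (simp add: complex_eq_iff)
    then show False using assms(3) inv by simp
  qed
  then have pos: "0 < Re m" using csqrt_principal[of \<zeta>1] by (auto simp: m_def)
  have "Im m \<noteq> 0"
  proof
    assume "Im m = 0"
    then have "cnj \<zeta>1 = \<zeta>1" unfolding m2[symmetric] by (simp add: complex_eq_iff power2_eq_square)
    then show False using assms(3) inv by simp
  qed
  moreover have "csqrt \<zeta>2 = cnj m"
    by (rule csqrt_unique) (use pos in \<open>simp_all add: inv m2[symmetric]\<close>)
  then have "csqrt \<zeta>2 = Complex (Re m) (- Im m)" by (simp add: complex_eq_iff)
  moreover have "csqrt \<zeta>1 = Complex (Re m) (Im m)" by (simp only: m_def complex_surj)
  ultimately show ?thesis using that sq pos by blast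
qed

text \<open>Two integrality conditions of the flat lattice concern the same coordinate, with ratio
  l0 / l2 in lowest terms; together they demand a multiple of l2. This is where the number of lobes
  comes from.\<close>

lemma coprime_multiples:
  fixes x t :: real
  assumes t: "\<bar>t\<bar> = real l0 / real l2" and l: "coprime l0 l2" "0 < l2"
  shows "2 * x \<in> \<int> \<and> 2 * t * x \<in> \<int> \<longleftrightarrow> (\<exists>b::int. 2 * x = real l2 * of_int b)"
proof
  assume "2 * x \<in> \<int> \<and> 2 * t * x \<in> \<int>"
  then obtain j k :: int where j: "2 * x = of_int j" and k: "2 * t * x = of_int k" by (auto elim!: Ints_cases)
  have "\<bar>t\<bar> * \<bar>2 * x\<bar> = \<bar>of_int k\<bar>" unfolding k[symmetric] by (simp add: abs_mult)
  then have "real l0 * \<bar>of_int j\<bar> = real l2 * \<bar>of_int k\<bar>" unfolding t j using l(2) by (simp add: field_simps)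
  then have "of_int (int l0 * \<bar>j\<bar>) = (of_int (int l2 * \<bar>k\<bar>) :: real)" by simp
  then have "int l0 * \<bar>j\<bar> = int l2 * \<bar>k\<bar>" by (simp only: of_int_eq_iff)
  then have "int l2 dvd int l0 * \<bar>j\<bar>" by simp
  then have "int l2 dvd j" using l(1) by (simp add: coprime_dvd_mult_right_iff coprime_commute)
  then obtain b where "j = int l2 * b" by blast
  then show "\<exists>b::int. 2 * x = real l2 * of_int b" using j by auto
next
  assume "\<exists>b::int. 2 * x = real l2 * of_int b"
  then obtain b :: int where b: "2 * x = real l2 * of_int b" by blast
  have "t = real l0 / real l2 \<or> t = - (real l0 / real l2)" using t by linarith
  then have d: "t * real l2 = real l0 \<or> t * real l2 = - real l0" using l(2) by auto
  have "2 * t * x = (t * real l2) * of_int b" using b by algebra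
  then have "2 * t * x = of_int (int l0 * b) \<or> 2 * t * x = of_int (- int l0 * b)"
    using d by (elim disjE) simp_all
  moreover have "2 * x = of_int (int l2 * b)" using b by simp
  ultimately show "2 * x \<in> \<int> \<and> 2 * t * x \<in> \<int>" by (metis Ints_of_int)
qed

text \<open>Irrationality of the square root of 2; it rules out the square torus.\<close>

lemma coprime_sq_ne:
  assumes "coprime l0 (l2::nat)" "2 * l0^2 = l2^2"
  shows False
proof -
  have "even (l2^2)" using assms(2) by (metis dvd_triv_left)
  then have "even l2" by simp
  then obtain k where "l2 = 2 * k" by blast
  then have "l0^2 = 2 * k^2" using assms(2) by (simp add: power_mult_distrib)
  then have "even (l0^2)" by simp
  then have "even l0" by simp
  then show False using \<open>even l2\<close> assms(1) by (metis coprime_common_divisor odd_one)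
qed

text \<open>The root of \<zeta>0 is 1 or i, so s1 and s2 agree up to sign: one of s1 + s2, s1 - s2
  is 0 and the other has modulus 4 \<bar>c\<bar> t', while \<bar>s0\<bar> = 4 \<bar>c\<bar> t t'.
  The ratio of \<open>l0\<close> and \<open>l2\<close> is therefore t, and the gcd condition becomes
  coprimality.\<close>

lemma flat_torus_type_ratio:
  assumes type: "flat_torus_type (of_real (sgn q)) \<zeta>1 \<zeta>2 l0 0 l2" and q: "\<bar>q\<bar> = 1"
    and m: "csqrt \<zeta>1 = Complex C S" "csqrt \<zeta>2 = Complex C (- S)"
    and CS: "C^2 + S^2 = 1" "0 < C" "S \<noteq> 0"
  shows "coprime l0 l2" "0 < l0" "l0 < l2" "real l0 / real l2 = (if q = 1 then C else \<bar>S\<bar>)"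
proof -
  obtain s0 s1 s2 :: int and c :: real where
    s0: "of_int s0 = of_real c * (\<i> * (Complex C S * cnj (Complex C (- S)) - Complex C (- S) * cnj (Complex C S)))" and
    s1: "of_int s1 = of_real c * (\<i> * (Complex C (- S) * cnj (csqrt (of_real (sgn q))) - csqrt (of_real (sgn q)) * cnj (Complex C (- S))))" and
    s2: "of_int s2 = of_real c * (\<i> * (csqrt (of_real (sgn q)) * cnj (Complex C S) - Complex C S * cnj (csqrt (of_real (sgn q)))))" and
    g: "gcd s0 (gcd (s1 + s2) (s1 - s2)) = 2" and
    l0: "2 * int l0 = \<bar>s0\<bar>" and "0 = min \<bar>s1 + s2\<bar> \<bar>s1 - s2\<bar>" and l2: "2 * int l2 = max \<bar>s1 + s2\<bar> \<bar>s1 - s2\<bar>"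
    using type unfolding flat_torus_type_def Let_def m by auto
  define t where "t = (if q = 1 then C else \<bar>S\<bar>)"
  define t' where "t' = (if q = 1 then \<bar>S\<bar> else C)"
  have t: "0 < t" "t < 1" "0 < t'" "t * t' = C * \<bar>S\<bar>"
  proof -
    have "0 < C^2" "0 < S^2" using CS by auto
    then have "C^2 < 1" "\<bar>S\<bar>^2 < 1" using CS(1) by (simp_all only: power2_abs)
    then have "C < 1" "\<bar>S\<bar> < 1" using CS(2) by (simp_all add: abs_square_less_1)
    then show "0 < t" "t < 1" "0 < t'" "t * t' = C * \<bar>S\<bar>" using CS by (auto simp: t_def t'_def)
  qed
  have "Re (of_int s0) = c * (- 4 * C * S)" unfolding s0 by simp
  then have rs0: "real_of_int s0 = c * (- 4 * C * S)" by simp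
  then have rs0: "\<bar>real_of_int s0\<bar> = 4 * \<bar>c\<bar> * (t * t')" using CS unfolding t by (simp add: abs_mult)
  have rs: "real_of_int (max \<bar>s1 + s2\<bar> \<bar>s1 - s2\<bar>) = 4 * \<bar>c\<bar> * t'
      \<and> gcd (s1 + s2) (s1 - s2) = max \<bar>s1 + s2\<bar> \<bar>s1 - s2\<bar>"
  proof (cases "q = 1")
    case True
    have "Re (of_int s1) = c * (2 * S)" "Re (of_int s2) = c * (2 * S)" unfolding s1 s2 using True by simp_all
    then have r: "real_of_int s1 = c * (2 * S)" "real_of_int s2 = c * (2 * S)" by simp_all
    then have "s1 = s2" by linarith
    moreover have "real_of_int (max \<bar>s1 + s2\<bar> \<bar>s1 - s2\<bar>) = \<bar>real_of_int s1 + real_of_int s2\<bar>"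
      using \<open>s1 = s2\<close> by simp
    then have "real_of_int (max \<bar>s1 + s2\<bar> \<bar>s1 - s2\<bar>) = 4 * \<bar>c\<bar> * t'"
      unfolding r using True by (simp add: t'_def abs_mult)
    ultimately show ?thesis by simp
  next
    case False
    then have "q = -1" using q by auto
    have "Re (of_int s1) = c * (2 * C)" "Re (of_int s2) = c * (- 2 * C)" unfolding s1 s2 using \<open>q = -1\<close> by simp_all
    then have r: "real_of_int s1 = c * (2 * C)" "real_of_int s2 = c * (- 2 * C)" by simp_all
    then have "s1 = - s2" by linarith
    moreover have "real_of_int (max \<bar>s1 + s2\<bar> \<bar>s1 - s2\<bar>) = \<bar>real_of_int s1 - real_of_int s2\<bar>"
      using \<open>s1 = - s2\<close> by simp
    then have "real_of_int (max \<bar>s1 + s2\<bar> \<bar>s1 - s2\<bar>) = 4 * \<bar>c\<bar> * t'"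
      unfolding r using False CS(2) by (simp add: t'_def abs_mult)
    ultimately show ?thesis by simp
  qed
  have L2: "real l2 = 2 * \<bar>c\<bar> * t'"
  proof -
    have "2 * real l2 = real_of_int (2 * int l2)" by simp
    also have "\<dots> = 4 * \<bar>c\<bar> * t'" unfolding l2 using rs by blast
    finally show ?thesis by simp
  qed
  have L0: "real l0 = 2 * \<bar>c\<bar> * (t * t')"
  proof -
    have "2 * real l0 = real_of_int (2 * int l0)" by simp
    also have "\<dots> = 4 * \<bar>c\<bar> * (t * t')" unfolding l0 using rs0 by simp
    finally show ?thesis by simp
  qed
  have "gcd (2 * int l0) (2 * int l2) = 2"
    using g rs unfolding l0 l2 by simp
  then have "2 * gcd (int l0) (int l2) = 2" by (simp add: gcd_mult_distrib_int[symmetric])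
  then have "gcd l0 l2 = 1" by (simp add: gcd_int_int_eq)
  then show co: "coprime l0 l2" by (simp add: coprime_iff_gcd_eq_1)
  have "c \<noteq> 0"
  proof
    assume "c = 0"
    then have "l0 = 0" "l2 = 0" using L0 L2 by auto
    then show False using \<open>gcd l0 l2 = 1\<close> by simp
  qed
  then have "0 < real l0" "0 < real l2" unfolding L0 L2 using t(1-3) by simp_all
  then show "0 < l0" by simp
  have eq: "real l0 = t * real l2" unfolding L0 L2 by simp
  then have "real l0 < real l2" using t(2) \<open>0 < real l2\<close> by simp
  then show "l0 < l2" by simp
  show "real l0 / real l2 = (if q = 1 then C else \<bar>S\<bar>)" unfolding eq t_def[symmetric] using \<open>0 < real l2\<close> by simp
qed


text \<open>The Taylor coefficients of orders 2 and 4 along the two axes fix the scaling constant \<open>\<alpha> + i \<beta>\<close> up to a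
  sign. For the square torus they would also allow an exchange of the axes, but \<open>C\<^sup>2 = S\<^sup>2\<close> contradicts
  the rationality of \<open>l0 / l2\<close>.\<close>

lemma flat_scaling:
  fixes C S H \<alpha> \<beta> :: real and l0 l2 :: nat
  assumes CS: "C^2 + S^2 = 1" "0 < C" "S \<noteq> 0" and q: "\<bar>q\<bar> = 1" and H: "H = q * (C^2 - S^2)"
    and l: "coprime l0 l2" "0 < l2" "real l0 / real l2 = (if q = 1 then C else \<bar>S\<bar>)"
    and eq: "\<And>x y. (1 + H) / 2 * cos (sqrt (2 - 2 * H) * (\<alpha> * x - \<beta> * y)) + (1 - H) / 2 * cos (sqrt (2 + 2 * H) * (\<alpha> * y + \<beta> * x))
        = S^2 * cos (4 * pi * C * x) + C^2 * cos (4 * pi * S * y)"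
  shows "if q = 1 then \<alpha> = 0 \<and> \<bar>\<beta>\<bar> = 2 * pi else \<beta> = 0 \<and> \<bar>\<alpha>\<bar> = 2 * pi"
proof -
  have sq: "(sqrt (2 - 2 * H))^2 = 2 - 2 * H" "(sqrt (2 + 2 * H))^2 = 2 + 2 * H"
  proof -
    have "C^2 \<le> 1" "S^2 \<le> 1" using CS(1) zero_le_power2[of C] zero_le_power2[of S] by linarith+
    moreover have "H = C^2 - S^2 \<or> H = S^2 - C^2" using q unfolding H by (auto simp: abs_if split: if_splits)
    ultimately have "H \<le> 1" "-1 \<le> H" using zero_le_power2[of C] zero_le_power2[of S] by linarith+
    then show "(sqrt (2 - 2 * H))^2 = 2 - 2 * H" "(sqrt (2 + 2 * H))^2 = 2 + 2 * H" by simp_all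
  qed
  have p4: "x^4 = (x^2)^2" for x :: real by (simp add: power_mult[symmetric])
  note m1 = cos_combination_moments[of "(1 + H) / 2" "sqrt (2 - 2 * H) * \<alpha>" "(1 - H) / 2" "sqrt (2 + 2 * H) * \<beta>" "S^2" "4 * pi * C" "C^2" 0]
  note m2 = cos_combination_moments[of "(1 + H) / 2" "sqrt (2 - 2 * H) * (- \<beta>)" "(1 - H) / 2" "sqrt (2 + 2 * H) * \<alpha>" "S^2" 0 "C^2" "4 * pi * S"]
  have e1: "(1 + H) / 2 * ((2 - 2 * H) * \<alpha>^2) + (1 - H) / 2 * ((2 + 2 * H) * \<beta>^2) = S^2 * (16 * pi^2 * C^2)"
    using m1(1) eq[of _ 0] by (simp add: power_mult_distrib sq mult.assoc)
  have e2: "(1 + H) / 2 * ((2 - 2 * H)^2 * \<alpha>^4) + (1 - H) / 2 * ((2 + 2 * H)^2 * \<beta>^4) = S^2 * (256 * pi^4 * C^4)"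
    using m1(2) eq[of _ 0] by (simp add: p4[of "sqrt _"] power_mult_distrib sq mult.assoc)
  have e3: "(1 + H) / 2 * ((2 - 2 * H)^2 * \<beta>^4) + (1 - H) / 2 * ((2 + 2 * H)^2 * \<alpha>^4) = C^2 * (256 * pi^4 * S^4)"
    using m2(2) eq[of 0] by (simp add: p4[of "sqrt _"] power_mult_distrib sq mult.assoc)
  have q2: "q^2 = 1" using q by (metis abs_power2 power2_abs power_one)
  have C2: "C^2 = 1 - S^2" using CS(1) by simp
  have HH: "1 - H^2 = 4 * (C^2 * S^2)" unfolding H power_mult_distrib q2 C2 by algebra
  have k: "4 * (C^2 * S^2) \<noteq> 0" using CS by simp
  have "4 * (C^2 * S^2) * (\<alpha>^2 + \<beta>^2) = 4 * (C^2 * S^2) * (4 * pi^2)" using e1 HH by algebra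
  then have n: "\<alpha>^2 + \<beta>^2 = 4 * pi^2" unfolding mult_left_cancel[OF k] .
  have "4 * (C^2 * S^2) * ((2 - 2 * H) * \<alpha>^4 + (2 + 2 * H) * \<beta>^4) = 4 * (C^2 * S^2) * (64 * pi^4 * C^2)"
    using e2 HH by algebra
  then have f1: "(2 - 2 * H) * \<alpha>^4 + (2 + 2 * H) * \<beta>^4 = 64 * pi^4 * C^2" unfolding mult_left_cancel[OF k] .
  have "4 * (C^2 * S^2) * ((2 - 2 * H) * \<beta>^4 + (2 + 2 * H) * \<alpha>^4) = 4 * (C^2 * S^2) * (64 * pi^4 * S^2)"
    using e3 HH by algebra
  then have f2: "(2 - 2 * H) * \<beta>^4 + (2 + 2 * H) * \<alpha>^4 = 64 * pi^4 * S^2" unfolding mult_left_cancel[OF k] .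
  \<comment> \<open>The sum of both relations of order 4 says that \<alpha>^4 + \<beta>^4 equals the
    square of \<alpha>^2 + \<beta>^2, hence \<alpha> \<beta> = 0.\<close>
  have "4 * (\<alpha>^4 + \<beta>^4) = 64 * pi^4" using f1 f2 CS(1) by algebra
  then have "2 * (\<alpha>^2 * \<beta>^2) = 0" using n by algebra
  then have ab: "\<alpha> = 0 \<or> \<beta> = 0" by simp
  have CnS: "C^2 \<noteq> S^2"
  proof
    assume "C^2 = S^2"
    then have "2 * (real l0 / real l2)^2 = 1" unfolding l(3) using CS(1) by simp
    then have "2 * (real l0)^2 = (real l2)^2" using l(2) by (simp add: power_divide field_simps)
    then have "real (2 * l0^2) = real (l2^2)" by simp
    then have "2 * l0^2 = l2^2" by (simp only: of_nat_eq_iff)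
    then show False by (rule coprime_sq_ne[OF l(1)])
  qed
  have abs2pi: "\<bar>t\<bar> = 2 * pi" if "t^2 = 4 * pi^2" for t :: real
  proof -
    have "\<bar>t\<bar>^2 = (2 * pi)^2" using that by simp
    then show ?thesis by (rule power2_eq_imp_eq) simp_all
  qed
  show ?thesis
  proof (cases "q = 1")
    case True
    then have H': "2 - 2 * H = 4 * S^2" "2 + 2 * H = 4 * C^2" unfolding H using CS(1) by simp_all
    have "\<beta> \<noteq> 0"
    proof
      assume "\<beta> = 0"
      then have "4 * S^2 * (4 * pi^2)^2 = 64 * pi^4 * C^2" using f1 n unfolding H' by algebra
      then have "64 * pi^4 * (S^2 - C^2) = 0" by algebra
      then show False using CnS by simp
    qed
    then have "\<alpha> = 0" using ab by simp
    then show ?thesis using True n abs2pi by simp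
  next
    case False
    then have "q = -1" using q by auto
    then have H': "2 - 2 * H = 4 * C^2" "2 + 2 * H = 4 * S^2" unfolding H using CS(1) by simp_all
    have "\<alpha> \<noteq> 0"
    proof
      assume "\<alpha> = 0"
      then have "4 * S^2 * (4 * pi^2)^2 = 64 * pi^4 * C^2" using f1 n unfolding H' by algebra
      then have "64 * pi^4 * (S^2 - C^2) = 0" by algebra
      then show False using CnS by simp
    qed
    then have "\<beta> = 0" using ab by simp
    then show ?thesis using False n abs2pi by simp
  qed
qed

text \<open>Comparing the two expressions for the scalar product with the point at 0 determines the
  factor c: it is \<open>2 * pi\<close> up to sign for q = -1, and i times this for q = 1, when the
  axes are exchanged. The sign does not affect integrality. In the new coordinate one condition
  describes rotation periods and the other two describe multiples of \<open>l2\<close> lobes, each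
  of height pi = 2 K'.\<close>

lemma flat_start:
  assumes flat: "flat_revolution_torus l0 l2 q \<theta>1 \<theta>2 f \<Gamma>"
    and ne: "sym_point \<theta>1 \<noteq> sym_point \<theta>2"
    and H: "H = q * Re (sym_point \<theta>1)"
    and inner: "\<And>z. inner (f z) (f 0) = (1 + H) / 2 * cos (sqrt (2 - 2 * H) * Re z) + (1 - H) / 2 * cos (sqrt (2 + 2 * H) * Im z)"
  shows "coprime l0 l2" "0 < l0" "l0 < l2" "sqrt ((1 + H) / 2) = real l0 / real l2"
    "\<gamma> \<in> \<Gamma> \<longleftrightarrow> (\<exists>a b::int. sqrt (2 - 2 * H) * Re \<gamma> = 2 * pi * of_int a \<and> Im \<gamma> = pi * real l2 * of_int b)"
proof -
  define \<zeta>1 where "\<zeta>1 = sym_point \<theta>1"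
  define \<zeta>2 where "\<zeta>2 = sym_point \<theta>2"
  obtain c T where q: "\<bar>q\<bar> = 1" and inv: "\<zeta>2 = inverse \<zeta>1" and type: "flat_torus_type (of_real (sgn q)) \<zeta>1 \<zeta>2 l0 0 l2"
    and c: "c \<noteq> 0" and T: "orthogonal_transformation T" and fT: "\<And>z. f (c * z) = T (flat_immersion \<zeta>1 \<zeta>2 z)"
    and \<Gamma>: "\<Gamma> = (\<lambda>\<gamma>. c * \<gamma>) ` flat_lattice (of_real (sgn q)) \<zeta>1 \<zeta>2"
    using flat unfolding flat_revolution_torus_def Let_def \<zeta>1_def \<zeta>2_def by blast
  have "cmod \<zeta>1 = 1" by (simp add: \<zeta>1_def sym_point_def)
  then obtain C S where CS: "C^2 + S^2 = (1::real)" "0 < C" "S \<noteq> 0" and m: "csqrt \<zeta>1 = Complex C S" "csqrt \<zeta>2 = Complex C (- S)"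
    using csqrt_conjugate_pair[OF inv] ne unfolding \<zeta>1_def \<zeta>2_def by metis
  note ratio = flat_torus_type_ratio[OF type q m CS]
  show "coprime l0 l2" "0 < l0" "l0 < l2" by (rule ratio)+
  have m2: "(Complex C S)^2 = \<zeta>1" "(Complex C (- S))^2 = \<zeta>2" unfolding m[symmetric] by simp_all
  have cm: "cmod (Complex C S) = 1" "cmod (Complex C (- S)) = 1" using CS(1) by (simp_all add: complex_norm)
  have "Re \<zeta>1 = C^2 - S^2" unfolding m2(1)[symmetric] by (simp add: power2_eq_square)
  then have H': "H = q * (C^2 - S^2)" unfolding H \<zeta>1_def by simp
  have qc: "q = 1 \<or> q = -1" using q by auto
  have half: "(1 + H) / 2 = (if q = 1 then C^2 else S^2)" using qc CS(1) unfolding H' by auto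
  show "sqrt ((1 + H) / 2) = real l0 / real l2"
    unfolding half ratio(4) using CS(2) by simp
  have eq: "(1 + H) / 2 * cos (sqrt (2 - 2 * H) * (Re c * x - Im c * y)) + (1 - H) / 2 * cos (sqrt (2 + 2 * H) * (Re c * y + Im c * x))
        = S^2 * cos (4 * pi * C * x) + C^2 * cos (4 * pi * S * y)" for x y
  proof -
    let ?z = "Complex x y"
    have "inner (f (c * ?z)) (f (c * 0)) = inner (flat_immersion \<zeta>1 \<zeta>2 ?z) (flat_immersion \<zeta>1 \<zeta>2 0)"
      unfolding fT using T by (simp add: orthogonal_transformation_def)
    also have "\<dots> = cos (2 * pi * (C * x + S * y)) * cos (2 * pi * (C * x - S * y)) + sin (2 * pi * (C * x + S * y)) * sin (2 * pi * (C * x - S * y)) * (C^2 - S^2)"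
      unfolding flat_immersion_inner_0[OF m2(1) cm(1) m2(2) cm(2)]
      by (simp add: pairing_def power2_eq_square algebra_simps)
    also have "\<dots> = (cos u * cos w + sin u * sin w) * C^2 + (cos u * cos w - sin u * sin w) * S^2"
      if "u = 2 * pi * (C * x + S * y)" "w = 2 * pi * (C * x - S * y)" for u w
    proof -
      have "C^2 = 1 - S^2" using CS(1) by simp
      then show ?thesis unfolding that[symmetric] by algebra
    qed
    also have "(cos u * cos w + sin u * sin w) * C^2 + (cos u * cos w - sin u * sin w) * S^2 =
        S^2 * cos (u + w) + C^2 * cos (u - w)" for u w
      by (simp add: cos_add cos_diff)
    finally have "inner (f (c * ?z)) (f 0) = S^2 * cos (2 * pi * (C * x + S * y) + 2 * pi * (C * x - S * y))
        + C^2 * cos (2 * pi * (C * x + S * y) - 2 * pi * (C * x - S * y))" by simp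
    also have "2 * pi * (C * x + S * y) + 2 * pi * (C * x - S * y) = 4 * pi * C * x" by algebra
    also have "2 * pi * (C * x + S * y) - 2 * pi * (C * x - S * y) = 4 * pi * S * y" by algebra
    finally show ?thesis using inner[of "c * ?z"] by (simp add: mult.commute)
  qed
  have dir: "if q = 1 then Re c = 0 \<and> \<bar>Im c\<bar> = 2 * pi else Im c = 0 \<and> \<bar>Re c\<bar> = 2 * pi"
    by (rule flat_scaling[OF CS q H' ratio(1) _ ratio(4) eq]) (use ratio(3) in simp)
  have lat: "z \<in> flat_lattice (of_real (sgn q)) \<zeta>1 \<zeta>2 \<longleftrightarrow>
      2 * C * Re z \<in> \<int> \<and> 2 * S * Im z \<in> \<int> \<and> (if q = 1 then 2 * Re z \<in> \<int> else 2 * Im z \<in> \<int>)" for z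
  proof -
    have "(Complex C S + Complex C (- S)) / 2 = Complex C 0" "(Complex C S - Complex C (- S)) / 2 = Complex 0 S"
      by (simp_all add: complex_eq_iff)
    then show ?thesis using qc unfolding flat_lattice_def Let_def m
      by (auto simp: pairing_def mult_ac)
  qed
  have tw: "(\<exists>a::int. u = 2 * pi * of_int a) \<longleftrightarrow> t \<in> \<int>" if "\<bar>u\<bar> = 2 * pi * \<bar>t\<bar>" for u t :: real
  proof -
    have twi: "(\<exists>a::int. 2 * pi * r = 2 * pi * of_int a) \<longleftrightarrow> r \<in> \<int>" for r :: real by (auto simp: Ints_def)
    have "u = 2 * pi * t \<or> u = 2 * pi * (- t)" using that by (auto simp: abs_if split: if_splits)
    then show ?thesis
    proof
      assume "u = 2 * pi * t"
      then show ?thesis by (auto simp: Ints_def)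
    next
      assume u: "u = 2 * pi * (- t)"
      show ?thesis unfolding u twi by simp
    qed
  qed
  have tb: "(\<exists>b::int. u = pi * real l2 * of_int b) \<longleftrightarrow> (\<exists>b::int. 2 * t = real l2 * of_int b)" if "\<bar>u\<bar> = 2 * pi * \<bar>t\<bar>" for u t :: real
  proof -
    have tbi: "(\<exists>b::int. pi * r = pi * real l2 * of_int b) \<longleftrightarrow> (\<exists>b::int. r = real l2 * of_int b)" for r :: real
      by (auto simp: mult.assoc)
    have "u = pi * (2 * t) \<or> u = pi * (- (2 * t))" using that by (auto simp: abs_if split: if_splits)
    then show ?thesis
    proof
      assume "u = pi * (2 * t)"
      then show ?thesis by (auto simp: mult.assoc)
    next
      assume u: "u = pi * (- (2 * t))"
      have "(\<exists>b::int. u = pi * real l2 * of_int b) \<longleftrightarrow> (\<exists>b::int. - (2 * t) = real l2 * of_int b)"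
        unfolding u tbi by simp
      also have "\<dots> \<longleftrightarrow> (\<exists>b::int. 2 * t = real l2 * of_int b)"
        by (metis minus_mult_right of_int_minus minus_equation_iff)
      finally show ?thesis .
    qed
  qed
  define z where "z = \<gamma> / c"
  have \<gamma>z: "\<gamma> = c * z" using c by (simp add: z_def)
  have "\<gamma> \<in> \<Gamma> \<longleftrightarrow> z \<in> flat_lattice (of_real (sgn q)) \<zeta>1 \<zeta>2"
    unfolding \<Gamma> \<gamma>z using c by (auto simp: image_iff)
  also have "\<dots> \<longleftrightarrow> (\<exists>a b::int. sqrt (2 - 2 * H) * Re \<gamma> = 2 * pi * of_int a \<and> Im \<gamma> = pi * real l2 * of_int b)"
  proof (cases "q = 1")
    case True
    then have cc: "Re c = 0" "\<bar>Im c\<bar> = 2 * pi" using dir by auto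
    have "2 - 2 * H = (2 * S)^2" unfolding H' True using CS(1) by (simp add: power_mult_distrib)
    then have s: "sqrt (2 - 2 * H) = 2 * \<bar>S\<bar>" by (simp only: real_sqrt_abs abs_mult abs_numeral)
    have "\<bar>sqrt (2 - 2 * H) * Re \<gamma>\<bar> = 2 * pi * \<bar>2 * S * Im z\<bar>" "\<bar>Im \<gamma>\<bar> = 2 * pi * \<bar>Re z\<bar>"
      unfolding s \<gamma>z using cc by (simp_all add: abs_mult)
    then have "(\<exists>a b::int. sqrt (2 - 2 * H) * Re \<gamma> = 2 * pi * of_int a \<and> Im \<gamma> = pi * real l2 * of_int b)
        \<longleftrightarrow> 2 * S * Im z \<in> \<int> \<and> (\<exists>b::int. 2 * Re z = real l2 * of_int b)"
      using tw tb by blast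
    also have "(\<exists>b::int. 2 * Re z = real l2 * of_int b) \<longleftrightarrow> 2 * Re z \<in> \<int> \<and> 2 * C * Re z \<in> \<int>"
      by (rule coprime_multiples[symmetric]) (use ratio True CS(2) in auto)
    finally show ?thesis unfolding lat using True by auto
  next
    case False
    then have cc: "Im c = 0" "\<bar>Re c\<bar> = 2 * pi" and "q = -1" using dir qc by auto
    have "2 - 2 * H = (2 * C)^2" unfolding H' \<open>q = -1\<close> using CS(1) by (simp add: power_mult_distrib)
    then have s: "sqrt (2 - 2 * H) = 2 * C" using CS(2) by (simp only: real_sqrt_abs abs_mult abs_numeral abs_of_pos)
    have "\<bar>sqrt (2 - 2 * H) * Re \<gamma>\<bar> = 2 * pi * \<bar>2 * C * Re z\<bar>" "\<bar>Im \<gamma>\<bar> = 2 * pi * \<bar>Im z\<bar>"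
      unfolding s \<gamma>z using cc CS(2) by (simp_all add: abs_mult)
    then have "(\<exists>a b::int. sqrt (2 - 2 * H) * Re \<gamma> = 2 * pi * of_int a \<and> Im \<gamma> = pi * real l2 * of_int b)
        \<longleftrightarrow> 2 * C * Re z \<in> \<int> \<and> (\<exists>b::int. 2 * Im z = real l2 * of_int b)"
      using tw tb by blast
    also have "(\<exists>b::int. 2 * Im z = real l2 * of_int b) \<longleftrightarrow> 2 * Im z \<in> \<int> \<and> 2 * S * Im z \<in> \<int>"
      by (rule coprime_multiples[symmetric]) (use ratio False in auto)
    finally show ?thesis unfolding lat using False by auto
  qed
  finally show "\<gamma> \<in> \<Gamma> \<longleftrightarrow> (\<exists>a b::int. sqrt (2 - 2 * H) * Re \<gamma> = 2 * pi * of_int a \<and> Im \<gamma> = pi * real l2 * of_int b)" .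
qed

section \<open>Families of tori of revolution\<close>

lemma sym_points_inverse:
  assumes "sym_point \<theta>2 = inverse (sym_point \<theta>1)"
  shows "sin (\<theta>1 + \<theta>2) = 0" "(cos (\<theta>1 + \<theta>2))^2 = 1"
    "Re (sym_point \<theta>1) = cos (\<theta>1 + \<theta>2) * cos (\<theta>1 - \<theta>2)"
    "hopf q \<theta>1 \<theta>2 = of_real (- (q * cos (\<theta>1 + \<theta>2) * sin (\<theta>1 - \<theta>2)))"
proof -
  have "cis (2 * \<theta>1) * cis (2 * \<theta>2) = 1"
    using assms unfolding sym_point_def by (simp add: cis_inverse cis_mult)
  then have "Re (cis (2 * \<theta>1 + 2 * \<theta>2)) = 1" by (simp add: cis_mult)
  then have "cos (2 * (\<theta>1 + \<theta>2)) = 1" by (simp add: distrib_left)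
  then show sin0: "sin (\<theta>1 + \<theta>2) = 0" unfolding cos_double_sin by simp
  then show "(cos (\<theta>1 + \<theta>2))^2 = 1" by (simp add: cos_squared_eq)
  have "2 * \<theta>1 = (\<theta>1 + \<theta>2) + (\<theta>1 - \<theta>2)" by simp
  then have dbl: "cos (2 * \<theta>1) = cos (\<theta>1 + \<theta>2) * cos (\<theta>1 - \<theta>2)" "sin (2 * \<theta>1) = cos (\<theta>1 + \<theta>2) * sin (\<theta>1 - \<theta>2)"
    using sin0 by (simp_all only: cos_add sin_add)
  then show "Re (sym_point \<theta>1) = cos (\<theta>1 + \<theta>2) * cos (\<theta>1 - \<theta>2)" by (simp add: sym_point_def)
  have "inverse (sym_point \<theta>2) - inverse (sym_point \<theta>1) = cis (2 * \<theta>1) - cis (- (2 * \<theta>1))"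
    using assms unfolding sym_point_def by (simp add: cis_inverse)
  also have "\<dots> = 2 * \<i> * of_real (sin (2 * \<theta>1))" by (simp add: complex_eq_iff)
  finally show "hopf q \<theta>1 \<theta>2 = of_real (- (q * cos (\<theta>1 + \<theta>2) * sin (\<theta>1 - \<theta>2)))"
    unfolding hopf_def dbl(2) by (simp add: complex_eq_iff)
qed

text \<open>The sign of \<open>q k\<close> is absorbed into \<open>h\<close>, so that only \<open>\<bar>q\<bar>\<close> and this signed \<open>h\<close> matter.\<close>

definition signed_h :: "real \<Rightarrow> real \<Rightarrow> real \<Rightarrow> real" where
  "signed_h q \<theta>1 \<theta>2 = sgn (q * cos (\<theta>1 + \<theta>2)) * cos (\<theta>1 - \<theta>2)"

text \<open>Multiplying both cos \<phi> and sin \<phi> by the sign \<sigma> of q k leaves the metric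
  and cot \<phi> sin^2 \<phi> = sin \<phi> cos \<phi> unchanged and turns the Hopf coefficient - q k
  sin \<phi> into - \<bar>q\<bar> s. The function dn sees only q^2.\<close>

lemma revolution_surface_of_immersion:
  assumes imm: "equivariant_cmc_immersion q \<theta>1 \<theta>2 f" and inv: "sym_point \<theta>2 = inverse (sym_point \<theta>1)"
    and ne: "sym_point \<theta>1 \<noteq> sym_point \<theta>2" and q: "q \<in> {-1..1} - {0}"
  obtains N where "revolution_surface f N \<bar>q\<bar> (signed_h q \<theta>1 \<theta>2) (sgn (q * cos (\<theta>1 + \<theta>2)) * sin (\<theta>1 - \<theta>2))"
proof -
  define \<phi> where "\<phi> = \<theta>1 - \<theta>2"
  define \<sigma> where "\<sigma> = sgn (q * cos (\<theta>1 + \<theta>2))"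
  note sp = sym_points_inverse[OF inv]
  have "q * cos (\<theta>1 + \<theta>2) \<noteq> 0" using q sp(2) by auto
  then have \<sigma>: "\<sigma> = 1 \<or> \<sigma> = -1" by (simp add: \<sigma>_def sgn_if)
  have k: "\<bar>cos (\<theta>1 + \<theta>2)\<bar> = 1" using sp(2) by (simp add: power2_eq_1_iff) linarith
  have p: "q * cos (\<theta>1 + \<theta>2) = \<sigma> * \<bar>q\<bar>"
    unfolding \<sigma>_def using k by (metis abs_mult mult.right_neutral sgn_mult_abs)
  obtain N where f: "smooth_map f" "range f \<subseteq> sphere 0 1" "unit_normal_field f N" and
    forms: "\<And>z w. first_form f z w = (sin \<phi>)^2 * (jacobi_dn (Im z) (1 - q^2))^2 * (cmod w)^2"
      "\<And>z w. second_form f N z w = cot \<phi> * (sin \<phi>)^2 * (jacobi_dn (Im z) (1 - q^2))^2 * (cmod w)^2 + Re (hopf q \<theta>1 \<theta>2 * w^2)"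
    using imm unfolding equivariant_cmc_immersion_def Let_def \<phi>_def by blast
  have s: "sin \<phi> \<noteq> 0"
  proof
    assume "sin \<phi> = 0"
    moreover have "2 * \<theta>1 = 2 * \<theta>2 + 2 * \<phi>" by (simp add: \<phi>_def)
    moreover have "cis (2 * \<phi>) = 1"
      using \<open>sin \<phi> = 0\<close> by (simp add: complex_eq_iff cos_double_sin sin_double)
    ultimately have "cis (2 * \<theta>1) = cis (2 * \<theta>2)" by (simp add: cis_mult[symmetric])
    then show False using ne by (simp add: sym_point_def)
  qed
  have dn: "dn \<bar>q\<bar> y = jacobi_dn y (1 - q^2)" for y by (simp add: dn_def)
  have "revolution_surface f N \<bar>q\<bar> (\<sigma> * cos \<phi>) (\<sigma> * sin \<phi>)"
  proof
    show "smooth_map f" "range f \<subseteq> sphere 0 1" "unit_normal_field f N" by (rule f)+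
    show "0 < \<bar>q\<bar>" "\<bar>q\<bar> \<le> 1" using q by auto
    show "\<sigma> * sin \<phi> \<noteq> 0" using \<sigma> s by auto
    have \<sigma>2: "\<sigma>^2 = 1" using \<sigma> by auto
    show "(\<sigma> * sin \<phi>)^2 = 1 - (\<sigma> * cos \<phi>)^2" unfolding power_mult_distrib \<sigma>2 by (simp add: sin_squared_eq)
    show "first_form f z w = (\<sigma> * sin \<phi>)^2 * (dn \<bar>q\<bar> (Im z))^2 * (cmod w)^2" for z w
      unfolding forms dn power_mult_distrib \<sigma>2 by simp
    show "second_form f N z w = \<sigma> * sin \<phi> * (\<sigma> * cos \<phi> * (dn \<bar>q\<bar> (Im z))^2 * (cmod w)^2 - \<bar>q\<bar> * Re (w^2))" for z w
    proof -
      have "cot \<phi> * (sin \<phi>)^2 = sin \<phi> * cos \<phi>" using s by (simp add: cot_def power2_eq_square)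
      moreover have "Re (hopf q \<theta>1 \<theta>2 * w^2) = - (\<sigma> * \<bar>q\<bar> * sin \<phi>) * Re (w^2)"
        unfolding sp(4) p \<phi>_def[symmetric] by (simp only: Re_complex_of_real Im_complex_of_real times_complex.sel)
      ultimately show ?thesis unfolding forms dn using \<sigma>2 by algebra
    qed
  qed
  then show ?thesis using that unfolding signed_h_def \<sigma>_def \<phi>_def by blast
qed

lemma flow_q_circle:
  assumes "\<bar>q\<bar> = 1" 
  shows "flow_q q k h = pi / 2 * (q * k - h)"
proof -
  have "q^2 = 1" using assms by (metis abs_power2 power2_abs power_one)
  then show ?thesis unfolding flow_q_def Let_def by (simp add: elliptic_E_0 elliptic_K_0 power2_eq_square algebra_simps)
qed

section \<open>Continuity arguments along a family\<close>

lemma continuous_Ints_constant: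
  fixes g :: "real \<Rightarrow> real"
  assumes "connected I" "continuous_on I g" "\<And>t. t \<in> I \<Longrightarrow> g t \<in> \<int>" "t0 \<in> I" "t \<in> I"
  shows "g t = g t0"
proof -
  have "g constant_on I"
  proof (rule continuous_discrete_range_constant[OF assms(1,2)])
    fix x assume x: "x \<in> I"
    have "1 \<le> norm (g y - g x)" if "y \<in> I" "g y \<noteq> g x" for y
    proof -
      have "g y \<in> \<int>" "g x \<in> \<int>" using assms(3) x that(1) by auto
      then obtain i j :: int where i: "g y = of_int i" and j: "g x = of_int j" by (auto elim!: Ints_cases)
      have "i \<noteq> j" using that(2) unfolding i j by simp
      then have "1 \<le> \<bar>i - j\<bar>" by linarith
      then have "(1::real) \<le> of_int \<bar>i - j\<bar>" by linarith
      then show ?thesis by (simp add: i j)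
    qed
    then show "\<exists>e>0. \<forall>y. y \<in> I \<and> g y \<noteq> g x \<longrightarrow> e \<le> norm (g y - g x)" by (intro exI[of _ 1]) auto
  qed
  then show ?thesis using assms(4,5) unfolding constant_on_def by metis
qed

text \<open>Where \<open>h = 0\<close> a half period turns by more than a right angle, so a family that winds exactly once
  never crosses \<open>h = 0\<close>.\<close>

lemma winding_once_persists:
  fixes P H :: "real \<Rightarrow> real"
  assumes I: "connected I" "continuous_on I P" "continuous_on I H" and l: "2 \<le> (l::nat)"
    and P: "\<And>t. t \<in> I \<Longrightarrow> 0 < P t \<and> P t \<le> 1" and H: "\<And>t. t \<in> I \<Longrightarrow> \<bar>H t\<bar> < 1"
    and int: "\<And>t. t \<in> I \<Longrightarrow> H t < P t \<Longrightarrow> \<exists>n::int. half_turn (P t) (H t) = pi * of_int n / real l"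
    and t1: "t1 \<in> I" "H t1 < P t1" "half_turn (P t1) (H t1) = pi / real l" and t: "t \<in> I"
  shows "H t < 0 \<and> half_turn (P t) (H t) = pi / real l"
proof -
  \<comment> \<open>Truncating \<open>H\<close> at 0 keeps the argument in the region h < q, so G is
    continuous on all of I; it agrees with the half turn wherever \<open>H\<close> is
    negative.\<close>
  define G where "G t = half_turn (P t) (min (H t) 0)" for t
  have contG: "continuous_on I G"
  proof -
    have "continuous_on I (\<lambda>t. (P t, min (H t) 0))" using I by (intro continuous_intros)
    moreover have "0 < P t \<and> P t \<le> 1 \<and> \<bar>min (H t) 0\<bar> < 1 \<and> min (H t) 0 < P t" if "t \<in> I" for t
      using P[OF that] H[OF that] by (auto simp: min_def)
    then have "(\<lambda>t. (P t, min (H t) 0)) ` I \<subseteq> {(q, h). 0 < q \<and> q \<le> 1 \<and> \<bar>h\<bar> < 1 \<and> h < q}"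
      by auto
    ultimately have "continuous_on I (\<lambda>t. case (P t, min (H t) 0) of (q, h) \<Rightarrow> half_turn q h)"
      by (rule continuous_on_compose2[OF half_turn_continuous])
    then show ?thesis unfolding G_def[abs_def] by simp
  qed
  have pl: "0 < pi / real l" "pi / real l \<le> pi / 2" using l by (simp, intro divide_left_mono) auto
  have neg: "G t = half_turn (P t) (H t)" if "H t < 0" for t using that by (simp add: G_def)
  have not_mid: False if "t \<in> I" "0 \<le> H t" "H t < P t" "half_turn (P t) (H t) \<le> pi / real l" for t
    using half_turn_lower_bound[of "P t" "H t"] P[OF that(1)] that pl by auto
  have alt: "G t = pi / real l \<or> 2 * (pi / real l) \<le> G t" if "t \<in> I" "H t < 0" for t
  proof -
    have lt: "H t < P t" using P[OF that(1)] that(2) by linarith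
    note ex = int[OF that(1) lt]
    obtain n :: int where n: "half_turn (P t) (H t) = pi * of_int n / real l" using ex by blast
    have "0 < half_turn (P t) (H t)" using half_turn_pos P H that(1) lt by blast
    then have "0 < n" unfolding n using l by (simp add: zero_less_divide_iff zero_less_mult_iff)
    then consider "n = 1" | "2 \<le> n" by linarith
    then show ?thesis
    proof cases
      case 1 then show ?thesis using neg[OF that(2)] n by simp
    next
      case 2
      then have "pi * 2 / real l \<le> pi * of_int n / real l" by (intro divide_right_mono mult_left_mono) auto
      then show ?thesis using neg[OF that(2)] n by (simp add: mult.commute)
    qed
  qed
  \<comment> \<open>For H < 0 the half turn is a positive multiple of pi / l, so it equals pi / l or
    is at least twice that. This gap lets both pieces be closed, and the lower bound for 0 \<le> h <
    q keeps them apart at H = 0.\<close>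
  let ?A = "{t \<in> I. H t \<le> 0} \<inter> {t \<in> I. G t \<le> pi / real l}"
  let ?B = "{t \<in> I. 0 \<le> H t} \<union> {t \<in> I. 2 * (pi / real l) \<le> G t}"
  have pre: "closedin (top_of_set I) {t \<in> I. u t \<in> S}" if "continuous_on I u" "closed S" for u :: "real \<Rightarrow> real" and S
    using continuous_closedin_preimage[OF that] by (simp add: vimage_def Int_def)
  have cl: "closedin (top_of_set I) ?A" "closedin (top_of_set I) ?B"
    using pre[OF I(3) closed_atMost[of 0]] pre[OF contG closed_atMost[of "pi / real l"]]
      pre[OF I(3) closed_atLeast[of 0]] pre[OF contG closed_atLeast[of "2 * (pi / real l)"]]
    unfolding atMost_iff atLeast_iff by (blast intro: closedin_Int closedin_Un)+
  have "?A \<inter> ?B = {}"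
  proof (rule ccontr)
    assume "?A \<inter> ?B \<noteq> {}"
    then obtain t where t: "t \<in> I" "H t \<le> 0" "G t \<le> pi / real l" "0 \<le> H t \<or> 2 * (pi / real l) \<le> G t" by blast
    then have "H t = 0" using pl by linarith
    then have "half_turn (P t) (H t) \<le> pi / real l" using t(3) by (simp add: G_def)
    then show False using not_mid[OF t(1)] P[OF t(1)] \<open>H t = 0\<close> by simp
  qed
  moreover have "I \<subseteq> ?A \<union> ?B"
  proof
    fix t assume "t \<in> I"
    then show "t \<in> ?A \<union> ?B" using alt[of t] by (cases "H t < 0") auto
  qed
  moreover have "t1 \<in> ?A"
  proof -
    have "H t1 < 0" using not_mid[OF t1(1) _ t1(2)] t1(3) by force
    then show ?thesis using t1 neg[of t1] by simp
  qed
  ultimately have "?B = {}"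
    using I(1) cl unfolding connected_closedin by blast
  then have "H t < 0" "G t < 2 * (pi / real l)" using t by force+
  then show ?thesis using alt[OF t] neg[of t] by auto
qed


lemma (in revolution_surface) inner_at_circle:
  assumes "q = 1"
  shows "inner (f z) (f 0) = (1 + h) / 2 * cos (sqrt (2 - 2 * h) * Re z) + (1 - h) / 2 * cos (sqrt (2 + 2 * h) * Im z)"
proof -
  have h: "h \<noteq> q" "-1 < h" "h < 1" using h_abs_less assms by auto
  have dn1: "dn q y = 1" for y
    using dn_bounds[OF q, of y] dn_pos[OF q, of y] assms by (simp add: power2_eq_1_iff)
  have c2: "c = sqrt (2 - 2 * h)" by (simp add: freq_def assms)
  have "(radius q h y)^2 = (1 - h^2) / (1 + q^2 - 2 * q * h)" for y
    unfolding radius_def dn1 power_divide c_sq using abs_less_1_sq[OF h_abs_less] by simp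
  then have "(radius q h y)^2 = (1 - h^2) / (2 - 2 * h)" for y using assms by simp
  moreover have "(1 - h^2) / (2 - 2 * h) = (1 + h) / 2" using h by (simp add: field_simps power2_eq_square)
  ultimately have r: "(radius q h y)^2 = (1 + h) / 2" for y by simp
  have r': "radius q h y * radius q h y' = (1 + h) / 2" for y y'
    using r[of y] by (simp add: radius_def dn1 power2_eq_square)
  have rho: "sqrt (1 - (radius q h y)^2) * sqrt (1 - (radius q h y')^2) = (1 - h) / 2" for y y'
    unfolding r using h by (simp add: field_simps)
  define D where "D = ang_density q h 1"
  have "angle q h y - D * y = angle q h 0 - D * 0" for y
  proof (rule DERIV_const_diff)
    show "(angle q h has_real_derivative D) (at x)" for x
      using angle_deriv[OF q h_abs_less h(1), of x] by (simp add: D_def dn1)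
    show "((\<lambda>y. D * y) has_real_derivative D) (at x)" for x
      by (auto intro!: derivative_eq_intros)
  qed
  then have ang: "angle q h y = D * y" for y using angle_0[OF q h_abs_less h(1)] by simp
  \<comment> \<open>The angle is linear in y, so its slope is read off from the half turn at K' =
    pi/2.\<close>
  have "D * (pi / 2) = pi * sqrt ((1 + h) / 2)"
    using ang[of "Kc q"] angle_K[OF q h_abs_less h(1)] half_turn_1[OF h_abs_less] assms by (simp add: elliptic_K_0)
  then have "D = 2 * sqrt ((1 + h) / 2)" by simp
  also have "\<dots> = sqrt (4 * ((1 + h) / 2))" unfolding real_sqrt_mult by simp
  finally have D: "D = sqrt (2 + 2 * h)" by (simp add: algebra_simps)
  show ?thesis unfolding inner_f_f[OF h(1)] r' rho ang D c2 by simp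
qed

text \<open>Rescaling the two axes independently is real-linear and carries one basis to the other,
  hence one lattice onto the other; the numbers of rotations and of lobes are preserved.\<close>

lemma lattice_transport:
  fixes w1 w2 w1' w2' :: complex
  assumes pos: "0 < c" "0 < K" "0 < c'" "0 < K'"
    and w1: "c * Re w1 = c' * Re w1'" "Im w1 / K = Im w1' / K'"
    and w2: "c * Re w2 = c' * Re w2'" "Im w2 / K = Im w2' / K'"
    and \<Gamma>': "\<And>\<gamma>. \<gamma> \<in> lattice w1' w2' \<longleftrightarrow> (\<exists>a b::int. c' * Re \<gamma> = 2 * pi * of_int a \<and> Im \<gamma> = 2 * K' * real l * of_int b)"
  shows "\<gamma> \<in> lattice w1 w2 \<longleftrightarrow> (\<exists>a b::int. c * Re \<gamma> = 2 * pi * of_int a \<and> Im \<gamma> = 2 * K * real l * of_int b)"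
proof -
  define T where "T z = Complex (c * Re z / c') (K' * Im z / K)" for z
  have Tw: "T w1 = w1'" "T w2 = w2'" using pos w1 w2 by (simp_all add: T_def complex_eq_iff field_simps)
  have lin: "T (of_int m * w1 + of_int n * w2) = of_int m * w1' + of_int n * w2'" for m n
    unfolding Tw[symmetric] using pos by (simp add: T_def complex_eq_iff field_simps)
  have inj: "T z = T w \<longleftrightarrow> z = w" for z w using pos by (auto simp: T_def complex_eq_iff)
  have "\<gamma> \<in> lattice w1 w2 \<longleftrightarrow> T \<gamma> \<in> lattice w1' w2'"
    unfolding lattice_def mem_Collect_eq lin[symmetric] inj by blast
  also have "\<dots> \<longleftrightarrow> (\<exists>a b::int. c * Re \<gamma> = 2 * pi * of_int a \<and> K' * Im \<gamma> / K = 2 * K' * real l * of_int b)"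
    unfolding \<Gamma>' using pos by (simp add: T_def)
  also have "\<dots> \<longleftrightarrow> (\<exists>a b::int. c * Re \<gamma> = 2 * pi * of_int a \<and> Im \<gamma> = 2 * K * real l * of_int b)"
    using pos by (simp add: field_simps)
  finally show ?thesis .
qed

text \<open>Where \<bar>q\<bar> = 1, the flow gives q q' = (pi/2) (\<kappa> - q h), which has the
  sign of \<kappa> because \<bar>h\<bar> < 1. So \<bar>q\<bar> would exceed 1 immediately after such
  a parameter if \<kappa> = 1, and immediately before it if \<kappa> = -1. A single such parameter
  may be an endpoint of I, but of two of them one has room on the forbidden side.\<close>

lemma flat_parameter_unique:
  fixes q k h :: "real \<Rightarrow> real"
  assumes I: "is_interval I" and t: "t \<in> I" "\<bar>q t\<bar> = 1" and t': "t' \<in> I" "\<bar>q t'\<bar> = 1"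
    and q: "\<And>s. s \<in> I \<Longrightarrow> \<bar>q s\<bar> \<le> 1" and k: "\<And>s. s \<in> I \<Longrightarrow> k s = \<kappa>" "\<kappa>^2 = 1"
    and h: "\<And>s. s \<in> I \<Longrightarrow> \<bar>h s\<bar> < 1"
    and deriv: "\<And>s. s \<in> I \<Longrightarrow> (q has_real_derivative flow_q (q s) (k s) (h s)) (at s within I)"
  shows "t = t'"
proof -
  \<comment> \<open>The product \<open>q u * q s\<close> with fixed \<open>u\<close> is a
    differentiable substitute for \<bar>q s\<bar> near a parameter \<open>u\<close> with \<bar>q
    u\<bar> = 1.\<close>
  have max1: "q u * q s \<le> 1" if "s \<in> I" "u \<in> I" for s u
  proof -
    have "q u * q s \<le> \<bar>q u\<bar> * \<bar>q s\<bar>" by (simp add: abs_mult[symmetric])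
    also have "\<dots> \<le> 1 * 1" using q that by (intro mult_mono) auto
    finally show ?thesis by simp
  qed
  have dir: "((\<lambda>s. q u * q s) has_real_derivative pi / 2 * (\<kappa> - q u * h u)) (at u within I)"
    and sq: "q u * q u = 1" and lt: "\<bar>q u * h u\<bar> < 1" if "u \<in> I" "\<bar>q u\<bar> = 1" for u
  proof -
    show sq: "q u * q u = 1" using that(2) by (metis abs_mult_self_eq mult_1)
    have "q u * flow_q (q u) (k u) (h u) = pi / 2 * (q u * q u * \<kappa> - q u * h u)"
      unfolding flow_q_circle[OF that(2)] k(1)[OF that(1)] by (simp add: algebra_simps)
    then have "q u * flow_q (q u) (k u) (h u) = pi / 2 * (\<kappa> - q u * h u)" unfolding sq by simp
    then show "((\<lambda>s. q u * q s) has_real_derivative pi / 2 * (\<kappa> - q u * h u)) (at u within I)"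
      using DERIV_cmult[OF deriv[OF that(1)], of "q u"] by metis
    show "\<bar>q u * h u\<bar> < 1" using h[OF that(1)] that(2) by (simp add: abs_mult)
  qed
  have ordered: False if u: "u \<in> I" "\<bar>q u\<bar> = 1" and w: "w \<in> I" "\<bar>q w\<bar> = 1" and "u < w" for u w
  proof -
    have seg: "r \<in> I" if "u \<le> r" "r \<le> w" for r
      using I u(1) w(1) that unfolding is_interval_1 by blast
    have "\<kappa> = 1 \<or> \<kappa> = -1" using k(2) by (simp add: power2_eq_1_iff)
    then show False
    proof
      assume \<kappa>: "\<kappa> = 1"
      have "0 < pi / 2 * (\<kappa> - q u * h u)" using lt[OF u] \<kappa> by simp
      from has_real_derivative_pos_inc_right[OF dir[OF u] this]
      obtain d where d: "0 < d" "\<And>e. 0 < e \<Longrightarrow> u + e \<in> I \<Longrightarrow> e < d \<Longrightarrow> q u * q u < q u * q (u + e)" by blast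
      define e where "e = min (d / 2) (w - u)"
      have e: "0 < e" "e < d" "u + e \<le> w" using d(1) \<open>u < w\<close> by (auto simp: e_def min_def)
      then have "u + e \<in> I" by (intro seg) auto
      then show False using d(2)[OF e(1) _ e(2)] max1[of "u + e" u] u(1) sq[OF u] by fastforce
    next
      assume \<kappa>: "\<kappa> = -1"
      have "pi / 2 * (\<kappa> - q w * h w) < 0" using lt[OF w] \<kappa> by (intro mult_pos_neg) auto
      from has_real_derivative_neg_dec_left[OF dir[OF w] this]
      obtain d where d: "0 < d" "\<And>e. 0 < e \<Longrightarrow> w - e \<in> I \<Longrightarrow> e < d \<Longrightarrow> q w * q w < q w * q (w - e)" by blast
      define e where "e = min (d / 2) (w - u)"
      have e: "0 < e" "e < d" "u \<le> w - e" using d(1) \<open>u < w\<close> by (auto simp: e_def min_def)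
      then have "w - e \<in> I" by (intro seg) auto
      then show False using d(2)[OF e(1) _ e(2)] max1[of "w - e" w] w(1) sq[OF w] by fastforce
    qed
  qed
  show ?thesis using ordered[OF t t'] ordered[OF t' t] by (cases t t' rule: linorder_cases) auto
qed

theorem theorem5p6:
  fixes l0 l2 :: nat and f :: "complex \<Rightarrow> real ^ 4" and \<Gamma> :: "complex set"
  assumes "cmc_torus_of_revolution l0 l2 f \<Gamma>"
  shows "embedded_torus f \<Gamma> \<longleftrightarrow> l0 = 1"
proof -
  obtain I q \<theta>1 \<theta>2 F \<omega>1 \<omega>2 t0 t where
    fam: "cmc_torus_family I q \<theta>1 \<theta>2 F \<omega>1 \<omega>2" and
    inv: "\<And>s. s \<in> I \<Longrightarrow> sym_point (\<theta>2 s) = inverse (sym_point (\<theta>1 s))" and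
    t0: "t0 \<in> I" and t: "t \<in> I" and
    flat: "flat_revolution_torus l0 l2 (q t0) (\<theta>1 t0) (\<theta>2 t0) (F t0) (lattice (\<omega>1 t0) (\<omega>2 t0))" and
    f: "f = F t" and \<Gamma>: "\<Gamma> = lattice (\<omega>1 t) (\<omega>2 t)"
    using assms unfolding cmc_torus_of_revolution_def by blast
  define k where "k s = cos (\<theta>1 s + \<theta>2 s)" for s
  define h where "h s = cos (\<theta>1 s - \<theta>2 s)" for s
  have I: "is_interval I" and con\<theta>: "continuous_on I \<theta>1" "continuous_on I \<theta>2"
    and q: "\<And>s. s \<in> I \<Longrightarrow> q s \<in> {-1..1} - {0}"
    and ne: "\<And>s. s \<in> I \<Longrightarrow> sym_point (\<theta>1 s) \<noteq> sym_point (\<theta>2 s)"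
    and dq: "\<And>s. s \<in> I \<Longrightarrow> (q has_real_derivative flow_q (q s) (k s) (h s)) (at s within I)"
    and imm: "\<And>s. s \<in> I \<Longrightarrow> equivariant_cmc_immersion (q s) (\<theta>1 s) (\<theta>2 s) (F s)"
    and con\<omega>: "continuous_on I \<omega>1" "continuous_on I \<omega>2"
    and basis: "\<And>s. s \<in> I \<Longrightarrow> lattice_basis (\<omega>1 s) (\<omega>2 s)"
    and per: "\<And>s. s \<in> I \<Longrightarrow> lattice (\<omega>1 s) (\<omega>2 s) \<subseteq> periods (F s)"
    using fam unfolding cmc_torus_family_def Let_def k_def h_def by auto
  have conn: "connected I" using I is_interval_connected by blast
  define P where "P s = \<bar>q s\<bar>" for s
  define H where "H s = signed_h (q s) (\<theta>1 s) (\<theta>2 s)" for s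
  define c where "c s = freq (P s) (H s)" for s
  define K where "K s = Kc (P s)" for s
  have P: "0 < P s" "P s \<le> 1" if "s \<in> I" for s using q[OF that] by (auto simp: P_def)
  have k2: "(k s)^2 = 1" if "s \<in> I" for s unfolding k_def by (rule sym_points_inverse(2)[OF inv[OF that]])
  have surf: "\<exists>N s'. revolution_surface (F s) N (P s) (H s) s'" if "s \<in> I" for s
    using revolution_surface_of_immersion[OF imm[OF that] inv[OF that] ne[OF that] q[OF that]]
    unfolding P_def H_def by blast
  have H1: "\<bar>H s\<bar> < 1" if "s \<in> I" for s using surf[OF that] revolution_surface.h_abs_less by blast
  have qk: "q s * k s \<noteq> 0" if "s \<in> I" for s using q[OF that] k2[OF that] by auto
  have h1: "\<bar>h s\<bar> < 1" if "s \<in> I" for s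
    using H1[OF that] qk[OF that] unfolding H_def signed_h_def h_def[symmetric] k_def[symmetric]
    by (simp add: abs_mult abs_sgn_eq)
  have conq: "continuous_on I q" using dq by (rule DERIV_continuous_on)
  have conk: "continuous_on I k" unfolding k_def[abs_def] by (intro continuous_intros con\<theta>)
  have conP: "continuous_on I P" unfolding P_def[abs_def] by (intro continuous_intros conq)
  have conH: "continuous_on I H"
    unfolding H_def[abs_def] signed_h_def k_def[symmetric]
    using qk by (intro continuous_intros conq conk con\<theta>) auto
  have conc: "continuous_on I c" unfolding c_def[abs_def] freq_def by (intro continuous_intros conP conH)
  have conK: "continuous_on I K"
    unfolding K_def[abs_def] by (rule continuous_on_compose2[OF Kc_continuous conP]) (use P in auto)
  have cpos: "0 < c s" and Kpos: "0 < K s" if "s \<in> I" for s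
    unfolding c_def K_def using freq_sq(2)[OF H1[OF that]] Kc_pos[OF P[OF that]] by auto
  have k_const: "k s = k t0" if "s \<in> I" for s
  proof (rule continuous_Ints_constant[OF conn conk _ t0 that])
    fix r assume "r \<in> I"
    then have "k r = 1 \<or> k r = -1" using k2 by (simp add: power2_eq_1_iff)
    then show "k r \<in> \<int>" by auto
  qed
  have Pt0: "P t0 = 1" using flat unfolding flat_revolution_torus_def Let_def P_def by blast
  have unique: "s = t0" if "s \<in> I" "P s = 1" for s
    by (rule flat_parameter_unique[OF I that(1) _ t0 _ _ k_const k2[OF t0] h1 dq])
       (use that Pt0 P in \<open>auto simp: P_def\<close>)
  have Ht0: "H t0 = q t0 * Re (sym_point (\<theta>1 t0))"
  proof -
    have "\<bar>q t0 * k t0\<bar> = 1" using Pt0 k2[OF t0] by (simp add: P_def abs_mult power2_eq_1_iff) linarith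
    then have "sgn (q t0 * k t0) = q t0 * k t0" by (metis mult.right_neutral sgn_mult_abs)
    then show ?thesis
      unfolding sym_points_inverse(3)[OF inv[OF t0]] H_def signed_h_def k_def[symmetric] by simp
  qed
  obtain N0 s0 where "revolution_surface (F t0) N0 (P t0) (H t0) s0" using surf[OF t0] by blast
  note start = flat_start[OF flat ne[OF t0] Ht0 revolution_surface.inner_at_circle[OF this Pt0]]
  have l: "2 \<le> l2" using start(2,3) by simp
  have ct0: "c t0 = sqrt (2 - 2 * H t0)" by (simp add: c_def freq_def Pt0)
  have Kt0: "K t0 = pi / 2" unfolding K_def Pt0 by (rule Kc_1)
  have \<Gamma>0: "\<gamma> \<in> lattice (\<omega>1 t0) (\<omega>2 t0) \<longleftrightarrow>
      (\<exists>a b::int. c t0 * Re \<gamma> = 2 * pi * of_int a \<and> Im \<gamma> = 2 * K t0 * real l2 * of_int b)" for \<gamma>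
    unfolding start(5) ct0 Kt0 by simp
  \<comment> \<open>Away from t0 dn is not constant and periods consist of whole lobes; at t0 the
    same follows from the explicit flat lattice.\<close>
  have integral: "c s * Re \<gamma> / (2 * pi) \<in> \<int> \<and> Im \<gamma> / (2 * K s) \<in> \<int>"
    if s: "s \<in> I" and \<gamma>: "\<gamma> \<in> lattice (\<omega>1 s) (\<omega>2 s)" for s \<gamma>
  proof (cases "s = t0")
    case True
    then obtain a b :: int where "c t0 * Re \<gamma> = 2 * pi * of_int a" "Im \<gamma> = 2 * K t0 * real l2 * of_int b"
      using \<gamma> \<Gamma>0 by blast
    then have "c t0 * Re \<gamma> / (2 * pi) = of_int a" "Im \<gamma> / (2 * K t0) = of_int (int l2 * b)"
      using Kpos[OF t0] by simp_all
    then show ?thesis unfolding True by (metis Ints_of_int)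
  next
    case False
    then have "P s < 1" using unique[OF s] P[OF s] by force
    moreover obtain N s' where "revolution_surface (F s) N (P s) (H s) s'" using surf[OF s] by blast
    moreover have "\<gamma> \<in> periods (F s)" using per[OF s] \<gamma> by blast
    ultimately obtain a b :: int where "c s * Re \<gamma> = 2 * pi * of_int a" "Im \<gamma> = 2 * K s * of_int b"
      unfolding c_def K_def using revolution_surface.periods_integral by blast
    then have "c s * Re \<gamma> / (2 * pi) = of_int a" "Im \<gamma> / (2 * K s) = of_int b"
      using Kpos[OF s] by simp_all
    then show ?thesis by (metis Ints_of_int)
  qed
  have gens: "w1 \<in> lattice w1 w2" "w2 \<in> lattice w1 w2" for w1 w2
  proof -
    have "w1 = of_int 1 * w1 + of_int 0 * w2" "w2 = of_int 0 * w1 + of_int 1 * w2" by simp_all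
    then show "w1 \<in> lattice w1 w2" "w2 \<in> lattice w1 w2" unfolding lattice_def by blast+
  qed
  \<comment> \<open>In units of rotations and lobes the generators have integer coordinates that
    vary continuously, hence do not move. This also covers parameters with h \<ge> q.\<close>
  have rigid: "c s * Re (\<omega> s) = c t0 * Re (\<omega> t0)" "Im (\<omega> s) / K s = Im (\<omega> t0) / K t0"
    if "continuous_on I \<omega>" "\<And>s. s \<in> I \<Longrightarrow> \<omega> s \<in> lattice (\<omega>1 s) (\<omega>2 s)" "s \<in> I" for \<omega> s
  proof -
    have "continuous_on I (\<lambda>s. c s * Re (\<omega> s) / (2 * pi))"
      by (intro continuous_intros conc that(1)) auto
    from continuous_Ints_constant[OF conn this _ t0 that(3)]
    have "c s * Re (\<omega> s) / (2 * pi) = c t0 * Re (\<omega> t0) / (2 * pi)" using integral that(2) by blast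
    then show "c s * Re (\<omega> s) = c t0 * Re (\<omega> t0)" by simp
    have "continuous_on I (\<lambda>s. Im (\<omega> s) / (2 * K s))"
      by (intro continuous_intros conK that(1)) (use Kpos in force)
    from continuous_Ints_constant[OF conn this _ t0 that(3)]
    have "Im (\<omega> s) / (2 * K s) = Im (\<omega> t0) / (2 * K t0)" using integral that(2) by blast
    then show "Im (\<omega> s) / K s = Im (\<omega> t0) / K t0" by simp
  qed
  have \<Gamma>s: "\<gamma> \<in> lattice (\<omega>1 s) (\<omega>2 s) \<longleftrightarrow>
      (\<exists>a b::int. c s * Re \<gamma> = 2 * pi * of_int a \<and> Im \<gamma> = 2 * K s * real l2 * of_int b)" if s: "s \<in> I" for s \<gamma>
    by (rule lattice_transport[OF cpos[OF s] Kpos[OF s] cpos[OF t0] Kpos[OF t0]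
          rigid(1)[OF con\<omega>(1) gens(1) s] rigid(2)[OF con\<omega>(1) gens(1) s]
          rigid(1)[OF con\<omega>(2) gens(2) s] rigid(2)[OF con\<omega>(2) gens(2) s] \<Gamma>0])
  have closing: "\<exists>n::int. half_turn (P s) (H s) = pi * of_int n / real l2" if s: "s \<in> I" and "H s \<noteq> P s" for s
  proof -
    obtain N s' where rs: "revolution_surface (F s) N (P s) (H s) s'" using surf[OF s] by blast
    have "c s * Re (Complex 0 (2 * K s * real l2)) = 2 * pi * of_int 0"
      "Im (Complex 0 (2 * K s * real l2)) = 2 * K s * real l2 * of_int 1" by simp_all
    then have "Complex 0 (2 * K s * real l2) \<in> lattice (\<omega>1 s) (\<omega>2 s)" unfolding \<Gamma>s[OF s] by blast
    then have "Complex 0 (2 * Kc (P s) * real l2) \<in> periods (F s)" using per[OF s] unfolding K_def by blast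
    then show ?thesis using revolution_surface.half_turn_closing[OF rs that(2)] l by (metis less_le_trans zero_less_numeral)
  qed
  note persists = winding_once_persists[OF conn conP conH l]
  have ht0: "half_turn (P t0) (H t0) = pi * real l0 / real l2"
    unfolding Pt0 half_turn_1[OF H1[OF t0]] start(4) by simp
  have Ht0P: "H t0 < P t0" using H1[OF t0] Pt0 by simp
  obtain N s' where rs: "revolution_surface (F t) N (P t) (H t) s'" using surf[OF t] by blast
  note \<Gamma>t = \<Gamma>s[OF t, unfolded c_def K_def]
  show ?thesis unfolding f \<Gamma>
  proof
    assume "l0 = 1"
    then have "half_turn (P t0) (H t0) = pi / real l2" using ht0 by simp
    then have "H t < 0 \<and> half_turn (P t) (H t) = pi / real l2"
      using persists[of t0 t] P H1 closing t0 t Ht0P by (metis less_irrefl)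
    then show "embedded_torus (F t) (lattice (\<omega>1 t) (\<omega>2 t))"
      using revolution_surface.embedded_of_half_turn[OF rs l \<Gamma>t basis[OF t] per[OF t]] P(1)[OF t] by simp
  next
    assume emb: "embedded_torus (F t) (lattice (\<omega>1 t) (\<omega>2 t))"
    have "H t \<noteq> P t" using revolution_surface.not_embedded_axis[OF rs l \<Gamma>t] emb by blast
    then obtain n where n: "half_turn (P t) (H t) = pi * of_int n / real l2" using closing[OF t] by blast
    have "\<not> P t < H t" using revolution_surface.not_embedded_nodoid[OF rs l \<Gamma>t _ n] emb by blast
    then have HP: "H t < P t" using \<open>H t \<noteq> P t\<close> by simp
    have "0 < half_turn (P t) (H t)" by (rule half_turn_pos[OF P[OF t] H1[OF t] HP])
    then have "0 < n" unfolding n using l by (simp add: zero_less_divide_iff zero_less_mult_iff)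
    then obtain m where m: "n = int m" "0 < m" by (metis pos_int_cases)
    have "\<not> 2 \<le> m"
      using revolution_surface.not_embedded_multiple_winding[OF rs l \<Gamma>t \<open>H t \<noteq> P t\<close>, of m] n m(1) emb by auto
    then have "half_turn (P t) (H t) = pi / real l2" using n m by simp
    \<comment> \<open>Persistence is run backwards here, from the embedded member to the flat torus;
      no statement about families with l0 \<ge> 2 is needed.\<close>
    then have "half_turn (P t0) (H t0) = pi / real l2"
      using persists[of t t0] P H1 closing t0 t HP by (metis less_irrefl)
    then have "real l0 = 1" unfolding ht0 using l by simp
    then show "l0 = 1" by simp
  qed
qed

end
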